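(* Let $R$ be a commutative ring with identity, $\Gamma$ a monoid, $A$ a $\Gamma$-graded $R$-algebra and $B$ a $\Gamma$-algebra over $R$. Suppose that $N$ is a $B$-module which is flat and finitely generated over $R$, and such that for all $\beta\in\Gamma$ the $B$-module ${}_\beta N$ is projective. Then the functor $-\ltimes_\Gamma N\colon A\text{-}\Gamma\text{-gr}\to (A\ltimes_\Gamma B)\text{-}\Gamma\text{-gr}$ preserves minimal projective resolutions; that is, if $P_\bullet$ is a minimal projective resolution of $M$ in $A\text{-}\Gamma\text{-gr}$, then $P_\bullet\ltimes_\Gamma N$ is a minimal projective resolution of $M\ltimes_\Gamma N$ in $(A\ltimes_\Gamma B)\text{-}\Gamma\text{-gr}$.
   Context: Unadorned tensor products are over $R$; $e$ denotes the neutral element of $\Gamma$. A $\Gamma$-graded $R$-algebra is an associative $R$-algebra $A$ with identity $e_A$ together with an $R$-module decomposition $A=\bigoplus_{\gamma\in\Gamma}A_\gamma$ with $A_{\gamma_1}A_{\gamma_2}\subset A_{\gamma_1\gamma_2}$ and $e_A\in A_e$. A left $A$-module $M$ is $\Gamma$-graded if $M=\bigoplus_{\gamma\in\Gamma}M_\gamma$ with each $M_\gamma$ an $R$-submodule and $A_{\gamma_1}M_{\gamma_2}\subset M_{\gamma_1\gamma_2}$. $A\text{-}\Gamma\text{-gr}$ is the (abelian) category of left $\Gamma$-graded $A$-modules and $A$-module homomorphisms $f$ with $f(M_{1,\gamma})\subset M_{2,\gamma}$ for all $\gamma$. A $\Gamma$-algebra is an $R$-algebra $B$ with a right action of the monoid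 $\Gamma$, $(b,\gamma)\mapsto b^\gamma$ (so $b^{\alpha\beta}=(b^\alpha)^\beta$, $b^e=b$), such that each map $b\mapsto b^\gamma$ is an algebra homomorphism. $A\ltimes_\Gamma B$ is the $R$-module $A\otimes B$ with multiplication $(a\otimes b)(a'\otimes b')=aa'\otimes b^{\beta}b'$ for $a\in A_\alpha$, $a'\in A_\beta$, $b,b'\in B$; it is an $R$-algebra with identity $1_A\otimes 1_B$, and it is $\Gamma$-graded by $(A\ltimes_\Gamma B)_\gamma=A_\gamma\otimes B$. For a $\Gamma$-graded $A$-module $M$ and a $B$-module $N$, $M\ltimes_\Gamma N$ is the $\Gamma$-graded $A\ltimes_\Gamma B$-module $M\otimes N$ with action $(a\otimes b)(m\otimes x)=am\otimes b^{\gamma}x$ for $m\in M_\gamma$, and grading $(M\ltimes_\Gamma N)_\gamma=M_\gamma\otimes N$. On morphisms, $-\ltimes_\Gamma N$ sends $\varphi$ to $\varphi\otimes\mathrm{id}_N$. For $\beta\in\Gamma$, ${}_\beta N$ is the $B$-module with the same underlying abelian group as $N$ and action $b\cdot_\beta x=b^\beta x$. In an abelian category, a subobject $N'$ of $M'$ is superfluous if for every subobject $T$ of $M'$, $N'+T=M'$ implies $T=M'$. A projective resolution of $M$ is an exact complex $\cdots\to P_1\to P_0\to P_{-1}=M\to 0$ with differentials $d_k\colon P_{k+1}\to P_k$ ($k\ge -1$) and $P_k$ projective for $k\ge 0$; it is minimal if $\ker(d_k)$ is a superfluous subobject of $P_{k+1}$ for all $k\ge -1$. *)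

theory Defs
  imports "HOL-Algebra.Algebra"
begin

section \<open>Modules over non-commutative rings\<close>

text \<open>The library locale \<^locale>\<open>module\<close> requires a commutative ring of scalars.\<close>

locale left_module = A?: ring A + M?: abelian_group M
  for A :: "('a, 'y) ring_scheme" and M :: "('a, 'm, 'z) module_scheme" +
  assumes smult_closed:
      "\<lbrakk>a \<in> carrier A; x \<in> carrier M\<rbrakk> \<Longrightarrow> a \<odot>\<^bsub>M\<^esub> x \<in> carrier M"
    and smult_l_distr:
      "\<lbrakk>a \<in> carrier A; b \<in> carrier A; x \<in> carrier M\<rbrakk> \<Longrightarrow>
       (a \<oplus>\<^bsub>A\<^esub> b) \<odot>\<^bsub>M\<^esub> x = a \<odot>\<^bsub>M\<^esub> x \<oplus>\<^bsub>M\<^esub> b \<odot>\<^bsub>M\<^esub> x"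
    and smult_r_distr:
      "\<lbrakk>a \<in> carrier A; x \<in> carrier M; y \<in> carrier M\<rbrakk> \<Longrightarrow>
       a \<odot>\<^bsub>M\<^esub> (x \<oplus>\<^bsub>M\<^esub> y) = a \<odot>\<^bsub>M\<^esub> x \<oplus>\<^bsub>M\<^esub> a \<odot>\<^bsub>M\<^esub> y"
    and smult_assoc:
      "\<lbrakk>a \<in> carrier A; b \<in> carrier A; x \<in> carrier M\<rbrakk> \<Longrightarrow>
       (a \<otimes>\<^bsub>A\<^esub> b) \<odot>\<^bsub>M\<^esub> x = a \<odot>\<^bsub>M\<^esub> (b \<odot>\<^bsub>M\<^esub> x)"
    and smult_one:
      "x \<in> carrier M \<Longrightarrow> \<one>\<^bsub>A\<^esub> \<odot>\<^bsub>M\<^esub> x = x"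

definition linear_map ::
  "('a, 'w) ring_scheme \<Rightarrow> ('a, 'm, 'y) module_scheme \<Rightarrow> ('a, 'n, 'z) module_scheme \<Rightarrow> ('m \<Rightarrow> 'n) \<Rightarrow> bool"
  where "linear_map A M N f \<longleftrightarrow>
    f \<in> carrier M \<rightarrow> carrier N \<and>
    (\<forall>x\<in>carrier M. \<forall>y\<in>carrier M. f (x \<oplus>\<^bsub>M\<^esub> y) = f x \<oplus>\<^bsub>N\<^esub> f y) \<and>
    (\<forall>a\<in>carrier A. \<forall>x\<in>carrier M. f (a \<odot>\<^bsub>M\<^esub> x) = a \<odot>\<^bsub>N\<^esub> f x)"

definition kernel_of :: "('a, 'm, 'y) module_scheme \<Rightarrow> ('a, 'n, 'z) module_scheme \<Rightarrow> ('m \<Rightarrow> 'n) \<Rightarrow> 'm set"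
  where "kernel_of M N f = {x \<in> carrier M. f x = \<zero>\<^bsub>N\<^esub>}"

text \<open>
  HOL cannot quantify over types inside a formula, so the notions below that refer to \<^emph>\<open>all\<close>
  modules (projectivity, flatness) take a type argument \<open>'u\<close> and quantify over all modules whose
  carrier is a set of elements of \<open>'u\<close>. As an assumption on a module with elements of type \<open>'m\<close>
  and scalars of type \<open>'s\<close>, they are used with \<open>'u\<close> the type \<open>('s, 'm) test\<close>, which
  contains copies of \<open>'m\<close>, of \<open>'s\<close> and of all free modules on subsets of \<open>'m\<close>; this is enough to
  be equivalent to the property for every \<open>'u\<close> (a projective module is a
  direct summand of the free module on its (homogeneous) elements; flatness can be tested on the
  ideals of the base ring). As a conclusion they are stated for an arbitrary type \<open>'u\<close>.
\<close>

type_synonym ('s, 'm) test = "('m \<Rightarrow> 's) + 'm"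

definition projective_module ::
  "'u itself \<Rightarrow> ('a, 'y) ring_scheme \<Rightarrow> ('a, 'm, 'z) module_scheme \<Rightarrow> bool"
  where "projective_module U A P \<longleftrightarrow>
    left_module A P \<and>
    (\<forall>(E :: ('a, 'u) module) (F :: ('a, 'u) module) g f.
       left_module A E \<longrightarrow> left_module A F \<longrightarrow>
       linear_map A E F g \<longrightarrow> g ` carrier E = carrier F \<longrightarrow> linear_map A P F f \<longrightarrow>
       (\<exists>h. linear_map A P E h \<and> (\<forall>p\<in>carrier P. g (h p) = f p)))"

definition finitely_generated :: "('r, 'y) ring_scheme \<Rightarrow> ('r, 'n, 'z) module_scheme \<Rightarrow> bool"
  where "finitely_generated R N \<longleftrightarrow>
    (\<exists>S. finite S \<and> S \<subseteq> carrier N \<and>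
      (\<forall>x\<in>carrier N. \<exists>c\<in>S \<rightarrow> carrier R. x = (\<Oplus>\<^bsub>N\<^esub>s\<in>S. c s \<odot>\<^bsub>N\<^esub> s)))"


section \<open>Tensor products over a commutative ring\<close>

text \<open>
  \<open>M \<otimes> N\<close> is the free abelian group on \<open>carrier M \<times> carrier N\<close> modulo the usual relations;
  its elements are cosets.
\<close>

type_synonym ('m, 'n) tensor = "('m \<times> 'n \<Rightarrow>\<^sub>0 int) set"

definition tensor_relations ::
  "('r, 'w) ring_scheme \<Rightarrow> ('r, 'm, 'y) module_scheme \<Rightarrow> ('r, 'n, 'z) module_scheme \<Rightarrow> ('m \<times> 'n \<Rightarrow>\<^sub>0 int) set"
  where "tensor_relations R M N =
    {frag_of (m \<oplus>\<^bsub>M\<^esub> m', n) - frag_of (m, n) - frag_of (m', n) | m m' n.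
       m \<in> carrier M \<and> m' \<in> carrier M \<and> n \<in> carrier N} \<union>
    {frag_of (m, n \<oplus>\<^bsub>N\<^esub> n') - frag_of (m, n) - frag_of (m, n') | m n n'.
       m \<in> carrier M \<and> n \<in> carrier N \<and> n' \<in> carrier N} \<union>
    {frag_of (r \<odot>\<^bsub>M\<^esub> m, n) - frag_of (m, r \<odot>\<^bsub>N\<^esub> n) | r m n.
       r \<in> carrier R \<and> m \<in> carrier M \<and> n \<in> carrier N}"

definition tensor_kernel ::
  "('r, 'w) ring_scheme \<Rightarrow> ('r, 'm, 'y) module_scheme \<Rightarrow> ('r, 'n, 'z) module_scheme \<Rightarrow> ('m \<times> 'n \<Rightarrow>\<^sub>0 int) set"
  where "tensor_kernel R M N =
    generate (free_Abelian_group (carrier M \<times> carrier N)) (tensor_relations R M N)"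

definition tensor_group ::
  "('r, 'w) ring_scheme \<Rightarrow> ('r, 'm, 'y) module_scheme \<Rightarrow> ('r, 'n, 'z) module_scheme \<Rightarrow> ('m, 'n) tensor monoid"
  where "tensor_group R M N =
    free_Abelian_group (carrier M \<times> carrier N) Mod tensor_kernel R M N"

definition pure_tensor ::
  "('r, 'w) ring_scheme \<Rightarrow> ('r, 'm, 'y) module_scheme \<Rightarrow> ('r, 'n, 'z) module_scheme \<Rightarrow> 'm \<Rightarrow> 'n \<Rightarrow> ('m, 'n) tensor"
  where "pure_tensor R M N m n =
    tensor_kernel R M N #>\<^bsub>free_Abelian_group (carrier M \<times> carrier N)\<^esub> frag_of (m, n)"

text \<open>
  The additive map from a tensor product to \<open>T\<close> with \<open>m \<otimes> n \<mapsto> f (m, n)\<close>. It does not depend on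
  the choice of the representative \<open>c\<close> whenever \<open>f\<close> is biadditive and \<open>R\<close>-balanced.
\<close>

definition tensor_lift :: "('t, 'z) ring_scheme \<Rightarrow> ('m \<times> 'n \<Rightarrow> 't) \<Rightarrow> ('m, 'n) tensor \<Rightarrow> 't"
  where "tensor_lift T f E =
    (let c = (SOME c. c \<in> E)
     in \<Oplus>\<^bsub>T\<^esub>p\<in>Poly_Mapping.keys c. [Poly_Mapping.lookup c p] \<cdot>\<^bsub>T\<^esub> f p)"

definition tensor_add ::
  "('r, 'w) ring_scheme \<Rightarrow> ('r, 'm, 'y) module_scheme \<Rightarrow> ('r, 'n, 'z) module_scheme \<Rightarrow> ('m, 'n) tensor ring"
  where "tensor_add R M N =
    \<lparr>carrier = carrier (tensor_group R M N), monoid.mult = undefined, one = undefined,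
     ring.zero = \<one>\<^bsub>tensor_group R M N\<^esub>, ring.add = monoid.mult (tensor_group R M N)\<rparr>"

definition tensor ::
  "('r, 'w) ring_scheme \<Rightarrow> ('r, 'm, 'y) module_scheme \<Rightarrow> ('r, 'n, 'z) module_scheme \<Rightarrow> ('r, ('m, 'n) tensor) module"
  where "tensor R M N =
    ring.extend (tensor_add R M N)
      (module.fields (\<lambda>r. tensor_lift (tensor_add R M N)
                            (\<lambda>(m, n). pure_tensor R M N (r \<odot>\<^bsub>M\<^esub> m) n)))"

text \<open>The map \<open>f \<otimes> id\<close> from \<open>M \<otimes> N\<close> to \<open>M' \<otimes> N\<close>.\<close>

definition tensor_map ::
  "('r, 'w) ring_scheme \<Rightarrow> ('r, 'm2, 'y) module_scheme \<Rightarrow> ('r, 'n, 'z) module_scheme \<Rightarrow>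
   ('m1 \<Rightarrow> 'm2) \<Rightarrow> ('m1, 'n) tensor \<Rightarrow> ('m2, 'n) tensor"
  where "tensor_map R M' N f = tensor_lift (tensor R M' N) (\<lambda>(m, n). pure_tensor R M' N (f m) n)"

definition flat_module ::
  "'u itself \<Rightarrow> ('r, 'y) ring_scheme \<Rightarrow> ('r, 'n, 'z) module_scheme \<Rightarrow> bool"
  where "flat_module U R N \<longleftrightarrow>
    module R N \<and>
    (\<forall>(E :: ('r, 'u) module) (F :: ('r, 'u) module) f.
       module R E \<longrightarrow> module R F \<longrightarrow> linear_map R E F f \<longrightarrow> inj_on f (carrier E) \<longrightarrow>
       inj_on (tensor_map R F N f) (carrier (tensor R E N)))"


section \<open>Algebras, gradings and graded modules\<close>

text \<open>The library locale \<^locale>\<open>algebra\<close> requires a commutative algebra.\<close>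

locale unital_algebra = module R A + A?: ring A
  for R :: "('r, 'y) ring_scheme" and A :: "('r, 'a, 'z) module_scheme" +
  assumes smult_mult_left:
      "\<lbrakk>r \<in> carrier R; x \<in> carrier A; y \<in> carrier A\<rbrakk> \<Longrightarrow>
       (r \<odot>\<^bsub>A\<^esub> x) \<otimes>\<^bsub>A\<^esub> y = r \<odot>\<^bsub>A\<^esub> (x \<otimes>\<^bsub>A\<^esub> y)"
    and smult_mult_right:
      "\<lbrakk>r \<in> carrier R; x \<in> carrier A; y \<in> carrier A\<rbrakk> \<Longrightarrow>
       x \<otimes>\<^bsub>A\<^esub> (r \<odot>\<^bsub>A\<^esub> y) = r \<odot>\<^bsub>A\<^esub> (x \<otimes>\<^bsub>A\<^esub> y)"

text \<open>The \<open>R\<close>-module underlying a module \<open>M\<close> over the \<open>R\<close>-algebra \<open>A\<close>.\<close>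

definition base_module :: "('r, 'a, 'y) module_scheme \<Rightarrow> ('a, 'm, 'z) module_scheme \<Rightarrow> ('r, 'm) module"
  where "base_module A M =
    \<lparr>carrier = carrier M, monoid.mult = monoid.mult M, one = \<one>\<^bsub>M\<^esub>, ring.zero = \<zero>\<^bsub>M\<^esub>, ring.add = (\<oplus>\<^bsub>M\<^esub>),
     smult = (\<lambda>r x. (r \<odot>\<^bsub>A\<^esub> \<one>\<^bsub>A\<^esub>) \<odot>\<^bsub>M\<^esub> x)\<rparr>"

text \<open>
  Graded algebras and graded modules: \<open>part M \<gamma>\<close> is \<open>M\<^sub>\<gamma>\<close>. Only degrees
  \<open>\<gamma> \<in> carrier \<Gamma>\<close> are relevant.
\<close>

record ('s, 'm, 'g) graded = "('s, 'm) module" +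
  part :: "'g \<Rightarrow> 'm set"

definition decomposes ::
  "('g, 'w) monoid_scheme \<Rightarrow> ('s, 'm, 'g, 'z) graded_scheme \<Rightarrow> 'm \<Rightarrow> ('g \<Rightarrow> 'm) \<Rightarrow> bool"
  where "decomposes \<Gamma> M x c \<longleftrightarrow>
    c \<in> (\<Pi>\<^sub>E \<gamma>\<in>carrier \<Gamma>. part M \<gamma>) \<and>
    finite {\<gamma> \<in> carrier \<Gamma>. c \<gamma> \<noteq> \<zero>\<^bsub>M\<^esub>} \<and>
    x = (\<Oplus>\<^bsub>M\<^esub>\<gamma>\<in>{\<gamma> \<in> carrier \<Gamma>. c \<gamma> \<noteq> \<zero>\<^bsub>M\<^esub>}. c \<gamma>)"

definition direct_sum_of_parts :: "('g, 'w) monoid_scheme \<Rightarrow> ('s, 'm, 'g, 'z) graded_scheme \<Rightarrow> bool"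
  where "direct_sum_of_parts \<Gamma> M \<longleftrightarrow> (\<forall>x\<in>carrier M. \<exists>!c. decomposes \<Gamma> M x c)"

definition homog_comp ::
  "('g, 'w) monoid_scheme \<Rightarrow> ('s, 'm, 'g, 'z) graded_scheme \<Rightarrow> 'm \<Rightarrow> 'g \<Rightarrow> 'm"
  where "homog_comp \<Gamma> M x = (THE c. decomposes \<Gamma> M x c)"

definition degrees :: "('g, 'w) monoid_scheme \<Rightarrow> ('s, 'm, 'g, 'z) graded_scheme \<Rightarrow> 'm \<Rightarrow> 'g set"
  where "degrees \<Gamma> M x = {\<gamma> \<in> carrier \<Gamma>. homog_comp \<Gamma> M x \<gamma> \<noteq> \<zero>\<^bsub>M\<^esub>}"

locale graded_algebra = unital_algebra R A + \<Gamma>?: monoid \<Gamma>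
  for R :: "('r, 'x) ring_scheme" and \<Gamma> :: "('g, 'y) monoid_scheme"
    and A :: "('r, 'a, 'g, 'z) graded_scheme" +
  assumes part_submodule: "\<gamma> \<in> carrier \<Gamma> \<Longrightarrow> submodule (part A \<gamma>) R A"
    and direct_sum: "direct_sum_of_parts \<Gamma> A"
    and part_mult:
      "\<lbrakk>\<alpha> \<in> carrier \<Gamma>; \<beta> \<in> carrier \<Gamma>; a \<in> part A \<alpha>; b \<in> part A \<beta>\<rbrakk> \<Longrightarrow>
       a \<otimes>\<^bsub>A\<^esub> b \<in> part A (\<alpha> \<otimes>\<^bsub>\<Gamma>\<^esub> \<beta>)"
    and one_part: "\<one>\<^bsub>A\<^esub> \<in> part A \<one>\<^bsub>\<Gamma>\<^esub>"

locale graded_module = alg: graded_algebra R \<Gamma> A + left_module A M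
  for R :: "('r, 'w) ring_scheme" and \<Gamma> :: "('g, 'x) monoid_scheme"
    and A :: "('r, 'a, 'g, 'y) graded_scheme" and M :: "('a, 'm, 'g, 'z) graded_scheme" +
  assumes part_submodule: "\<gamma> \<in> carrier \<Gamma> \<Longrightarrow> submodule (part M \<gamma>) R (base_module A M)"
    and direct_sum: "direct_sum_of_parts \<Gamma> M"
    and part_smult:
      "\<lbrakk>\<alpha> \<in> carrier \<Gamma>; \<beta> \<in> carrier \<Gamma>; a \<in> part A \<alpha>; x \<in> part M \<beta>\<rbrakk> \<Longrightarrow>
       a \<odot>\<^bsub>M\<^esub> x \<in> part M (\<alpha> \<otimes>\<^bsub>\<Gamma>\<^esub> \<beta>)"

definition graded_map ::
  "('g, 'v) monoid_scheme \<Rightarrow> ('a, 'w) ring_scheme \<Rightarrow> ('a, 'm, 'g, 'y) graded_scheme \<Rightarrow>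
   ('a, 'n, 'g, 'z) graded_scheme \<Rightarrow> ('m \<Rightarrow> 'n) \<Rightarrow> bool"
  where "graded_map \<Gamma> A M N f \<longleftrightarrow>
    linear_map A M N f \<and> (\<forall>\<gamma>\<in>carrier \<Gamma>. f ` part M \<gamma> \<subseteq> part N \<gamma>)"

definition graded_projective ::
  "'u itself \<Rightarrow> ('r, 'w) ring_scheme \<Rightarrow> ('g, 'x) monoid_scheme \<Rightarrow> ('r, 'a, 'g, 'y) graded_scheme \<Rightarrow>
   ('a, 'm, 'g, 'z) graded_scheme \<Rightarrow> bool"
  where "graded_projective U R \<Gamma> A P \<longleftrightarrow>
    graded_module R \<Gamma> A P \<and>
    (\<forall>(E :: ('a, 'u, 'g) graded) (F :: ('a, 'u, 'g) graded) g f.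
       graded_module R \<Gamma> A E \<longrightarrow> graded_module R \<Gamma> A F \<longrightarrow>
       graded_map \<Gamma> A E F g \<longrightarrow> g ` carrier E = carrier F \<longrightarrow> graded_map \<Gamma> A P F f \<longrightarrow>
       (\<exists>h. graded_map \<Gamma> A P E h \<and> (\<forall>p\<in>carrier P. g (h p) = f p)))"

text \<open>Subobjects: the grading of a subobject \<open>T\<close> of \<open>M\<close> is necessarily \<open>T\<^sub>\<gamma> = T \<inter> M\<^sub>\<gamma>\<close>.\<close>

definition graded_submodule ::
  "('r, 'w) ring_scheme \<Rightarrow> ('g, 'x) monoid_scheme \<Rightarrow> ('r, 'a, 'g, 'y) graded_scheme \<Rightarrow>
   'm set \<Rightarrow> ('a, 'm, 'g, 'z) graded_scheme \<Rightarrow> bool"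
  where "graded_submodule R \<Gamma> A T M \<longleftrightarrow>
    T \<subseteq> carrier M \<and>
    graded_module R \<Gamma> A (M\<lparr>carrier := T, part := (\<lambda>\<gamma>. T \<inter> part M \<gamma>)\<rparr>)"

definition superfluous ::
  "('r, 'w) ring_scheme \<Rightarrow> ('g, 'x) monoid_scheme \<Rightarrow> ('r, 'a, 'g, 'y) graded_scheme \<Rightarrow>
   'm set \<Rightarrow> ('a, 'm, 'g, 'z) graded_scheme \<Rightarrow> bool"
  where "superfluous R \<Gamma> A K M \<longleftrightarrow>
    graded_submodule R \<Gamma> A K M \<and>
    (\<forall>T. graded_submodule R \<Gamma> A T M \<longrightarrow> K <+>\<^bsub>M\<^esub> T = carrier M \<longrightarrow> T = carrier M)"

text \<open>
  The complex is indexed by the integers \<open>k \<ge> -1\<close>, with differentials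
  \<open>d k\<close> from \<open>P (k + 1)\<close> to \<open>P k\<close>; values at \<open>k < -1\<close> are irrelevant. Having all \<open>P k\<close> over one
  element type is no restriction, since carriers are arbitrary subsets.
\<close>

definition projective_resolution ::
  "'u itself \<Rightarrow> ('r, 'w) ring_scheme \<Rightarrow> ('g, 'x) monoid_scheme \<Rightarrow> ('r, 'a, 'g, 'y) graded_scheme \<Rightarrow>
   ('a, 'm, 'g, 'z) graded_scheme \<Rightarrow> (int \<Rightarrow> ('a, 'm, 'g, 'z) graded_scheme) \<Rightarrow> (int \<Rightarrow> 'm \<Rightarrow> 'm) \<Rightarrow> bool"
  where "projective_resolution U R \<Gamma> A M P d \<longleftrightarrow>
    P (-1) = M \<and>
    (\<forall>k\<ge>-1. graded_module R \<Gamma> A (P k)) \<and>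
    (\<forall>k\<ge>-1. graded_map \<Gamma> A (P (k + 1)) (P k) (d k)) \<and>
    d (-1) ` carrier (P 0) = carrier (P (-1)) \<and>
    (\<forall>k\<ge>-1. d (k + 1) ` carrier (P (k + 2)) = kernel_of (P (k + 1)) (P k) (d k)) \<and>
    (\<forall>k\<ge>0. graded_projective U R \<Gamma> A (P k))"

definition minimal_projective_resolution ::
  "'u itself \<Rightarrow> ('r, 'w) ring_scheme \<Rightarrow> ('g, 'x) monoid_scheme \<Rightarrow> ('r, 'a, 'g, 'y) graded_scheme \<Rightarrow>
   ('a, 'm, 'g, 'z) graded_scheme \<Rightarrow> (int \<Rightarrow> ('a, 'm, 'g, 'z) graded_scheme) \<Rightarrow> (int \<Rightarrow> 'm \<Rightarrow> 'm) \<Rightarrow> bool"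
  where "minimal_projective_resolution U R \<Gamma> A M P d \<longleftrightarrow>
    projective_resolution U R \<Gamma> A M P d \<and>
    (\<forall>k\<ge>-1. superfluous R \<Gamma> A (kernel_of (P (k + 1)) (P k) (d k)) (P (k + 1)))"


section \<open>Monoid actions and the functor \<open>- \<ltimes> N\<close>\<close>

record ('r, 'b, 'g) acted = "('r, 'b) module" +
  act :: "'b \<Rightarrow> 'g \<Rightarrow> 'b"

text \<open>Elements of \<^const>\<open>ring_hom\<close> preserve the identity.\<close>

locale monoid_algebra_action = unital_algebra R B + \<Gamma>?: monoid \<Gamma>
  for R :: "('r, 'x) ring_scheme" and \<Gamma> :: "('g, 'y) monoid_scheme"
    and B :: "('r, 'b, 'g, 'z) acted_scheme" +
  assumes act_hom: "\<gamma> \<in> carrier \<Gamma> \<Longrightarrow> (\<lambda>b. act B b \<gamma>) \<in> ring_hom B B"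
    and act_smult:
      "\<lbrakk>\<gamma> \<in> carrier \<Gamma>; r \<in> carrier R; b \<in> carrier B\<rbrakk> \<Longrightarrow>
       act B (r \<odot>\<^bsub>B\<^esub> b) \<gamma> = r \<odot>\<^bsub>B\<^esub> act B b \<gamma>"
    and act_mult:
      "\<lbrakk>\<alpha> \<in> carrier \<Gamma>; \<beta> \<in> carrier \<Gamma>; b \<in> carrier B\<rbrakk> \<Longrightarrow>
       act B b (\<alpha> \<otimes>\<^bsub>\<Gamma>\<^esub> \<beta>) = act B (act B b \<alpha>) \<beta>"
    and act_one: "b \<in> carrier B \<Longrightarrow> act B b \<one>\<^bsub>\<Gamma>\<^esub> = b"

definition twisted_module ::
  "('r, 'b, 'g, 'y) acted_scheme \<Rightarrow> 'g \<Rightarrow> ('b, 'n, 'z) module_scheme \<Rightarrow> ('b, 'n, 'z) module_scheme"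
  where "twisted_module B \<beta> N = N\<lparr>smult := (\<lambda>b x. act B b \<beta> \<odot>\<^bsub>N\<^esub> x)\<rparr>"

text \<open>
  The multiplication of \<open>A \<ltimes> B\<close> is the biadditive extension of
  \<open>(a \<otimes> b)(a' \<otimes> b') = a a'\<^sub>\<beta> \<otimes> b\<^sup>\<beta> b'\<close> to arbitrary \<open>a'\<close>, i.e. one sums over the degrees
  \<open>\<beta>\<close> of \<open>a'\<close>; similarly for the action on \<open>M \<ltimes> N\<close>. As \<open>A\<^sub>\<gamma>\<close> is a direct summand of \<open>A\<close>,
  the module \<open>A\<^sub>\<gamma> \<otimes> B\<close> is identified with the subgroup of \<open>A \<otimes> B\<close> generated by the
  tensors \<open>a \<otimes> b\<close> with \<open>a \<in> A\<^sub>\<gamma>\<close>.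
\<close>

definition smash_algebra ::
  "('r, 'w) ring_scheme \<Rightarrow> ('g, 'x) monoid_scheme \<Rightarrow> ('r, 'a, 'g, 'y) graded_scheme \<Rightarrow>
   ('r, 'b, 'g, 'z) acted_scheme \<Rightarrow> ('r, ('a, 'b) tensor, 'g) graded"
  where "smash_algebra R \<Gamma> A B =
    (let T = tensor R A B in
     \<lparr>carrier = carrier T,
      monoid.mult = (\<lambda>s t.
        tensor_lift T (\<lambda>(a, b).
          tensor_lift T (\<lambda>(a', b').
            \<Oplus>\<^bsub>T\<^esub>\<beta>\<in>degrees \<Gamma> A a'.
              pure_tensor R A B (a \<otimes>\<^bsub>A\<^esub> homog_comp \<Gamma> A a' \<beta>) (act B b \<beta> \<otimes>\<^bsub>B\<^esub> b')) t) s),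
      one = pure_tensor R A B \<one>\<^bsub>A\<^esub> \<one>\<^bsub>B\<^esub>,
      ring.zero = \<zero>\<^bsub>T\<^esub>,
      ring.add = (\<oplus>\<^bsub>T\<^esub>),
      smult = smult T,
      part = (\<lambda>\<gamma>. generate (add_monoid T)
        {pure_tensor R A B a b | a b. a \<in> part A \<gamma> \<and> b \<in> carrier B})\<rparr>)"

definition smash_module ::
  "('r, 'u) ring_scheme \<Rightarrow> ('g, 'v) monoid_scheme \<Rightarrow> ('r, 'a, 'g, 'w) graded_scheme \<Rightarrow>
   ('r, 'b, 'g, 'x) acted_scheme \<Rightarrow> ('b, 'n, 'y) module_scheme \<Rightarrow> ('a, 'm, 'g, 'z) graded_scheme \<Rightarrow>
   (('a, 'b) tensor, ('m, 'n) tensor, 'g) graded"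
  where "smash_module R \<Gamma> A B N M =
    (let M\<^sub>R = base_module A M; N\<^sub>R = base_module B N; T = tensor R M\<^sub>R N\<^sub>R in
     \<lparr>carrier = carrier T,
      monoid.mult = monoid.mult T,
      one = \<one>\<^bsub>T\<^esub>,
      ring.zero = \<zero>\<^bsub>T\<^esub>,
      ring.add = (\<oplus>\<^bsub>T\<^esub>),
      smult = (\<lambda>s t.
        tensor_lift T (\<lambda>(a, b).
          tensor_lift T (\<lambda>(m, x).
            \<Oplus>\<^bsub>T\<^esub>\<gamma>\<in>degrees \<Gamma> M m.
              pure_tensor R M\<^sub>R N\<^sub>R (a \<odot>\<^bsub>M\<^esub> homog_comp \<Gamma> M m \<gamma>) (act B b \<gamma> \<odot>\<^bsub>N\<^esub> x)) t) s),
      part = (\<lambda>\<gamma>. generate (add_monoid T)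
        {pure_tensor R M\<^sub>R N\<^sub>R m x | m x. m \<in> part M \<gamma> \<and> x \<in> carrier N})\<rparr>)"

text \<open>The value of \<open>- \<ltimes> N\<close> at a morphism \<open>\<phi>\<close> with target \<open>M'\<close>.\<close>

definition smash_map ::
  "('r, 'v) ring_scheme \<Rightarrow> ('r, 'a, 'g, 'w) graded_scheme \<Rightarrow> ('r, 'b, 'g, 'x) acted_scheme \<Rightarrow>
   ('b, 'n, 'y) module_scheme \<Rightarrow> ('a, 'm2, 'g, 'z) graded_scheme \<Rightarrow> ('m1 \<Rightarrow> 'm2) \<Rightarrow>
   ('m1, 'n) tensor \<Rightarrow> ('m2, 'n) tensor"
  where "smash_map R A B N M' \<phi> = tensor_map R (base_module A M') (base_module B N) \<phi>"

end

theory Submission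
  imports Defs
begin

text \<open>
  The functor \<open>- \<ltimes> N\<close> preserves minimal projective resolutions because it preserves exactness,
  projectivity and superfluous kernels.

  \<^emph>\<open>Exactness.\<close> Up to the action, \<open>M \<ltimes> N\<close> is the tensor product \<open>M \<otimes> N\<close> over \<open>R\<close>. Tensoring is
  right exact, and it preserves injections into the modules of the resolution because \<open>N\<close> is flat.
  Hence the kernel of \<open>d \<otimes> id\<close> is spanned by the tensors \<open>k \<otimes> n\<close> with \<open>k \<in> ker d\<close>
  (\<open>kernel_tensor_map_flat\<close>), and so is the image of the preceding differential
  (\<open>tensor_map_image\<close>).

  \<^emph>\<open>Projectivity.\<close> A graded projective \<open>A\<close>-module \<open>P\<close> is a direct summand of a free graded module, that
  is, it has a dual basis: homogeneous elements \<open>h\<close>, of degree \<open>|h|\<close>, and linear coordinates \<open>c\<^sub>h\<close> with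
  \<open>p = \<Sum>\<^sub>h c\<^sub>h(p) h\<close>. Likewise each twist \<open>\<^sub>\<beta>N\<close>, being projective over \<open>B\<close>, has a dual basis, with
  coordinates \<open>\<psi>\<^sub>\<beta>(x, y)\<close>. A graded map out of the free module on one generator \<open>h\<close>, smashed with \<open>N\<close>,
  is the same as a \<open>B\<close>-linear map from \<open>\<^sub>\<beta>N\<close>, for \<open>\<beta> = |h|\<close>, to the part of degree \<open>\<beta>\<close> of the target;
  this is where the twists of \<open>N\<close> come from. So \<open>f\<close> lifts along a surjection \<open>g\<close> by
  \<open>p \<otimes> x \<mapsto> \<Sum>\<^sub>h \<Sum>\<^sub>y (c\<^sub>h(p) \<otimes> \<psi>\<^sub>\<beta>(x, y)) e(h, y)\<close> with \<open>\<beta> = |h|\<close>, where \<open>e(h, y)\<close> is homogeneous of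
  degree \<open>|h|\<close> and \<open>g(e(h, y)) = f(h \<otimes> y)\<close>. This is linear because for \<open>p\<close> of degree \<open>\<delta>\<close> the coordinate
  \<open>c\<^sub>h(p)\<close> has components only in degrees \<open>\<epsilon>\<close> with \<open>\<epsilon> |h| = \<delta>\<close>, and for these \<open>b\<^sup>\<delta> x\<close> is the product of
  \<open>b\<^sup>\<epsilon>\<close> and \<open>x\<close> in the twist of \<open>N\<close> by \<open>|h|\<close> (\<open>graded_projective_smash\<close>). Dual bases also bridge the
  element types: they are extracted from the lifting property for modules over one fixed type, and they
  produce lifts into modules over any type.

  \<^emph>\<open>Minimality.\<close> Let \<open>K\<close> be superfluous in \<open>M\<close>, let \<open>n\<^sub>1, \<dots>, n\<^sub>s\<close> generate \<open>N\<close> over \<open>R\<close>, and let \<open>T\<close> be a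
  graded submodule of \<open>M \<ltimes> N\<close> with \<open>K \<otimes> N + T = M \<otimes> N\<close>. Restrict the action to the elements
  \<open>a \<otimes> 1\<close>. Then \<open>m \<mapsto> m \<otimes> n\<^sub>i\<close> is a map of graded \<open>A\<close>-modules, so the image \<open>K \<otimes> n\<^sub>i\<close> of \<open>K\<close> is again
  superfluous; since \<open>K \<otimes> N\<close> is the sum of these finitely many images, they can be discarded one after
  the other (\<open>superfluous_smash\<close>).

  What remains is that \<open>A \<ltimes> B\<close> and \<open>M \<ltimes> N\<close> are a graded algebra and a graded module. Every map on a
  tensor product is obtained from the universal property, and every identity is checked on tensors
  \<open>m \<otimes> n\<close> with \<open>m\<close> homogeneous, which suffices since these generate additively. The product of
  \<open>A \<ltimes> B\<close> and the action on \<open>M \<ltimes> N\<close> are two instances of one construction, \<open>smash_action\<close>.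
\<close>

section \<open>Additive maps and sums of finite support\<close>

definition additive_map :: "('x, 'y) ring_scheme \<Rightarrow> ('z, 'w) ring_scheme \<Rightarrow> ('x \<Rightarrow> 'z) \<Rightarrow> bool"
  where "additive_map V Y f \<longleftrightarrow> f \<in> carrier V \<rightarrow> carrier Y \<and>
    (\<forall>x\<in>carrier V. \<forall>y\<in>carrier V. f (x \<oplus>\<^bsub>V\<^esub> y) = f x \<oplus>\<^bsub>Y\<^esub> f y)"

lemma additiveI:
  assumes "\<And>x. x \<in> carrier V \<Longrightarrow> f x \<in> carrier Y"
    and "\<And>x y. x \<in> carrier V \<Longrightarrow> y \<in> carrier V \<Longrightarrow> f (x \<oplus>\<^bsub>V\<^esub> y) = f x \<oplus>\<^bsub>Y\<^esub> f y"
  shows "additive_map V Y f"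
  using assms by (auto simp: additive_map_def)

lemma additive_closed: "additive_map V Y f \<Longrightarrow> x \<in> carrier V \<Longrightarrow> f x \<in> carrier Y"
  by (auto simp: additive_map_def)

lemma additive_add:
  "additive_map V Y f \<Longrightarrow> x \<in> carrier V \<Longrightarrow> y \<in> carrier V \<Longrightarrow> f (x \<oplus>\<^bsub>V\<^esub> y) = f x \<oplus>\<^bsub>Y\<^esub> f y"
  by (auto simp: additive_map_def)

lemma additive_zero:
  assumes "abelian_group V" "abelian_group Y" "additive_map V Y f"
  shows "f \<zero>\<^bsub>V\<^esub> = \<zero>\<^bsub>Y\<^esub>"
proof -
  interpret V: abelian_group V by fact
  interpret Y: abelian_group Y by fact
  have c: "f \<zero>\<^bsub>V\<^esub> \<in> carrier Y" using assms(3) by (simp add: additive_closed)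
  have "f \<zero>\<^bsub>V\<^esub> \<oplus>\<^bsub>Y\<^esub> f \<zero>\<^bsub>V\<^esub> = f \<zero>\<^bsub>V\<^esub>"
    using additive_add[OF assms(3), of "\<zero>\<^bsub>V\<^esub>" "\<zero>\<^bsub>V\<^esub>"] by simp
  then show ?thesis using c by (simp add: Y.add.l_cancel_one)
qed

lemma additive_minus:
  assumes "abelian_group V" "abelian_group Y" "additive_map V Y f" "x \<in> carrier V"
  shows "f (\<ominus>\<^bsub>V\<^esub> x) = \<ominus>\<^bsub>Y\<^esub> f x"
proof -
  interpret V: abelian_group V by fact
  interpret Y: abelian_group Y by fact
  have "f (\<ominus>\<^bsub>V\<^esub> x) \<oplus>\<^bsub>Y\<^esub> f x = \<zero>\<^bsub>Y\<^esub>"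
    using additive_add[OF assms(3), of "\<ominus>\<^bsub>V\<^esub> x" x] assms additive_zero[OF assms(1-3)]
    by (simp add: V.l_neg)
  then show ?thesis
    using assms by (metis V.a_inv_closed Y.minus_equality additive_closed)
qed

lemma additive_comp:
  "additive_map V Y f \<Longrightarrow> additive_map Y Z g \<Longrightarrow> additive_map V Z (\<lambda>x. g (f x))"
  by (simp add: additive_map_def Pi_iff)

lemma additive_id: "additive_map V V (\<lambda>x. x)"
  by (auto simp: additive_map_def)

lemma additive_const_zero: "abelian_group Y \<Longrightarrow> additive_map V Y (\<lambda>x. \<zero>\<^bsub>Y\<^esub>)"
  by (auto simp: additive_map_def abelian_group.axioms abelian_monoid.zero_closed abelian_monoid.l_zero)

lemma additive_map_plus:
  assumes "abelian_group Y" "additive_map V Y f" "additive_map V Y g"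
  shows "additive_map V Y (\<lambda>x. f x \<oplus>\<^bsub>Y\<^esub> g x)"
proof -
  interpret Y: abelian_group Y by fact
  show ?thesis
    by (rule additiveI)
      (simp_all add: additive_closed[OF assms(2)] additive_closed[OF assms(3)]
        additive_add[OF assms(2)] additive_add[OF assms(3)] Y.a_ac)
qed

lemma linear_map_additive: "linear_map A M N f \<Longrightarrow> additive_map M N f"
  by (auto simp: linear_map_def additive_map_def)

text \<open>
  Homogeneous components and coordinates are nonzero only on a finite set that depends on the element.
  Summing over the whole index set, zero terms ignored, makes the sum additive in the family; the supports
  of two families and of their sum would be three different index sets.
  It is the additive form of \<^const>\<open>gfinprod\<close>.
\<close>

definition fsum :: "('y, 'w) ring_scheme \<Rightarrow> ('i \<Rightarrow> 'y) \<Rightarrow> 'i set \<Rightarrow> 'y"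
  where "fsum Y f I = gfinprod (add_monoid Y) f I"

context abelian_group begin

lemma fsum_closed: "(\<And>i. i \<in> I \<Longrightarrow> f i \<in> carrier G) \<Longrightarrow> fsum G f I \<in> carrier G"
  unfolding fsum_def using add.gfinprod_closed[of f I] by auto

lemma fsum_eq_finsum:
  "finite I \<Longrightarrow> (\<And>i. i \<in> I \<Longrightarrow> f i \<in> carrier G) \<Longrightarrow> fsum G f I = finsum G f I"
  unfolding fsum_def using add.gfinprod_eq_finprod[of I f] by auto

lemma fsum_support:
  "finite {i \<in> I. f i \<noteq> \<zero>} \<Longrightarrow> fsum G f I = finsum G f {i \<in> I. f i \<noteq> \<zero>}"
  unfolding fsum_def finsum_def gfinprod_def by auto

lemma fsum_eq_finsum_superset:
  assumes "finite J" "J \<subseteq> I" "\<And>i. i \<in> I \<Longrightarrow> f i \<in> carrier G" "\<And>i. i \<in> I \<Longrightarrow> i \<notin> J \<Longrightarrow> f i = \<zero>"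
  shows "fsum G f I = finsum G f J"
proof -
  have "fsum G f J = fsum G f I"
    unfolding fsum_def using assms by (intro add.gfinprod_mono_neutral_cong_left) auto
  then show ?thesis using fsum_eq_finsum[of J f] assms by auto
qed

lemma fsum_cong:
  "(\<And>i. i \<in> I \<Longrightarrow> f i \<in> carrier G) \<Longrightarrow> (\<And>i. i \<in> I \<Longrightarrow> f i = g i) \<Longrightarrow> fsum G f I = fsum G g I"
  unfolding fsum_def by (rule add.gfinprod_cong) (auto simp: simp_implies_def)

lemma fsum_add:
  assumes "finite {i \<in> I. f i \<noteq> \<zero>}" "finite {i \<in> I. g i \<noteq> \<zero>}"
    "\<And>i. i \<in> I \<Longrightarrow> f i \<in> carrier G" "\<And>i. i \<in> I \<Longrightarrow> g i \<in> carrier G"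
  shows "fsum G (\<lambda>i. f i \<oplus> g i) I = fsum G f I \<oplus> fsum G g I"
  unfolding fsum_def using add.gfinprod_distrib[of I f g] assms by auto

lemma fsum_zero: "(\<And>i. i \<in> I \<Longrightarrow> f i = \<zero>) \<Longrightarrow> fsum G f I = \<zero>"
  using fsum_eq_finsum_superset[of "{}" I f] by auto

lemma fsum_single:
  assumes "j \<in> I" "\<And>i. i \<in> I \<Longrightarrow> f i \<in> carrier G" "\<And>i. i \<in> I \<Longrightarrow> i \<noteq> j \<Longrightarrow> f i = \<zero>"
  shows "fsum G f I = f j"
proof -
  have "fsum G f I = finsum G f {j}" by (rule fsum_eq_finsum_superset) (use assms in auto)
  also have "\<dots> = f j" using assms by simp
  finally show ?thesis .
qed

lemma finsum_in_subgroup: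
  assumes "subgroup S (add_monoid G)" "finite J" "\<And>i. i \<in> J \<Longrightarrow> f i \<in> S"
  shows "finsum G f J \<in> S"
proof -
  have S: "S \<subseteq> carrier G" "\<zero> \<in> S" "\<And>x y. x \<in> S \<Longrightarrow> y \<in> S \<Longrightarrow> x \<oplus> y \<in> S"
    using subgroup.subset[OF assms(1)] subgroup.one_closed[OF assms(1)] subgroup.m_closed[OF assms(1)] by auto
  show ?thesis using assms(2,3)
  proof (induct J)
    case empty then show ?case using S by simp
  next
    case (insert x F)
    then have "f \<in> F \<rightarrow> carrier G" "f x \<in> carrier G" using S by auto
    then show ?case using insert S by auto
  qed
qed

lemma fsum_in_subgroup:
  assumes "subgroup S (add_monoid G)" "\<And>i. i \<in> I \<Longrightarrow> f i \<in> S"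
  shows "fsum G f I \<in> S"
proof (cases "finite {i \<in> I. f i \<noteq> \<zero>}")
  case True
  then show ?thesis using fsum_support[OF True] finsum_in_subgroup[OF assms(1) True] assms(2) by auto
next
  case False
  then have "fsum G f I = \<zero>" by (auto simp: fsum_def gfinprod_def)
  then show ?thesis using subgroup.one_closed[OF assms(1)] by auto
qed

end

lemma additive_finsum:
  assumes "abelian_group V" "abelian_group Y" "additive_map V Y f" "finite J" "\<And>i. i \<in> J \<Longrightarrow> x i \<in> carrier V"
  shows "f (finsum V x J) = finsum Y (\<lambda>i. f (x i)) J"
proof -
  interpret V: abelian_group V by fact
  interpret Y: abelian_group Y by fact
  show ?thesis using assms(4,5)
  proof (induct J)
    case empty then show ?case using additive_zero[OF assms(1-3)] by simp
  next
    case (insert j F)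
    then have "x \<in> F \<rightarrow> carrier V" "x j \<in> carrier V" by auto
    then show ?case using insert by (simp add: additive_add[OF assms(3)] additive_closed[OF assms(3)] Pi_def)
  qed
qed

lemma additive_fsum:
  assumes "abelian_group V" "abelian_group Y" "additive_map V Y f" "finite {i \<in> I. x i \<noteq> \<zero>\<^bsub>V\<^esub>}"
    "\<And>i. i \<in> I \<Longrightarrow> x i \<in> carrier V"
  shows "f (fsum V x I) = fsum Y (\<lambda>i. f (x i)) I"
proof -
  interpret V: abelian_group V by fact
  interpret Y: abelian_group Y by fact
  have "f (fsum V x I) = finsum Y (\<lambda>i. f (x i)) {i \<in> I. x i \<noteq> \<zero>\<^bsub>V\<^esub>}"
    using V.fsum_support[OF assms(4)] additive_finsum[OF assms(1-4)] assms(5) by auto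
  also have "\<dots> = fsum Y (\<lambda>i. f (x i)) I"
    by (rule Y.fsum_eq_finsum_superset[symmetric])
      (use assms additive_zero[OF assms(1-3)] additive_closed[OF assms(3)] in auto)
  finally show ?thesis .
qed

text \<open>
  The pointwise form of the same principle: a family of additive maps that is finite at each point can
  be summed. All maps out of graded and of free modules below are built in this way.
\<close>

lemma additive_fsum_fun:
  assumes "abelian_group Y" "\<And>i. i \<in> I \<Longrightarrow> additive_map V Y (t i)"
    "\<And>x. x \<in> carrier V \<Longrightarrow> finite {i \<in> I. t i x \<noteq> \<zero>\<^bsub>Y\<^esub>}"
  shows "additive_map V Y (\<lambda>x. fsum Y (\<lambda>i. t i x) I)"
proof (rule additiveI)
  interpret Y: abelian_group Y by fact
  show "fsum Y (\<lambda>i. t i x) I \<in> carrier Y" if "x \<in> carrier V" for x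
    using that by (intro Y.fsum_closed) (rule additive_closed[OF assms(2)])
  show "fsum Y (\<lambda>i. t i (x \<oplus>\<^bsub>V\<^esub> y)) I = fsum Y (\<lambda>i. t i x) I \<oplus>\<^bsub>Y\<^esub> fsum Y (\<lambda>i. t i y) I"
    if xy: "x \<in> carrier V" "y \<in> carrier V" for x y
  proof -
    have "fsum Y (\<lambda>i. t i (x \<oplus>\<^bsub>V\<^esub> y)) I = fsum Y (\<lambda>i. t i x \<oplus>\<^bsub>Y\<^esub> t i y) I"
      by (rule Y.fsum_cong[symmetric])
        (use xy in \<open>auto simp: additive_closed[OF assms(2)] additive_add[OF assms(2)]\<close>)
    also have "\<dots> = fsum Y (\<lambda>i. t i x) I \<oplus>\<^bsub>Y\<^esub> fsum Y (\<lambda>i. t i y) I"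
      by (rule Y.fsum_add) (use assms xy in \<open>auto simp: additive_closed[of V]\<close>)
    finally show ?thesis .
  qed
qed

lemma additive_finsum_fun:
  assumes "abelian_group Y" "finite J" "\<And>i. i \<in> J \<Longrightarrow> additive_map V Y (t i)"
  shows "additive_map V Y (\<lambda>x. finsum Y (\<lambda>i. t i x) J)"
proof (rule additiveI)
  interpret Y: abelian_group Y by fact
  show "finsum Y (\<lambda>i. t i x) J \<in> carrier Y" if "x \<in> carrier V" for x
    using that by (intro Y.finsum_closed) (auto intro: additive_closed[OF assms(3)])
  show "finsum Y (\<lambda>i. t i (x \<oplus>\<^bsub>V\<^esub> y)) J = finsum Y (\<lambda>i. t i x) J \<oplus>\<^bsub>Y\<^esub> finsum Y (\<lambda>i. t i y) J"
    if xy: "x \<in> carrier V" "y \<in> carrier V" for x y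
  proof -
    have "finsum Y (\<lambda>i. t i (x \<oplus>\<^bsub>V\<^esub> y)) J = finsum Y (\<lambda>i. t i x \<oplus>\<^bsub>Y\<^esub> t i y) J"
      by (rule Y.finsum_cong')
        (use assms(3) xy in \<open>auto simp: additive_closed[of V] additive_add[of V]\<close>)
    also have "\<dots> = finsum Y (\<lambda>i. t i x) J \<oplus>\<^bsub>Y\<^esub> finsum Y (\<lambda>i. t i y) J"
      by (rule Y.finsum_addf) (use assms xy in \<open>auto simp: additive_closed[of V]\<close>)
    finally show ?thesis .
  qed
qed

lemma subgroup_addI:
  assumes "abelian_group V" "S \<subseteq> carrier V" "\<zero>\<^bsub>V\<^esub> \<in> S"
    "\<And>x y. x \<in> S \<Longrightarrow> y \<in> S \<Longrightarrow> x \<oplus>\<^bsub>V\<^esub> y \<in> S" "\<And>x. x \<in> S \<Longrightarrow> \<ominus>\<^bsub>V\<^esub> x \<in> S"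
  shows "subgroup S (add_monoid V)"
proof -
  interpret V: abelian_group V by fact
  show ?thesis by (rule V.add.subgroupI) (use assms in \<open>auto simp: a_inv_def\<close>)
qed

lemma subgroup_addD:
  assumes "abelian_group V" "subgroup S (add_monoid V)"
  shows "S \<subseteq> carrier V" "\<zero>\<^bsub>V\<^esub> \<in> S" "\<And>x y. x \<in> S \<Longrightarrow> y \<in> S \<Longrightarrow> x \<oplus>\<^bsub>V\<^esub> y \<in> S"
    "\<And>x. x \<in> S \<Longrightarrow> \<ominus>\<^bsub>V\<^esub> x \<in> S"
  using subgroup.subset[OF assms(2)] subgroup.one_closed[OF assms(2)] subgroup.m_closed[OF assms(2)]
    subgroup.m_inv_closed[OF assms(2)] by (auto simp: a_inv_def)

lemma subgroup_generate_add:
  assumes "abelian_group V" "S \<subseteq> carrier V"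
  shows "subgroup (generate (add_monoid V) S) (add_monoid V)"
proof -
  interpret V: abelian_group V by fact
  show ?thesis by (rule V.add.generate_is_subgroup) (use assms in auto)
qed

lemma generate_add_subset:
  assumes "abelian_group V" "S \<subseteq> H" "subgroup H (add_monoid V)"
  shows "generate (add_monoid V) S \<subseteq> H"
proof -
  interpret V: abelian_group V by fact
  show ?thesis by (rule V.add.generate_subgroup_incl) (use assms in auto)
qed

lemma subgroup_vimage:
  assumes "abelian_group V" "abelian_group Y" "additive_map V Y f" "subgroup S (add_monoid Y)"
  shows "subgroup {x \<in> carrier V. f x \<in> S} (add_monoid V)"
proof -
  interpret V: abelian_group V by fact
  show ?thesis
    by (rule subgroup_addI)
      (use assms subgroup_addD[OF assms(2,4)] in
        \<open>auto simp: additive_zero additive_add additive_minus\<close>)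
qed

lemma subgroup_image:
  assumes "abelian_group V" "abelian_group Y" "additive_map V Y f" "subgroup S (add_monoid V)"
  shows "subgroup (f ` S) (add_monoid Y)"
proof (rule subgroup_addI[OF assms(2)])
  note S = subgroup_addD[OF assms(1,4)]
  show "f ` S \<subseteq> carrier Y" using S assms(3) by (auto simp: additive_closed)
  show "\<zero>\<^bsub>Y\<^esub> \<in> f ` S" using S additive_zero[OF assms(1-3)] by (metis image_eqI)
  show "x \<oplus>\<^bsub>Y\<^esub> y \<in> f ` S" if "x \<in> f ` S" "y \<in> f ` S" for x y
    using that S additive_add[OF assms(3)] by (auto simp: image_iff) (metis subsetD)
  show "\<ominus>\<^bsub>Y\<^esub> x \<in> f ` S" if "x \<in> f ` S" for x
    using that S additive_minus[OF assms(1-3)] by (auto simp: image_iff) (metis subsetD)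
qed

lemma additive_eq_on_generate:
  assumes "abelian_group V" "abelian_group Y" "additive_map V Y f" "additive_map V Y g" "S \<subseteq> carrier V"
    "\<And>x. x \<in> S \<Longrightarrow> f x = g x" "x \<in> generate (add_monoid V) S"
  shows "f x = g x"
proof -
  interpret V: abelian_group V by fact
  have "subgroup {x \<in> carrier V. f x = g x} (add_monoid V)"
    by (rule subgroup_addI)
      (use assms additive_zero[OF assms(1-3)] additive_zero[OF assms(1,2,4)]
         additive_minus[OF assms(1-3)] additive_minus[OF assms(1,2,4)] in
        \<open>auto simp: additive_add\<close>)
  then show ?thesis using generate_add_subset[OF assms(1), of S "{x \<in> carrier V. f x = g x}"] assms by auto
qed

section \<open>The universal property of the tensor product\<close>

lemma comm_group_quotient_abelian:
  assumes "comm_group G" "subgroup H G"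
  shows "comm_group (G Mod H)"
proof -
  interpret G: comm_group G by fact
  have n: "H \<lhd> G" by (rule G.subgroup_imp_normal[OF assms(2)])
  show ?thesis by (rule G.abelian_FactGroup[OF assms(2)])
qed

text \<open>
  The lift of a map to a tensor product takes values in a ring record, whereas quotients are formed for
  multiplicative groups; this turns such a quotient into a possible target.
\<close>

definition additive_ring :: "('x, 'y) monoid_scheme \<Rightarrow> 'x ring"
  where "additive_ring G = \<lparr>carrier = carrier G, monoid.mult = undefined, one = undefined,
     ring.zero = \<one>\<^bsub>G\<^esub>, ring.add = monoid.mult G\<rparr>"

lemma additive_ring_simps [simp]:
  "carrier (additive_ring G) = carrier G"
  "\<zero>\<^bsub>additive_ring G\<^esub> = \<one>\<^bsub>G\<^esub>"
  "x \<oplus>\<^bsub>additive_ring G\<^esub> y = x \<otimes>\<^bsub>G\<^esub> y"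
  by (auto simp: additive_ring_def)

lemma abelian_group_additive_ring:
  assumes "comm_group G" shows "abelian_group (additive_ring G)"
proof -
  interpret G: comm_group G by fact
  show ?thesis
    by (rule abelian_groupI) (auto simp: G.m_assoc intro: G.m_comm G.l_inv_ex)
qed

definition balanced where
  "balanced R M N Y f \<longleftrightarrow>
    (\<forall>n\<in>carrier N. additive_map M Y (\<lambda>m. f m n)) \<and>
    (\<forall>m\<in>carrier M. additive_map N Y (f m)) \<and>
    (\<forall>r\<in>carrier R. \<forall>m\<in>carrier M. \<forall>n\<in>carrier N. f (r \<odot>\<^bsub>M\<^esub> m) n = f m (r \<odot>\<^bsub>N\<^esub> n))"

lemma balancedI:
  assumes "\<And>n. n \<in> carrier N \<Longrightarrow> additive_map M Y (\<lambda>m. f m n)"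
    "\<And>m. m \<in> carrier M \<Longrightarrow> additive_map N Y (f m)"
    "\<And>r m n. r \<in> carrier R \<Longrightarrow> m \<in> carrier M \<Longrightarrow> n \<in> carrier N \<Longrightarrow>
       f (r \<odot>\<^bsub>M\<^esub> m) n = f m (r \<odot>\<^bsub>N\<^esub> n)"
  shows "balanced R M N Y f"
  using assms by (auto simp: balanced_def)

locale tensor_pair = M: module R M + N: module R N
  for R :: "('r, 'x) ring_scheme" and M :: "('r, 'm, 'y) module_scheme"
    and N :: "('r, 'n, 'z) module_scheme"
begin

abbreviation S :: "('m \<times> 'n) set" where "S \<equiv> carrier M \<times> carrier N"
abbreviation FG :: "('m \<times> 'n \<Rightarrow>\<^sub>0 int) monoid" where "FG \<equiv> free_Abelian_group S"
abbreviation K :: "('m \<times> 'n \<Rightarrow>\<^sub>0 int) set" where "K \<equiv> tensor_kernel R M N"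
abbreviation T :: "('r, ('m, 'n) tensor) module" where "T \<equiv> tensor R M N"
abbreviation pt :: "'m \<Rightarrow> 'n \<Rightarrow> ('m, 'n) tensor" where "pt \<equiv> pure_tensor R M N"

lemma relations_subset: "tensor_relations R M N \<subseteq> carrier FG"
  unfolding tensor_relations_def
  by (auto simp: keys_frag_of dest!: subsetD[OF keys_diff])

lemma K_subgroup: "subgroup K FG"
  unfolding tensor_kernel_def by (rule group.generate_is_subgroup[OF group_free_Abelian_group relations_subset])

lemma tensor_group_comm_group: "comm_group (tensor_group R M N)"
  unfolding tensor_group_def
  by (rule comm_group_quotient_abelian[OF abelian_free_Abelian_group K_subgroup])

lemma carrier_T: "carrier T = carrier (tensor_group R M N)"
  and zero_T: "\<zero>\<^bsub>T\<^esub> = \<one>\<^bsub>tensor_group R M N\<^esub>"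
  and add_T: "x \<oplus>\<^bsub>T\<^esub> y = x \<otimes>\<^bsub>tensor_group R M N\<^esub> y"
  and smult_T: "r \<odot>\<^bsub>T\<^esub> t = tensor_lift (tensor_add R M N)
                            (\<lambda>(m, n). pure_tensor R M N (r \<odot>\<^bsub>M\<^esub> m) n) t"
  by (simp_all add: tensor_def tensor_add_def ring.defs module.defs)

lemma tensor_add_simps: "carrier (tensor_add R M N) = carrier T"
  "\<zero>\<^bsub>tensor_add R M N\<^esub> = \<zero>\<^bsub>T\<^esub>"
  "x \<oplus>\<^bsub>tensor_add R M N\<^esub> y = x \<oplus>\<^bsub>T\<^esub> y"
  by (simp_all add: tensor_def tensor_add_def ring.defs module.defs)

lemma abelian_group_tensor_add: "abelian_group (tensor_add R M N)"
  using abelian_group_additive_ring[OF tensor_group_comm_group]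
  by (simp add: tensor_add_def additive_ring_def)

lemma abelian_group_T: "abelian_group T"
proof -
  interpret G: comm_group "tensor_group R M N" by (rule tensor_group_comm_group)
  show ?thesis
    by (rule abelian_groupI)
      (simp_all add: carrier_T zero_T add_T G.m_assoc G.l_inv_ex, simp add: G.m_comm)
qed

sublocale T: abelian_group T by (rule abelian_group_T)

definition coset :: "('m \<times> 'n \<Rightarrow>\<^sub>0 int) \<Rightarrow> ('m, 'n) tensor"
  where "coset c = K #>\<^bsub>FG\<^esub> c"

lemma pt_coset: "pt m n = coset (frag_of (m, n))"
  by (simp add: pure_tensor_def coset_def)

lemma coset_eq: "coset c = {k + c | k. k \<in> K}"
  by (auto simp: coset_def r_coset_def)

lemma coset_self: "c \<in> coset c"
  using subgroup.one_closed[OF K_subgroup] by (force simp: coset_eq)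

lemma carrier_T_coset: "carrier T = coset ` carrier FG"
  by (auto simp: carrier_T tensor_group_def FactGroup_def RCOSETS_def coset_def)

lemma coset_add: "c \<in> carrier FG \<Longrightarrow> c' \<in> carrier FG \<Longrightarrow> coset (c + c') = coset c \<oplus>\<^bsub>T\<^esub> coset c'"
  using normal.rcos_sum[OF comm_group.subgroup_imp_normal[OF abelian_free_Abelian_group K_subgroup], of c c']
  by (simp add: add_T tensor_group_def FactGroup_def coset_def)

lemma coset_zero: "coset 0 = \<zero>\<^bsub>T\<^esub>"
  by (simp add: coset_eq zero_T tensor_group_def FactGroup_def)

lemma coset_in_T: "c \<in> carrier FG \<Longrightarrow> coset c \<in> carrier T"
  by (simp add: carrier_T_coset)

lemma coset_diff: "c \<in> carrier FG \<Longrightarrow> c' \<in> carrier FG \<Longrightarrow> coset (c - c') = coset c \<ominus>\<^bsub>T\<^esub> coset c'"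
proof -
  assume c: "c \<in> carrier FG" "c' \<in> carrier FG"
  then have d: "c - c' \<in> carrier FG" using keys_diff[of c c'] by auto
  have "coset c = coset (c - c') \<oplus>\<^bsub>T\<^esub> coset c'"
    using coset_add[OF d c(2)] by simp
  then show ?thesis using coset_in_T[OF c(1)] coset_in_T[OF c(2)] coset_in_T[OF d]
    by (simp add: T.minus_eq T.a_assoc T.r_neg)
qed

lemma coset_relation: "c \<in> K \<Longrightarrow> coset c = \<zero>\<^bsub>T\<^esub>"
proof -
  assume "c \<in> K"
  then have "K #>\<^bsub>FG\<^esub> c = K"
    using subgroup.rcos_const[OF K_subgroup group_free_Abelian_group] by simp
  then show ?thesis by (simp add: zero_T tensor_group_def FactGroup_def coset_def)
qed

lemma frag_in: "m \<in> carrier M \<Longrightarrow> n \<in> carrier N \<Longrightarrow> frag_of (m, n) \<in> carrier FG"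
  by simp

lemma pt_closed: "m \<in> carrier M \<Longrightarrow> n \<in> carrier N \<Longrightarrow> pt m n \<in> carrier T"
  unfolding pt_coset by (rule coset_in_T) simp

lemma rel_in_K: "c \<in> tensor_relations R M N \<Longrightarrow> c \<in> K"
  unfolding tensor_kernel_def by (rule generate.incl)

lemma minus_zero_eq:
  assumes "x \<in> carrier T" "y \<in> carrier T" "x \<ominus>\<^bsub>T\<^esub> y = \<zero>\<^bsub>T\<^esub>"
  shows "x = y"
proof -
  have "x = (x \<ominus>\<^bsub>T\<^esub> y) \<oplus>\<^bsub>T\<^esub> y" using assms(1,2) by (simp add: T.minus_eq T.a_assoc T.l_neg)
  then show ?thesis using assms by simp
qed

text \<open>
  Each of the three bilinearity laws of \<open>pt\<close> is one of the relations that are divided out.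
\<close>

lemma relation_coset_eq:
  assumes "c - c' \<in> tensor_relations R M N" "c \<in> carrier FG" "c' \<in> carrier FG"
  shows "coset c = coset c'"
  by (rule minus_zero_eq[OF coset_in_T[OF assms(2)] coset_in_T[OF assms(3)]])
    (simp add: coset_diff[OF assms(2,3), symmetric] coset_relation[OF rel_in_K[OF assms(1)]])

lemma frag_add_in: "p \<in> S \<Longrightarrow> q \<in> S \<Longrightarrow> frag_of p + frag_of q \<in> carrier FG"
  using keys_add[of "frag_of p" "frag_of q"] by (auto simp: keys_frag_of)

lemma pt_add_left:
  assumes "m \<in> carrier M" "m' \<in> carrier M" "n \<in> carrier N"
  shows "pt (m \<oplus>\<^bsub>M\<^esub> m') n = pt m n \<oplus>\<^bsub>T\<^esub> pt m' n"
proof -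
  have "coset (frag_of (m \<oplus>\<^bsub>M\<^esub> m', n)) = coset (frag_of (m, n) + frag_of (m', n))"
    using assms by (intro relation_coset_eq frag_add_in) (auto simp: tensor_relations_def diff_diff_eq)
  then show ?thesis using assms by (simp add: pt_coset coset_add)
qed

lemma pt_add_right:
  assumes "m \<in> carrier M" "n \<in> carrier N" "n' \<in> carrier N"
  shows "pt m (n \<oplus>\<^bsub>N\<^esub> n') = pt m n \<oplus>\<^bsub>T\<^esub> pt m n'"
proof -
  have "coset (frag_of (m, n \<oplus>\<^bsub>N\<^esub> n')) = coset (frag_of (m, n) + frag_of (m, n'))"
    using assms by (intro relation_coset_eq frag_add_in) (auto simp: tensor_relations_def diff_diff_eq)
  then show ?thesis using assms by (simp add: pt_coset coset_add)
qed

lemma pt_smult: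
  assumes "r \<in> carrier R" "m \<in> carrier M" "n \<in> carrier N"
  shows "pt (r \<odot>\<^bsub>M\<^esub> m) n = pt m (r \<odot>\<^bsub>N\<^esub> n)"
  unfolding pt_coset using assms by (intro relation_coset_eq) (auto simp: tensor_relations_def)

lemma pt_balanced: "balanced R M N T pt"
  by (intro balancedI additiveI) (auto simp: pt_closed pt_add_left pt_add_right pt_smult)

text \<open>
  The additive extension of \<open>f\<close> to the free abelian group, written as in the definition of
  \<^const>\<open>tensor_lift\<close>. It kills the relations when \<open>f\<close> is balanced, so that its value on a coset does not
  depend on the representative which \<^const>\<open>tensor_lift\<close> chooses.
\<close>

definition extension :: "('t, 'w) ring_scheme \<Rightarrow> ('m \<Rightarrow> 'n \<Rightarrow> 't) \<Rightarrow> ('m \<times> 'n \<Rightarrow>\<^sub>0 int) \<Rightarrow> 't"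
  where "extension Y f c = (\<Oplus>\<^bsub>Y\<^esub>p\<in>Poly_Mapping.keys c. [Poly_Mapping.lookup c p] \<cdot>\<^bsub>Y\<^esub> (case_prod f) p)"

text \<open>
  The free abelian group is generated by its basis, so its quotient is generated additively by the pure
  tensors. This is what allows checking identities and inclusions on them.
\<close>

lemma tensor_generate: "carrier T = generate (add_monoid T) {pt m n | m n. m \<in> carrier M \<and> n \<in> carrier N}"
  (is "_ = generate _ ?P")
proof
  have sub: "?P \<subseteq> carrier T" by (auto simp: pt_closed)
  have sg: "subgroup (generate (add_monoid T) ?P) (add_monoid T)"
    by (rule subgroup_generate_add[OF abelian_group_T sub])
  show "generate (add_monoid T) ?P \<subseteq> carrier T"
    using subgroup.subset[OF sg] by simp
  have "coset c \<in> generate (add_monoid T) ?P" if "Poly_Mapping.keys c \<subseteq> S" for c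
  proof (rule free_Abelian_group_induct[OF that, where P = "\<lambda>c. coset c \<in> generate (add_monoid T) ?P"])
    show "coset 0 \<in> generate (add_monoid T) ?P"
      using subgroup_addD(2)[OF abelian_group_T sg] by (simp add: coset_zero)
  next
    fix x y assume "Poly_Mapping.keys x \<subseteq> S" "Poly_Mapping.keys y \<subseteq> S"
      "coset x \<in> generate (add_monoid T) ?P" "coset y \<in> generate (add_monoid T) ?P"
    then show "coset (x - y) \<in> generate (add_monoid T) ?P"
      using subgroup_addD[OF abelian_group_T sg] by (simp add: coset_diff T.minus_eq)
  next
    fix a assume "a \<in> S"
    then show "coset (frag_of a) \<in> generate (add_monoid T) ?P"
      by (cases a) (auto simp: pt_coset[symmetric] intro!: generate.incl)
  qed
  then show "carrier T \<subseteq> generate (add_monoid T) ?P"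
    by (auto simp: carrier_T_coset)
qed

lemma pure_subset: "{pt m n | m n. m \<in> carrier M \<and> n \<in> carrier N} \<subseteq> carrier T"
  by (auto simp: pt_closed)

context
  fixes Y :: "('t, 'w) ring_scheme" and f
  assumes Y: "abelian_group Y" and f: "balanced R M N Y f"
begin

interpretation Y: abelian_group Y by (rule Y)

lemma zero_pow: "[(0::int)] \<cdot>\<^bsub>Y\<^esub> a = \<zero>\<^bsub>Y\<^esub>"
  by (simp add: add_pow_def int_pow_def2 nat_pow_def)

lemma f_closed: "m \<in> carrier M \<Longrightarrow> n \<in> carrier N \<Longrightarrow> f m n \<in> carrier Y"
  using f by (auto simp: balanced_def additive_map_def)

lemma extension_fsum:
  assumes "Poly_Mapping.keys c \<subseteq> S"
  shows "extension Y f c = fsum Y (\<lambda>p. [Poly_Mapping.lookup c p] \<cdot>\<^bsub>Y\<^esub> (case_prod f) p) S"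
  unfolding extension_def
  by (rule Y.fsum_eq_finsum_superset[symmetric]) (use assms in \<open>auto simp: f_closed in_keys_iff Y.add.int_pow_closed zero_pow\<close>)

lemma extension_hom: "extension Y f \<in> hom FG (add_monoid Y)"
proof (rule homI)
  fix c assume "c \<in> carrier FG"
  then show "extension Y f c \<in> carrier (add_monoid Y)"
    by (auto simp: extension_fsum f_closed intro!: Y.fsum_closed)
next
  fix c d assume cd: "c \<in> carrier FG" "d \<in> carrier FG"
  then have k: "Poly_Mapping.keys (c + d) \<subseteq> S" using keys_add[of c d] by auto
  have fin: "finite {i \<in> S. [Poly_Mapping.lookup e i] \<cdot>\<^bsub>Y\<^esub> case_prod f i \<noteq> \<zero>\<^bsub>Y\<^esub>}"
    for e :: "'m \<times> 'n \<Rightarrow>\<^sub>0 int"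
    by (rule finite_subset[OF _ finite_keys[of e]]) (auto simp: in_keys_iff zero_pow)
  have "extension Y f (c + d) =
      fsum Y (\<lambda>p. [Poly_Mapping.lookup c p] \<cdot>\<^bsub>Y\<^esub> (case_prod f) p \<oplus>\<^bsub>Y\<^esub> [Poly_Mapping.lookup d p] \<cdot>\<^bsub>Y\<^esub> (case_prod f) p) S"
    unfolding extension_fsum[OF k]
    by (rule Y.fsum_cong) (auto simp: f_closed lookup_add Y.add.int_pow_mult)
  also have "\<dots> = extension Y f c \<oplus>\<^bsub>Y\<^esub> extension Y f d"
    using cd by (simp add: extension_fsum) (rule Y.fsum_add[OF fin fin], auto simp: f_closed)
  finally show "extension Y f (c \<otimes>\<^bsub>FG\<^esub> d) = extension Y f c \<otimes>\<^bsub>add_monoid Y\<^esub> extension Y f d" by simp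
qed

lemma extension_frag_of: "m \<in> carrier M \<Longrightarrow> n \<in> carrier N \<Longrightarrow> extension Y f (frag_of (m, n)) = f m n"
  unfolding extension_def by (simp add: keys_frag_of f_closed Y.add.int_pow_1)

interpretation E: group_hom FG "add_monoid Y" "extension Y f"
  by (intro group_hom.intro group_hom_axioms.intro extension_hom group_free_Abelian_group Y.add.is_group)

lemma extension_diff:
  assumes "c \<in> carrier FG" "d \<in> carrier FG"
  shows "extension Y f (c - d) = extension Y f c \<ominus>\<^bsub>Y\<^esub> extension Y f d"
proof -
  have d: "c - d \<in> carrier FG" using keys_diff[of c d] assms by auto
  have "extension Y f c = extension Y f (c - d) \<oplus>\<^bsub>Y\<^esub> extension Y f d"
    using E.hom_mult[OF d assms(2)] by simp
  then show ?thesis using E.hom_closed[OF assms(1)] E.hom_closed[OF assms(2)] E.hom_closed[OF d]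
    by (simp add: Y.minus_eq Y.a_assoc Y.r_neg)
qed

lemma extension_relation:
  assumes "c \<in> tensor_relations R M N" shows "extension Y f c = \<zero>\<^bsub>Y\<^esub>"
proof -
  have bal: "\<And>m m' n. m \<in> carrier M \<Longrightarrow> m' \<in> carrier M \<Longrightarrow> n \<in> carrier N \<Longrightarrow>
      f (m \<oplus>\<^bsub>M\<^esub> m') n = f m n \<oplus>\<^bsub>Y\<^esub> f m' n"
    "\<And>m n n'. m \<in> carrier M \<Longrightarrow> n \<in> carrier N \<Longrightarrow> n' \<in> carrier N \<Longrightarrow>
      f m (n \<oplus>\<^bsub>N\<^esub> n') = f m n \<oplus>\<^bsub>Y\<^esub> f m n'"
    "\<And>r m n. r \<in> carrier R \<Longrightarrow> m \<in> carrier M \<Longrightarrow> n \<in> carrier N \<Longrightarrow> f (r \<odot>\<^bsub>M\<^esub> m) n = f m (r \<odot>\<^bsub>N\<^esub> n)"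
    using f by (auto simp: balanced_def additive_map_def)
  have dd: "frag_of p - frag_of q \<in> carrier FG" if "p \<in> S" "q \<in> S" for p q
    using that keys_diff[of "frag_of p" "frag_of q"] by (auto simp: keys_frag_of)
  note ext = extension_diff[OF frag_in frag_in] extension_frag_of f_closed
  show ?thesis using assms unfolding tensor_relations_def
  proof (elim UnE CollectE exE conjE)
    fix m m' n assume c: "c = frag_of (m \<oplus>\<^bsub>M\<^esub> m', n) - frag_of (m, n) - frag_of (m', n)"
      and in': "m \<in> carrier M" "m' \<in> carrier M" "n \<in> carrier N"
    have "extension Y f c = (f (m \<oplus>\<^bsub>M\<^esub> m') n \<ominus>\<^bsub>Y\<^esub> f m n) \<ominus>\<^bsub>Y\<^esub> f m' n"
      unfolding c using in' by (subst extension_diff[OF dd]) (auto simp: ext)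
    then show ?thesis using in' f_closed[of m n] f_closed[of m' n]
      by (simp add: bal Y.minus_eq Y.a_ac Y.r_neg Y.r_neg1 Y.r_neg2)
  next
    fix m n n' assume c: "c = frag_of (m, n \<oplus>\<^bsub>N\<^esub> n') - frag_of (m, n) - frag_of (m, n')"
      and in': "m \<in> carrier M" "n \<in> carrier N" "n' \<in> carrier N"
    have "extension Y f c = (f m (n \<oplus>\<^bsub>N\<^esub> n') \<ominus>\<^bsub>Y\<^esub> f m n) \<ominus>\<^bsub>Y\<^esub> f m n'"
      unfolding c using in' by (subst extension_diff[OF dd]) (auto simp: ext)
    then show ?thesis using in' f_closed[of m n] f_closed[of m n']
      by (simp add: bal Y.minus_eq Y.a_ac Y.r_neg Y.r_neg1 Y.r_neg2)
  next
    fix r m n assume c: "c = frag_of (r \<odot>\<^bsub>M\<^esub> m, n) - frag_of (m, r \<odot>\<^bsub>N\<^esub> n)"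
      and in': "r \<in> carrier R" "m \<in> carrier M" "n \<in> carrier N"
    then show ?thesis by (simp add: ext bal Y.minus_eq Y.r_neg)
  qed
qed

lemma extension_K: assumes "c \<in> K" shows "extension Y f c = \<zero>\<^bsub>Y\<^esub>"
proof -
  have "subgroup (kernel FG (add_monoid Y) (extension Y f)) FG" by (rule E.subgroup_kernel)
  moreover have "tensor_relations R M N \<subseteq> kernel FG (add_monoid Y) (extension Y f)"
    using relations_subset by (auto simp: kernel_def extension_relation simp del: carrier_free_Abelian_group_iff)
  ultimately have "K \<subseteq> kernel FG (add_monoid Y) (extension Y f)"
    unfolding tensor_kernel_def by (intro group.generate_subgroup_incl[OF group_free_Abelian_group])
  then show ?thesis using assms by (auto simp: kernel_def)
qed

lemma tensor_lift_coset:
  assumes "c \<in> carrier FG" shows "tensor_lift Y (case_prod f) (coset c) = extension Y f c"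
proof -
  have "(SOME c'. c' \<in> coset c) \<in> coset c" using coset_self by (rule someI)
  then obtain k where k: "k \<in> K" "(SOME c'. c' \<in> coset c) = k + c"
    by (auto simp: coset_eq)
  have kF: "k \<in> carrier FG" using subgroup.subset[OF K_subgroup] k by blast
  have "tensor_lift Y (case_prod f) (coset c) = extension Y f (k + c)"
    by (simp add: tensor_lift_def k(2) extension_def Let_def)
  also have "\<dots> = extension Y f c"
    using E.hom_mult[OF kF assms] extension_K[OF k(1)] E.hom_closed[OF assms] by simp
  finally show ?thesis .
qed

lemma tensor_lift_additive: "additive_map T Y (tensor_lift Y (case_prod f))"
proof (rule additiveI)
  fix x assume "x \<in> carrier T"
  then obtain c where "c \<in> carrier FG" "x = coset c" by (auto simp: carrier_T_coset)
  then show "tensor_lift Y (case_prod f) x \<in> carrier Y"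
    using E.hom_closed by (simp add: tensor_lift_coset)
next
  fix x y assume "x \<in> carrier T" "y \<in> carrier T"
  then obtain c d where cd: "c \<in> carrier FG" "x = coset c" "d \<in> carrier FG" "y = coset d"
    by (auto simp: carrier_T_coset)
  then have "c + d \<in> carrier FG" using keys_add[of c d] by auto
  then show "tensor_lift Y (case_prod f) (x \<oplus>\<^bsub>T\<^esub> y) =
      tensor_lift Y (case_prod f) x \<oplus>\<^bsub>Y\<^esub> tensor_lift Y (case_prod f) y"
    using cd E.hom_mult[OF cd(1,3)] by (simp add: coset_add[symmetric] tensor_lift_coset)
qed

lemma tensor_lift_pure:
  "m \<in> carrier M \<Longrightarrow> n \<in> carrier N \<Longrightarrow> tensor_lift Y (case_prod f) (pt m n) = f m n"
  by (simp add: pt_coset tensor_lift_coset extension_frag_of)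

end

lemma tensor_hom_ext:
  assumes "abelian_group Y" "additive_map T Y f" "additive_map T Y g"
    "\<And>m n. m \<in> carrier M \<Longrightarrow> n \<in> carrier N \<Longrightarrow> f (pt m n) = g (pt m n)" "t \<in> carrier T"
  shows "f t = g t"
  by (rule additive_eq_on_generate[OF abelian_group_T assms(1-3) pure_subset])
    (use assms(4,5) tensor_generate in auto)

lemma tensor_subgroup_eqI:
  assumes "subgroup H (add_monoid T)" "\<And>m n. m \<in> carrier M \<Longrightarrow> n \<in> carrier N \<Longrightarrow> pt m n \<in> H"
  shows "H = carrier T"
proof
  show "H \<subseteq> carrier T" using subgroup_addD(1)[OF abelian_group_T assms(1)] .
  show "carrier T \<subseteq> H"
    by (subst tensor_generate, rule generate_add_subset[OF abelian_group_T _ assms(1)]) (use assms(2) in auto)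
qed

lemma additive_map_tensor_add: "additive_map V (tensor_add R M N) f = additive_map V T f"
  by (simp add: additive_map_def tensor_add_simps)

lemma smult_balanced:
  assumes "r \<in> carrier R" shows "balanced R M N (tensor_add R M N) (\<lambda>m n. pt (r \<odot>\<^bsub>M\<^esub> m) n)"
  using assms
  by (intro balancedI; (unfold additive_map_tensor_add, intro additiveI)?)
    (auto simp: pt_closed pt_add_left pt_add_right M.smult_r_distr pt_smult[symmetric]
        M.smult_assoc1[symmetric] M.m_comm)

lemma smult_additive: "r \<in> carrier R \<Longrightarrow> additive_map T T (\<lambda>t. r \<odot>\<^bsub>T\<^esub> t)"
  using tensor_lift_additive[OF abelian_group_tensor_add smult_balanced]
  by (simp add: additive_map_tensor_add smult_T)

lemma smult_pt:
  assumes "r \<in> carrier R" "m \<in> carrier M" "n \<in> carrier N"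
  shows "r \<odot>\<^bsub>T\<^esub> pt m n = pt (r \<odot>\<^bsub>M\<^esub> m) n"
  unfolding smult_T
  by (rule tensor_lift_pure[OF abelian_group_tensor_add smult_balanced[OF assms(1)] assms(2,3)])

lemma module_T: "module R T"
proof (rule moduleI)
  show "cring R" by (rule M.is_cring)
  show "abelian_group T" by (rule abelian_group_T)
  show "r \<odot>\<^bsub>T\<^esub> t \<in> carrier T" if "r \<in> carrier R" "t \<in> carrier T" for r t
    using additive_closed[OF smult_additive] that by blast
  show "r \<odot>\<^bsub>T\<^esub> (t \<oplus>\<^bsub>T\<^esub> u) = r \<odot>\<^bsub>T\<^esub> t \<oplus>\<^bsub>T\<^esub> r \<odot>\<^bsub>T\<^esub> u"
    if "r \<in> carrier R" "t \<in> carrier T" "u \<in> carrier T" for r t u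
    using additive_add[OF smult_additive] that by blast
  show "(r \<oplus>\<^bsub>R\<^esub> s) \<odot>\<^bsub>T\<^esub> t = r \<odot>\<^bsub>T\<^esub> t \<oplus>\<^bsub>T\<^esub> s \<odot>\<^bsub>T\<^esub> t"
    if rs: "r \<in> carrier R" "s \<in> carrier R" and t: "t \<in> carrier T" for r s t
    by (rule tensor_hom_ext[OF abelian_group_T smult_additive
          additive_map_plus[OF abelian_group_T smult_additive smult_additive] _ t])
      (use rs in \<open>auto simp: smult_pt M.smult_l_distr pt_add_left\<close>)
  show "(r \<otimes>\<^bsub>R\<^esub> s) \<odot>\<^bsub>T\<^esub> t = r \<odot>\<^bsub>T\<^esub> (s \<odot>\<^bsub>T\<^esub> t)"
    if rs: "r \<in> carrier R" "s \<in> carrier R" and t: "t \<in> carrier T" for r s t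
    by (rule tensor_hom_ext[OF abelian_group_T smult_additive
          additive_comp[OF smult_additive smult_additive] _ t])
      (use rs in \<open>auto simp: smult_pt M.smult_assoc1\<close>)
  show "\<one>\<^bsub>R\<^esub> \<odot>\<^bsub>T\<^esub> t = t" if t: "t \<in> carrier T" for t
    by (rule tensor_hom_ext[OF abelian_group_T smult_additive additive_id _ t])
      (auto simp: smult_pt)
qed

end

section \<open>Exactness of the tensor product\<close>

lemma tensor_pairI: "module R M \<Longrightarrow> module R N \<Longrightarrow> tensor_pair R M N"
  by (rule tensor_pair.intro)

lemma linear_map_closed: "linear_map A M N f \<Longrightarrow> x \<in> carrier M \<Longrightarrow> f x \<in> carrier N"
  by (auto simp: linear_map_def)

lemma linear_map_smult:
  "linear_map A M N f \<Longrightarrow> a \<in> carrier A \<Longrightarrow> x \<in> carrier M \<Longrightarrow> f (a \<odot>\<^bsub>M\<^esub> x) = a \<odot>\<^bsub>N\<^esub> f x"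
  by (auto simp: linear_map_def)

lemma linear_map_add:
  "linear_map A M N f \<Longrightarrow> x \<in> carrier M \<Longrightarrow> y \<in> carrier M \<Longrightarrow> f (x \<oplus>\<^bsub>M\<^esub> y) = f x \<oplus>\<^bsub>N\<^esub> f y"
  by (auto simp: linear_map_def)

lemma linear_mapI:
  assumes "additive_map M N f"
    "\<And>a x. a \<in> carrier A \<Longrightarrow> x \<in> carrier M \<Longrightarrow> f (a \<odot>\<^bsub>M\<^esub> x) = a \<odot>\<^bsub>N\<^esub> f x"
  shows "linear_map A M N f"
  using assms by (auto simp: linear_map_def additive_map_def)

lemma linear_map_comp:
  "linear_map A M N f \<Longrightarrow> linear_map A N Q g \<Longrightarrow> linear_map A M Q (\<lambda>x. g (f x))"
  by (simp add: linear_map_def Pi_iff)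

lemma abelian_group_module: "module R M \<Longrightarrow> abelian_group M"
  by (rule module.axioms(2))

context
  fixes R :: "('r, 'x) ring_scheme" and M :: "('r, 'm, 'y) module_scheme"
    and M' :: "('r, 'l, 'v) module_scheme" and N :: "('r, 'n, 'z) module_scheme"
  assumes M: "module R M" and M': "module R M'" and N: "module R N"
begin

interpretation MN: tensor_pair R M N by (rule tensor_pairI[OF M N])
interpretation M'N: tensor_pair R M' N by (rule tensor_pairI[OF M' N])

lemma tensor_map_balanced:
  assumes "linear_map R M M' f"
  shows "balanced R M N (tensor R M' N) (\<lambda>m n. pure_tensor R M' N (f m) n)"
  using linear_map_closed[OF assms]
  by (intro balancedI additiveI)
    (auto simp: M'N.pt_closed M'N.pt_add_left M'N.pt_add_right M'N.pt_smult
       linear_map_add[OF assms] linear_map_smult[OF assms])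

lemma tensor_map_additive:
  "linear_map R M M' f \<Longrightarrow> additive_map (tensor R M N) (tensor R M' N) (tensor_map R M' N f)"
  unfolding tensor_map_def by (rule MN.tensor_lift_additive[OF M'N.abelian_group_T tensor_map_balanced])

lemma tensor_map_pure:
  "linear_map R M M' f \<Longrightarrow> m \<in> carrier M \<Longrightarrow> n \<in> carrier N \<Longrightarrow>
   tensor_map R M' N f (pure_tensor R M N m n) = pure_tensor R M' N (f m) n"
  unfolding tensor_map_def by (rule MN.tensor_lift_pure[OF M'N.abelian_group_T tensor_map_balanced])

lemma tensor_map_surj:
  assumes f: "linear_map R M M' f" and surj: "f ` carrier M = carrier M'"
  shows "tensor_map R M' N f ` carrier (tensor R M N) = carrier (tensor R M' N)"
proof (rule M'N.tensor_subgroup_eqI)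
  show "subgroup (tensor_map R M' N f ` carrier (tensor R M N)) (add_monoid (tensor R M' N))"
    using subgroup_image[OF MN.abelian_group_T M'N.abelian_group_T tensor_map_additive[OF f], of "carrier (tensor R M N)"]
      MN.T.add.subgroup_self by simp
  show "pure_tensor R M' N m n \<in> tensor_map R M' N f ` carrier (tensor R M N)"
    if "m \<in> carrier M'" "n \<in> carrier N" for m n
  proof -
    from that(1) surj obtain e where "e \<in> carrier M" "m = f e" by blast
    then show ?thesis using that(2) tensor_map_pure[OF f] MN.pt_closed by (metis imageI)
  qed
qed

text \<open>
  Right exactness. Let \<open>I\<close> be spanned by the tensors \<open>k \<otimes> n\<close> with \<open>k\<close> in the kernel of \<open>f\<close>. Choosing a
  preimage of the first factor gives a well-defined balanced map to the quotient of \<open>M \<otimes> N\<close> by \<open>I\<close>, and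
  the induced map on \<open>M' \<otimes> N\<close> composed with \<open>f \<otimes> id\<close> is the projection to this quotient. So whatever
  \<open>f \<otimes> id\<close> kills lies in \<open>I\<close>.
\<close>

lemma tensor_map_kernel_surj:
  assumes f: "linear_map R M M' f" and surj: "f ` carrier M = carrier M'"
    and t: "t \<in> carrier (tensor R M N)" and t0: "tensor_map R M' N f t = \<zero>\<^bsub>tensor R M' N\<^esub>"
  shows "t \<in> generate (add_monoid (tensor R M N))
     {pure_tensor R M N k n | k n. k \<in> kernel_of M M' f \<and> n \<in> carrier N}" (is "t \<in> generate ?V ?P")
proof -
  let ?T = "tensor R M N"
  let ?I = "generate ?V ?P"
  have sub: "?P \<subseteq> carrier ?T" by (auto simp: kernel_of_def MN.pt_closed)
  have I: "subgroup ?I ?V" by (rule subgroup_generate_add[OF MN.abelian_group_T sub])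
  have Vc: "comm_group ?V" by (rule MN.T.a_comm_group)
  note Vg = comm_group.axioms(2)[OF Vc]
  have nI: "?I \<lhd> ?V" by (rule comm_group.subgroup_imp_normal[OF Vc I])
  define Q where "Q = additive_ring (?V Mod ?I)"
  define q where "q = (\<lambda>t. ?I #>\<^bsub>?V\<^esub> t)"
  have Q: "abelian_group Q"
    unfolding Q_def by (rule abelian_group_additive_ring[OF comm_group_quotient_abelian[OF Vc I]])
  then interpret Q: abelian_group Q .
  have q: "additive_map ?T Q q"
    using normal.r_coset_hom_Mod[OF nI] by (auto simp: additive_map_def hom_def Q_def q_def)
  have q0: "q s = \<zero>\<^bsub>Q\<^esub> \<longleftrightarrow> s \<in> ?I" if "s \<in> carrier ?T" for s
    using group.coset_join1[OF Vg _ _ I] group.coset_join2[OF Vg _ I] subgroup.subset[OF I] that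
    by (auto simp: Q_def q_def FactGroup_def)
  \<comment> \<open>two preimages of \<open>y\<close> differ by an element of the kernel, so the choice does not matter in the quotient\<close>
  define h where "h = (\<lambda>y n. q (pure_tensor R M N (inv_into (carrier M) f y) n))"
  have h: "h (f e) n = q (pure_tensor R M N e n)" if e: "e \<in> carrier M" and n: "n \<in> carrier N" for e n
  proof -
    define e' where "e' = inv_into (carrier M) f (f e)"
    have e': "e' \<in> carrier M" "f e' = f e"
      using e unfolding e'_def by (auto intro: inv_into_into f_inv_into_f)
    have k: "e' \<ominus>\<^bsub>M\<^esub> e \<in> kernel_of M M' f"
      using e e' linear_map_add[OF f, of e' "\<ominus>\<^bsub>M\<^esub> e"] linear_map_closed[OF f, of e]
        additive_minus[OF abelian_group_module[OF M] abelian_group_module[OF M'] linear_map_additive[OF f], of e]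
      by (simp add: kernel_of_def MN.M.minus_eq M'N.M.r_neg)
    have "e' = (e' \<ominus>\<^bsub>M\<^esub> e) \<oplus>\<^bsub>M\<^esub> e" using e e' by (simp add: MN.M.minus_eq MN.M.a_assoc MN.M.l_neg)
    then have "pure_tensor R M N e' n = pure_tensor R M N (e' \<ominus>\<^bsub>M\<^esub> e) n \<oplus>\<^bsub>?T\<^esub> pure_tensor R M N e n"
      using MN.pt_add_left[of "e' \<ominus>\<^bsub>M\<^esub> e" e n] e e' n by simp
    moreover have "q (pure_tensor R M N (e' \<ominus>\<^bsub>M\<^esub> e) n) = \<zero>\<^bsub>Q\<^esub>"
      using k n e e' by (subst q0) (auto simp: MN.pt_closed intro!: generate.incl)
    ultimately have "q (pure_tensor R M N e' n) = q (pure_tensor R M N e n)"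
      using e e' n by (simp add: additive_add[OF q] additive_closed[OF q] MN.pt_closed)
    then show ?thesis by (simp add: h_def e'_def)
  qed
  have pre: "\<exists>e\<in>carrier M. y = f e" if "y \<in> carrier M'" for y using surj that by blast
  have hb: "balanced R M' N Q h"
  proof (rule balancedI)
    fix n assume n: "n \<in> carrier N"
    show "additive_map M' Q (\<lambda>m. h m n)"
    proof (rule additiveI)
      fix x assume "x \<in> carrier M'"
      with pre obtain e where "e \<in> carrier M" "x = f e" by blast
      then show "h x n \<in> carrier Q" using n by (simp add: h additive_closed[OF q] MN.pt_closed)
    next
      fix x y assume "x \<in> carrier M'" "y \<in> carrier M'"
      with pre obtain e e' where e: "e \<in> carrier M" "x = f e" "e' \<in> carrier M" "y = f e'" by blast
      have "h (x \<oplus>\<^bsub>M'\<^esub> y) n = h (f (e \<oplus>\<^bsub>M\<^esub> e')) n" using e by (simp add: linear_map_add[OF f])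
      also have "\<dots> = h x n \<oplus>\<^bsub>Q\<^esub> h y n" using e n
        by (simp add: h MN.pt_add_left additive_add[OF q] MN.pt_closed)
      finally show "h (x \<oplus>\<^bsub>M'\<^esub> y) n = h x n \<oplus>\<^bsub>Q\<^esub> h y n" .
    qed
  next
    fix y assume "y \<in> carrier M'"
    with pre obtain e where e: "e \<in> carrier M" "y = f e" by blast
    then show "additive_map N Q (h y)"
      by (intro additiveI) (simp_all add: h MN.pt_add_right additive_add[OF q] additive_closed[OF q] MN.pt_closed)
  next
    fix r y n assume r: "r \<in> carrier R" "y \<in> carrier M'" "n \<in> carrier N"
    with pre obtain e where e: "e \<in> carrier M" "y = f e" by blast
    have "h (r \<odot>\<^bsub>M'\<^esub> y) n = h (f (r \<odot>\<^bsub>M\<^esub> e)) n" using e r by (simp add: linear_map_smult[OF f])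
    then show "h (r \<odot>\<^bsub>M'\<^esub> y) n = h y (r \<odot>\<^bsub>N\<^esub> n)" using e r by (simp add: h MN.pt_smult)
  qed
  have "tensor_lift Q (case_prod h) (tensor_map R M' N f t) = q t"
    by (rule MN.tensor_hom_ext[OF Q additive_comp[OF tensor_map_additive[OF f] M'N.tensor_lift_additive[OF Q hb]] q _ t])
      (simp add: tensor_map_pure[OF f] M'N.tensor_lift_pure[OF Q hb] linear_map_closed[OF f] h)
  then have "q t = \<zero>\<^bsub>Q\<^esub>"
    using t0 additive_zero[OF M'N.abelian_group_T Q M'N.tensor_lift_additive[OF Q hb]] by simp
  then show ?thesis using q0[OF t] by simp
qed

end

lemma tensor_map_comp:
  assumes "module R M" "module R M'" "module R M''" "module R N"
    "linear_map R M M' f" "linear_map R M' M'' g" "t \<in> carrier (tensor R M N)"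
  shows "tensor_map R M'' N g (tensor_map R M' N f t) = tensor_map R M'' N (\<lambda>x. g (f x)) t"
proof -
  interpret MN: tensor_pair R M N by (rule tensor_pairI[OF assms(1,4)])
  interpret M''N: tensor_pair R M'' N by (rule tensor_pairI[OF assms(3,4)])
  note gf = linear_map_comp[OF assms(5,6)]
  show ?thesis
    by (rule MN.tensor_hom_ext[OF M''N.abelian_group_T additive_comp[OF tensor_map_additive[OF assms(1,2,4,5)]
          tensor_map_additive[OF assms(2,3,4,6)]] tensor_map_additive[OF assms(1,3,4) gf] _ assms(7)])
      (simp add: tensor_map_pure[OF assms(1,2,4,5)] tensor_map_pure[OF assms(2,3,4,6)]
        tensor_map_pure[OF assms(1,3,4) gf] linear_map_closed[OF assms(5)])
qed

lemma tensor_map_id: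
  assumes "module R M" "module R N" "\<And>x. x \<in> carrier M \<Longrightarrow> f x = x" "t \<in> carrier (tensor R M N)"
  shows "tensor_map R M N f t = t"
proof -
  interpret MN: tensor_pair R M N by (rule tensor_pairI[OF assms(1,2)])
  have f: "linear_map R M M f" using assms(3) by (auto simp: linear_map_def)
  show ?thesis
    by (rule MN.tensor_hom_ext[OF MN.abelian_group_T tensor_map_additive[OF assms(1,1,2) f] additive_id _ assms(4)])
      (simp add: tensor_map_pure[OF assms(1,1,2) f] assms(3))
qed

text \<open>
  Flatness and projectivity are assumed for modules over a sum type only. A module is moved there by
  \<^const>\<open>Inr\<close>; the record extension \<open>w\<close> is a parameter so that the same copy serves plain and graded
  modules.
\<close>

definition copy_module :: "'w \<Rightarrow> ('a, 'm, 'z) module_scheme \<Rightarrow> ('a, 'c + 'm, 'w) module_scheme"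
  where "copy_module w M = \<lparr>carrier = Inr ` carrier M, monoid.mult = undefined, one = undefined,
    ring.zero = Inr \<zero>\<^bsub>M\<^esub>, ring.add = (\<lambda>x y. Inr (projr x \<oplus>\<^bsub>M\<^esub> projr y)),
    smult = (\<lambda>a x. Inr (a \<odot>\<^bsub>M\<^esub> projr x)), \<dots> = w\<rparr>"

lemma copy_module_simps [simp]:
  "carrier (copy_module w M) = Inr ` carrier M"
  "\<zero>\<^bsub>copy_module w M\<^esub> = Inr \<zero>\<^bsub>M\<^esub>"
  "x \<oplus>\<^bsub>copy_module w M\<^esub> y = Inr (projr x \<oplus>\<^bsub>M\<^esub> projr y)"
  "a \<odot>\<^bsub>copy_module w M\<^esub> x = Inr (a \<odot>\<^bsub>M\<^esub> projr x)"
  by (simp_all add: copy_module_def)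

lemma abelian_group_copy:
  assumes "abelian_group M" shows "abelian_group (copy_module w M)"
proof -
  interpret abelian_group M by fact
  show ?thesis
  proof (rule abelian_groupI)
    fix x assume "x \<in> carrier (copy_module w M)"
    then obtain y where "y \<in> carrier M" "x = Inr y" by auto
    then show "\<exists>y\<in>carrier (copy_module w M). y \<oplus>\<^bsub>copy_module w M\<^esub> x = \<zero>\<^bsub>copy_module w M\<^esub>"
      by (auto intro!: bexI[of _ "\<ominus>\<^bsub>M\<^esub> y"] simp: l_neg)
  qed (auto simp: a_ac)
qed

lemma module_copy:
  assumes "module R M" shows "module R (copy_module w M)"
proof -
  interpret module R M by fact
  show ?thesis
    by (rule moduleI) (auto simp: is_cring smult_l_distr smult_r_distr smult_assoc1
        intro: abelian_group_copy[OF abelian_group_module[OF assms]])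
qed

lemma left_module_copy:
  assumes "left_module A M" shows "left_module A (copy_module w M)"
proof -
  interpret left_module A M by fact
  show ?thesis
    by (intro left_module.intro left_module_axioms.intro A.ring_axioms abelian_group_copy M.abelian_group_axioms)
      (auto simp: smult_closed smult_l_distr smult_r_distr smult_assoc smult_one)
qed

lemma linear_map_Inr: "linear_map A M (copy_module w M) Inr"
  by (auto simp: linear_map_def)

lemma linear_map_projr: "linear_map A (copy_module w M) M projr"
  by (auto simp: linear_map_def)

text \<open>
  Conjugating with the isomorphisms to the copies transports the injectivity of \<open>f \<otimes> id\<close> back.
\<close>

lemma flat_module_inj:
  fixes E :: "('r, 'm, 'y) module_scheme" and F :: "('r, 'm, 'v) module_scheme"
  assumes flat: "flat_module TYPE('c + 'm) R N"
    and E: "module R E" and F: "module R F"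
    and f: "linear_map R E F f" and inj: "inj_on f (carrier E)"
  shows "inj_on (tensor_map R F N f) (carrier (tensor R E N))"
proof -
  have N: "module R N" using flat by (simp add: flat_module_def)
  define E' :: "('r, 'c + 'm) module" where "E' = copy_module () E"
  define F' :: "('r, 'c + 'm) module" where "F' = copy_module () F"
  define f' :: "'c + 'm \<Rightarrow> 'c + 'm" where "f' = (\<lambda>x. Inr (f (projr x)))"
  have E': "module R E'" and F': "module R F'" unfolding E'_def F'_def by (simp_all add: module_copy E F)
  have i: "linear_map R E E' Inr" and i': "linear_map R E' E projr"
    and j: "linear_map R F F' Inr" and j': "linear_map R F' F projr"
    unfolding E'_def F'_def by (simp_all add: linear_map_Inr linear_map_projr)
  have f': "linear_map R E' F' f'"
    unfolding f'_def by (rule linear_map_comp[OF linear_map_comp[OF i' f] j])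
  have "inj_on f' (carrier E')" using inj by (auto simp: inj_on_def f'_def E'_def)
  then have inj': "inj_on (tensor_map R F' N f') (carrier (tensor R E' N))"
    using flat E' F' f' by (auto simp: flat_module_def)
  show ?thesis
  proof (rule inj_onI)
    fix s t assume st: "s \<in> carrier (tensor R E N)" "t \<in> carrier (tensor R E N)"
      and eq: "tensor_map R F N f s = tensor_map R F N f t"
    have f'u: "tensor_map R F' N f' (tensor_map R E' N Inr u) = tensor_map R F' N Inr (tensor_map R F N f u)"
      if u: "u \<in> carrier (tensor R E N)" for u
      using tensor_map_comp[OF E E' F' N i f' u] tensor_map_comp[OF E F F' N f j u]
      by (simp add: f'_def)
    have retract: "tensor_map R E N projr (tensor_map R E' N Inr u) = u"
      if u: "u \<in> carrier (tensor R E N)" for u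
      using tensor_map_comp[OF E E' E N i i' u] tensor_map_id[OF E N _ u, of "\<lambda>x. projr (Inr x)"] by simp
    have "tensor_map R E' N Inr s = tensor_map R E' N Inr t"
      by (rule inj_onD[OF inj'])
        (use st eq f'u additive_closed[OF tensor_map_additive[OF E E' N i]] in auto)
    then show "s = t" using retract st by metis
  qed
qed

text \<open>
  Factor \<open>f\<close> through its image \<open>F'\<close>. By right exactness the first factor has the stated kernel after
  tensoring, and by flatness the inclusion of \<open>F'\<close> stays injective.
\<close>

lemma kernel_tensor_map_flat:
  fixes E :: "('r, 'm, 'y) module_scheme" and F :: "('r, 'm, 'v) module_scheme"
  assumes flat: "flat_module TYPE('c + 'm) R N"
    and E: "module R E" and F: "module R F" and f: "linear_map R E F f"
  shows "kernel_of (tensor R E N) (tensor R F N) (tensor_map R F N f) =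
    generate (add_monoid (tensor R E N)) {pure_tensor R E N k n | k n. k \<in> kernel_of E F f \<and> n \<in> carrier N}"
    (is "?L = ?G")
proof
  have N: "module R N" using flat by (simp add: flat_module_def)
  interpret EN: tensor_pair R E N by (rule tensor_pairI[OF E N])
  interpret FN: tensor_pair R F N by (rule tensor_pairI[OF F N])
  define F' where "F' = F\<lparr>carrier := f ` carrier E\<rparr>"
  have sub: "submodule (f ` carrier E) R F"
  proof (rule module.submoduleI[OF F])
    show "f ` carrier E \<subseteq> carrier F" using linear_map_closed[OF f] by auto
    have sg: "subgroup (f ` carrier E) (add_monoid F)"
      using subgroup_image[OF abelian_group_module[OF E] abelian_group_module[OF F] linear_map_additive[OF f], of "carrier E"]
        EN.M.add.subgroup_self by simp
    note subgroup_addD[OF abelian_group_module[OF F] sg]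
    then show "\<zero>\<^bsub>F\<^esub> \<in> f ` carrier E" "\<And>a. a \<in> f ` carrier E \<Longrightarrow> \<ominus>\<^bsub>F\<^esub> a \<in> f ` carrier E"
      "\<And>a b. a \<in> f ` carrier E \<Longrightarrow> b \<in> f ` carrier E \<Longrightarrow> a \<oplus>\<^bsub>F\<^esub> b \<in> f ` carrier E" by blast+
    show "a \<odot>\<^bsub>F\<^esub> x \<in> f ` carrier E" if "a \<in> carrier R" "x \<in> f ` carrier E" for a x
    proof -
      from that obtain e where e: "e \<in> carrier E" "x = f e" by blast
      then have "a \<odot>\<^bsub>F\<^esub> x = f (a \<odot>\<^bsub>E\<^esub> e)" using that by (simp add: linear_map_smult[OF f])
      then show ?thesis using that e by simp
    qed
  qed
  have F': "module R F'" unfolding F'_def by (rule submodule.submodule_is_module[OF sub F])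
  interpret F'N: tensor_pair R F' N by (rule tensor_pairI[OF F' N])
  have f': "linear_map R E F' f" using f by (auto simp: linear_map_def F'_def)
  have incl: "linear_map R F' F (\<lambda>x. x)" using linear_map_closed[OF f] by (auto simp: linear_map_def F'_def)
  have inj: "inj_on (tensor_map R F N (\<lambda>x. x)) (carrier (tensor R F' N))"
    by (rule flat_module_inj[OF flat F' F incl]) simp
  have kk: "kernel_of E F' f = kernel_of E F f" by (simp add: kernel_of_def F'_def)
  show "?L \<subseteq> ?G"
  proof
    fix t assume "t \<in> ?L"
    then have t: "t \<in> carrier (tensor R E N)" "tensor_map R F N f t = \<zero>\<^bsub>tensor R F N\<^esub>"
      by (auto simp: kernel_of_def)
    have "tensor_map R F N (\<lambda>x. x) (tensor_map R F' N f t) = \<zero>\<^bsub>tensor R F N\<^esub>"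
      using tensor_map_comp[OF E F' F N f' incl t(1)] t(2) by simp
    also have "\<dots> = tensor_map R F N (\<lambda>x. x) \<zero>\<^bsub>tensor R F' N\<^esub>"
      using additive_zero[OF F'N.abelian_group_T FN.abelian_group_T tensor_map_additive[OF F' F N incl]] by simp
    finally have "tensor_map R F' N f t = \<zero>\<^bsub>tensor R F' N\<^esub>"
      by (rule inj_onD[OF inj]) (use additive_closed[OF tensor_map_additive[OF E F' N f'] t(1)] in auto)
    then have "t \<in> generate (add_monoid (tensor R E N))
        {pure_tensor R E N k n | k n. k \<in> kernel_of E F' f \<and> n \<in> carrier N}"
      by (intro tensor_map_kernel_surj[OF E F' N f' _ t(1)]) (simp add: F'_def)
    then show "t \<in> ?G" by (simp add: kk)
  qed
  show "?G \<subseteq> ?L"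
  proof (rule generate_add_subset[OF EN.abelian_group_T])
    note ad = tensor_map_additive[OF E F N f]
    show "subgroup ?L (add_monoid (tensor R E N))"
      using subgroup_vimage[OF EN.abelian_group_T FN.abelian_group_T ad, of "{\<zero>\<^bsub>tensor R F N\<^esub>}"]
        FN.T.add.triv_subgroup by (simp add: kernel_of_def)
    have "pure_tensor R F N \<zero>\<^bsub>F\<^esub> n = \<zero>\<^bsub>tensor R F N\<^esub>" if "n \<in> carrier N" for n
      using additive_zero[OF abelian_group_module[OF F] FN.abelian_group_T, of "\<lambda>m. pure_tensor R F N m n"]
        FN.pt_balanced that by (auto simp: balanced_def)
    then show "{pure_tensor R E N k n | k n. k \<in> kernel_of E F f \<and> n \<in> carrier N} \<subseteq> ?L"
      by (auto simp: kernel_of_def EN.pt_closed tensor_map_pure[OF E F N f])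
  qed
qed

section \<open>Gradings by projections\<close>

lemma subgroup_add_cong:
  assumes "abelian_group V" "abelian_group W" "carrier V = carrier W" "\<zero>\<^bsub>V\<^esub> = \<zero>\<^bsub>W\<^esub>"
    "\<And>x y. x \<oplus>\<^bsub>V\<^esub> y = x \<oplus>\<^bsub>W\<^esub> y" "subgroup H (add_monoid V)"
  shows "subgroup H (add_monoid W)"
proof (rule subgroup_addI[OF assms(2)])
  note H = subgroup_addD[OF assms(1,6)]
  have "\<ominus>\<^bsub>V\<^esub> x = \<ominus>\<^bsub>W\<^esub> x" for x
    by (simp add: a_inv_def m_inv_def assms(3-5))
  then show "H \<subseteq> carrier W" "\<zero>\<^bsub>W\<^esub> \<in> H" "\<And>x y. x \<in> H \<Longrightarrow> y \<in> H \<Longrightarrow> x \<oplus>\<^bsub>W\<^esub> y \<in> H"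
    "\<And>x. x \<in> H \<Longrightarrow> \<ominus>\<^bsub>W\<^esub> x \<in> H"
    using H assms(3-5) by auto
qed

text \<open>
  Components are determined by the additive group alone, so graded algebras, graded modules and their
  underlying \<open>R\<close>-modules can share this theory.
\<close>

locale graded_group = abelian_group M
  for \<Gamma> :: "('g, 'x) monoid_scheme" and M :: "('s, 'm, 'g, 'z) graded_scheme" +
  assumes part_subgroup: "\<gamma> \<in> carrier \<Gamma> \<Longrightarrow> subgroup (part M \<gamma>) (add_monoid M)"
    and parts_direct: "direct_sum_of_parts \<Gamma> M"
begin

abbreviation comp :: "'m \<Rightarrow> 'g \<Rightarrow> 'm" where "comp \<equiv> homog_comp \<Gamma> M"

lemma part_carrier: "\<gamma> \<in> carrier \<Gamma> \<Longrightarrow> x \<in> part M \<gamma> \<Longrightarrow> x \<in> carrier M"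
  using subgroup.subset[OF part_subgroup] by auto

lemmas part_add = subgroup_addD(3)[OF abelian_group_axioms part_subgroup]
lemmas part_zero = subgroup_addD(2)[OF abelian_group_axioms part_subgroup]

lemma decomposes_fsum:
  "decomposes \<Gamma> M x c \<longleftrightarrow> c \<in> (\<Pi>\<^sub>E \<gamma>\<in>carrier \<Gamma>. part M \<gamma>) \<and>
    finite {\<gamma> \<in> carrier \<Gamma>. c \<gamma> \<noteq> \<zero>\<^bsub>M\<^esub>} \<and> x = fsum M c (carrier \<Gamma>)"
  unfolding decomposes_def using fsum_support[of "carrier \<Gamma>" c] by auto

lemma decomposes_comp: "x \<in> carrier M \<Longrightarrow> decomposes \<Gamma> M x (comp x)"
  using parts_direct unfolding direct_sum_of_parts_def homog_comp_def by (metis theI')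

lemma comp_eqI: "x \<in> carrier M \<Longrightarrow> decomposes \<Gamma> M x c \<Longrightarrow> comp x = c"
  using parts_direct decomposes_comp unfolding direct_sum_of_parts_def by blast

lemma comp_part: "x \<in> carrier M \<Longrightarrow> \<gamma> \<in> carrier \<Gamma> \<Longrightarrow> comp x \<gamma> \<in> part M \<gamma>"
  using decomposes_comp[of x] by (auto simp: decomposes_def PiE_iff)

lemma comp_closed: "x \<in> carrier M \<Longrightarrow> \<gamma> \<in> carrier \<Gamma> \<Longrightarrow> comp x \<gamma> \<in> carrier M"
  by (rule part_carrier[OF _ comp_part])

lemma comp_finite: "x \<in> carrier M \<Longrightarrow> finite {\<gamma> \<in> carrier \<Gamma>. comp x \<gamma> \<noteq> \<zero>\<^bsub>M\<^esub>}"
  using decomposes_comp[of x] by (auto simp: decomposes_def)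

lemma fsum_comp: "x \<in> carrier M \<Longrightarrow> fsum M (comp x) (carrier \<Gamma>) = x"
  using decomposes_comp[of x] by (simp add: decomposes_fsum)

lemma comp_add:
  assumes x: "x \<in> carrier M" and y: "y \<in> carrier M" and \<gamma>: "\<gamma> \<in> carrier \<Gamma>"
  shows "comp (x \<oplus>\<^bsub>M\<^esub> y) \<gamma> = comp x \<gamma> \<oplus>\<^bsub>M\<^esub> comp y \<gamma>"
proof -
  let ?c = "restrict (\<lambda>\<gamma>. comp x \<gamma> \<oplus>\<^bsub>M\<^esub> comp y \<gamma>) (carrier \<Gamma>)"
  have "finite {\<gamma> \<in> carrier \<Gamma>. comp x \<gamma> \<oplus>\<^bsub>M\<^esub> comp y \<gamma> \<noteq> \<zero>\<^bsub>M\<^esub>}"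
    by (rule finite_subset[OF _ finite_UnI[OF comp_finite[OF x] comp_finite[OF y]]]) auto
  moreover have "{\<gamma> \<in> carrier \<Gamma>. ?c \<gamma> \<noteq> \<zero>\<^bsub>M\<^esub>} = {\<gamma> \<in> carrier \<Gamma>. comp x \<gamma> \<oplus>\<^bsub>M\<^esub> comp y \<gamma> \<noteq> \<zero>\<^bsub>M\<^esub>}"
    by auto
  ultimately have "finite {\<gamma> \<in> carrier \<Gamma>. ?c \<gamma> \<noteq> \<zero>\<^bsub>M\<^esub>}" by simp
  moreover have "fsum M ?c (carrier \<Gamma>) = x \<oplus>\<^bsub>M\<^esub> y"
  proof -
    have "fsum M ?c (carrier \<Gamma>) = fsum M (\<lambda>\<gamma>. comp x \<gamma> \<oplus>\<^bsub>M\<^esub> comp y \<gamma>) (carrier \<Gamma>)"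
      by (rule fsum_cong) (use x y comp_closed in auto)
    also have "\<dots> = x \<oplus>\<^bsub>M\<^esub> y"
      using fsum_add[OF comp_finite[OF x] comp_finite[OF y]] x y comp_closed by (simp add: fsum_comp)
    finally show ?thesis .
  qed
  ultimately have "decomposes \<Gamma> M (x \<oplus>\<^bsub>M\<^esub> y) ?c"
    using x y by (auto simp: decomposes_fsum intro: part_add comp_part)
  then have "comp (x \<oplus>\<^bsub>M\<^esub> y) = ?c" using x y by (intro comp_eqI) auto
  then show ?thesis using \<gamma> by simp
qed

lemma comp_additive: "\<gamma> \<in> carrier \<Gamma> \<Longrightarrow> additive_map M M (\<lambda>x. comp x \<gamma>)"
  by (intro additiveI) (auto simp: comp_add comp_closed)

lemma comp_homogeneous:
  assumes \<gamma>: "\<gamma> \<in> carrier \<Gamma>" and x: "x \<in> part M \<gamma>" and \<delta>: "\<delta> \<in> carrier \<Gamma>"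
  shows "comp x \<delta> = (if \<delta> = \<gamma> then x else \<zero>\<^bsub>M\<^esub>)"
proof -
  let ?c = "restrict (\<lambda>\<delta>. if \<delta> = \<gamma> then x else \<zero>\<^bsub>M\<^esub>) (carrier \<Gamma>)"
  have x': "x \<in> carrier M" using part_carrier \<gamma> x .
  have "fsum M ?c (carrier \<Gamma>) = ?c \<gamma>"
    by (rule fsum_single) (use \<gamma> x' in auto)
  moreover have "finite {\<delta> \<in> carrier \<Gamma>. ?c \<delta> \<noteq> \<zero>\<^bsub>M\<^esub>}"
    by (rule finite_subset[of _ "{\<gamma>}"]) auto
  ultimately have "decomposes \<Gamma> M x ?c"
    using \<gamma> x by (auto simp: decomposes_fsum part_zero)
  then have "comp x = ?c" using x' by (intro comp_eqI)
  then show ?thesis using \<delta> by simp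
qed

lemma comp_same: "\<gamma> \<in> carrier \<Gamma> \<Longrightarrow> x \<in> part M \<gamma> \<Longrightarrow> comp x \<gamma> = x"
  by (simp add: comp_homogeneous)

lemma subgroup_of_parts:
  assumes "subgroup H (add_monoid M)" "\<And>\<gamma>. \<gamma> \<in> carrier \<Gamma> \<Longrightarrow> part M \<gamma> \<subseteq> H"
  shows "H = carrier M"
proof
  show "H \<subseteq> carrier M" using subgroup.subset[OF assms(1)] by simp
  show "carrier M \<subseteq> H"
  proof
    fix x assume x: "x \<in> carrier M"
    have "fsum M (comp x) (carrier \<Gamma>) \<in> H"
      using assms(2) comp_part[OF x] by (intro fsum_in_subgroup[OF assms(1)]) auto
    then show "x \<in> H" using fsum_comp[OF x] by simp
  qed
qed

text \<open>
  A graded group is generated by its homogeneous elements.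
\<close>

lemma homogeneous_ext:
  assumes "abelian_group Y" "additive_map M Y f" "additive_map M Y g"
    "\<And>\<gamma> x. \<gamma> \<in> carrier \<Gamma> \<Longrightarrow> x \<in> part M \<gamma> \<Longrightarrow> f x = g x" "x \<in> carrier M"
  shows "f x = g x"
proof -
  interpret Y: abelian_group Y by fact
  have "f x = f (fsum M (comp x) (carrier \<Gamma>))" by (simp add: fsum_comp assms(5))
  also have "\<dots> = fsum Y (\<lambda>\<gamma>. f (comp x \<gamma>)) (carrier \<Gamma>)"
    by (rule additive_fsum[OF abelian_group_axioms assms(1,2) comp_finite[OF assms(5)]])
      (use comp_closed assms(5) in auto)
  also have "\<dots> = fsum Y (\<lambda>\<gamma>. g (comp x \<gamma>)) (carrier \<Gamma>)"
  proof (rule Y.fsum_cong)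
    fix \<gamma> assume g: "\<gamma> \<in> carrier \<Gamma>"
    show "f (comp x \<gamma>) \<in> carrier Y" by (rule additive_closed[OF assms(2) comp_closed[OF assms(5) g]])
    show "f (comp x \<gamma>) = g (comp x \<gamma>)" by (rule assms(4)[OF g comp_part[OF assms(5) g]])
  qed
  also have "\<dots> = g (fsum M (comp x) (carrier \<Gamma>))"
    by (rule additive_fsum[OF abelian_group_axioms assms(1,3) comp_finite[OF assms(5)], symmetric])
      (use comp_closed assms(5) in auto)
  finally show ?thesis by (simp add: fsum_comp assms(5))
qed

text \<open>
  The universal property of a direct sum: a family of additive maps \<open>t \<gamma>\<close>, one for each degree, combines
  to one additive map that equals \<open>t \<gamma>\<close> on the part of degree \<open>\<gamma>\<close>. The sum over \<^const>\<open>degrees\<close> is the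
  form in which the product of \<open>A \<ltimes> B\<close> is defined.
\<close>

context
  fixes Y :: "('y, 'w) ring_scheme" and t :: "'g \<Rightarrow> 'm \<Rightarrow> 'y"
  assumes Y: "abelian_group Y" and t: "\<And>\<gamma>. \<gamma> \<in> carrier \<Gamma> \<Longrightarrow> additive_map M Y (t \<gamma>)"
begin

lemma degreewise_fsum:
  assumes x: "x \<in> carrier M"
  shows "(\<Oplus>\<^bsub>Y\<^esub>\<gamma>\<in>degrees \<Gamma> M x. t \<gamma> (comp x \<gamma>)) = fsum Y (\<lambda>\<gamma>. t \<gamma> (comp x \<gamma>)) (carrier \<Gamma>)"
  unfolding degrees_def
  by (rule abelian_group.fsum_eq_finsum_superset[OF Y, symmetric])
    (use comp_finite[OF x] x additive_closed[OF t] comp_closed additive_zero[OF abelian_group_axioms Y t] in auto)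

lemma degreewise_additive:
  "additive_map M Y (\<lambda>x. \<Oplus>\<^bsub>Y\<^esub>\<gamma>\<in>degrees \<Gamma> M x. t \<gamma> (comp x \<gamma>))"
proof -
  have "additive_map M Y (\<lambda>x. fsum Y (\<lambda>\<gamma>. t \<gamma> (comp x \<gamma>)) (carrier \<Gamma>))"
  proof (rule additive_fsum_fun[OF Y])
    fix \<gamma> assume "\<gamma> \<in> carrier \<Gamma>"
    then show "additive_map M Y (\<lambda>x. t \<gamma> (comp x \<gamma>))"
      using additive_comp[OF comp_additive t] by blast
  next
    fix x assume x: "x \<in> carrier M"
    show "finite {\<gamma> \<in> carrier \<Gamma>. t \<gamma> (comp x \<gamma>) \<noteq> \<zero>\<^bsub>Y\<^esub>}"
      by (rule finite_subset[OF _ comp_finite[OF x]])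
        (use additive_zero[OF abelian_group_axioms Y t] in auto)
  qed
  then show ?thesis
    by (simp add: additive_map_def Pi_iff degreewise_fsum)
qed

lemma degreewise_homogeneous:
  assumes "\<gamma> \<in> carrier \<Gamma>" "x \<in> part M \<gamma>"
  shows "(\<Oplus>\<^bsub>Y\<^esub>\<gamma>\<in>degrees \<Gamma> M x. t \<gamma> (comp x \<gamma>)) = t \<gamma> x"
proof -
  have x: "x \<in> carrier M" using part_carrier assms .
  have "fsum Y (\<lambda>\<gamma>. t \<gamma> (comp x \<gamma>)) (carrier \<Gamma>) = t \<gamma> (comp x \<gamma>)"
    by (rule abelian_group.fsum_single[OF Y assms(1)])
      (use x additive_closed[OF t] comp_closed additive_zero[OF abelian_group_axioms Y t]
        comp_homogeneous[OF assms] in auto)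
  then show ?thesis using degreewise_fsum[OF x] comp_same[OF assms] by simp
qed

end

end

lemma graded_map_comp:
  assumes M: "graded_group \<Gamma> M" and M': "graded_group \<Gamma> M'"
    and f: "additive_map M M' f" and fp: "\<And>\<gamma>. \<gamma> \<in> carrier \<Gamma> \<Longrightarrow> f ` part M \<gamma> \<subseteq> part M' \<gamma>"
    and x: "x \<in> carrier M" and \<gamma>: "\<gamma> \<in> carrier \<Gamma>"
  shows "homog_comp \<Gamma> M' (f x) \<gamma> = f (homog_comp \<Gamma> M x \<gamma>)"
proof -
  interpret M: graded_group \<Gamma> M by fact
  interpret M': graded_group \<Gamma> M' by fact
  have z: "f \<zero>\<^bsub>M\<^esub> = \<zero>\<^bsub>M'\<^esub>"
    by (rule additive_zero[OF M.abelian_group_axioms M'.abelian_group_axioms f])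
  show ?thesis
  proof (rule M.homogeneous_ext[OF M'.abelian_group_axioms _ _ _ x])
    show "additive_map M M' (\<lambda>x. homog_comp \<Gamma> M' (f x) \<gamma>)"
      by (rule additive_comp[OF f M'.comp_additive[OF \<gamma>]])
    show "additive_map M M' (\<lambda>x. f (homog_comp \<Gamma> M x \<gamma>))"
      by (rule additive_comp[OF M.comp_additive[OF \<gamma>] f])
    fix \<delta> y assume d: "\<delta> \<in> carrier \<Gamma>" "y \<in> part M \<delta>"
    then have "f y \<in> part M' \<delta>" using fp by auto
    then show "homog_comp \<Gamma> M' (f y) \<gamma> = f (homog_comp \<Gamma> M y \<gamma>)"
      using M.comp_homogeneous[OF d \<gamma>] M'.comp_homogeneous[OF d(1) _ \<gamma>] z by simp
  qed
qed

text \<open>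
  Existence and uniqueness of decompositions follow at once if there are additive projections to the
  parts which annihilate the other parts: the elements that are the sum of their projections form a
  subgroup containing all parts, and the projections read off the coefficients of any decomposition.
  All gradings below are obtained in this way, and the projections are then the components.
\<close>

lemma projections_direct_sum:
  fixes M :: "('s, 'm, 'g, 'z) graded_scheme"
  assumes M: "abelian_group M"
    and part: "\<And>\<gamma>. \<gamma> \<in> carrier \<Gamma> \<Longrightarrow> subgroup (part M \<gamma>) (add_monoid M)"
    and \<pi>: "\<And>\<gamma>. \<gamma> \<in> carrier \<Gamma> \<Longrightarrow> additive_map M M (\<pi> \<gamma>)"
    and \<pi>_part: "\<And>\<gamma> x. \<gamma> \<in> carrier \<Gamma> \<Longrightarrow> x \<in> carrier M \<Longrightarrow> \<pi> \<gamma> x \<in> part M \<gamma>"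
    and \<pi>_id: "\<And>\<gamma> x. \<gamma> \<in> carrier \<Gamma> \<Longrightarrow> x \<in> part M \<gamma> \<Longrightarrow> \<pi> \<gamma> x = x"
    and \<pi>_zero: "\<And>\<gamma> \<delta> x. \<gamma> \<in> carrier \<Gamma> \<Longrightarrow> \<delta> \<in> carrier \<Gamma> \<Longrightarrow> \<delta> \<noteq> \<gamma> \<Longrightarrow> x \<in> part M \<delta> \<Longrightarrow> \<pi> \<gamma> x = \<zero>\<^bsub>M\<^esub>"
    and gen: "\<And>H. subgroup H (add_monoid M) \<Longrightarrow> (\<And>\<gamma>. \<gamma> \<in> carrier \<Gamma> \<Longrightarrow> part M \<gamma> \<subseteq> H) \<Longrightarrow> carrier M \<subseteq> H"
  shows "graded_group \<Gamma> M"
    and "\<And>x \<gamma>. x \<in> carrier M \<Longrightarrow> \<gamma> \<in> carrier \<Gamma> \<Longrightarrow> homog_comp \<Gamma> M x \<gamma> = \<pi> \<gamma> x"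
proof -
  interpret M: abelian_group M by fact
  have \<pi>0: "\<pi> \<gamma> \<zero>\<^bsub>M\<^esub> = \<zero>\<^bsub>M\<^esub>" if "\<gamma> \<in> carrier \<Gamma>" for \<gamma>
    by (rule additive_zero[OF M M \<pi>[OF that]])
  have partc: "x \<in> carrier M" if "\<gamma> \<in> carrier \<Gamma>" "x \<in> part M \<gamma>" for \<gamma> x
    using subgroup.subset[OF part[OF that(1)]] that(2) by auto
  have dec_iff: "decomposes \<Gamma> M x c \<longleftrightarrow> c \<in> (\<Pi>\<^sub>E \<gamma>\<in>carrier \<Gamma>. part M \<gamma>) \<and>
    finite {\<gamma> \<in> carrier \<Gamma>. c \<gamma> \<noteq> \<zero>\<^bsub>M\<^esub>} \<and> x = fsum M c (carrier \<Gamma>)" for x c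
    unfolding decomposes_def using M.fsum_support[of "carrier \<Gamma>" c] by auto
  \<comment> \<open>the elements recovered from their projections\<close>
  define H where "H = {x \<in> carrier M. finite {\<gamma> \<in> carrier \<Gamma>. \<pi> \<gamma> x \<noteq> \<zero>\<^bsub>M\<^esub>} \<and> fsum M (\<lambda>\<gamma>. \<pi> \<gamma> x) (carrier \<Gamma>) = x}"
  have cl: "\<pi> \<gamma> x \<in> carrier M" if "\<gamma> \<in> carrier \<Gamma>" "x \<in> carrier M" for \<gamma> x
    using partc \<pi>_part that by blast
  have "subgroup H (add_monoid M)"
  proof (rule subgroup_addI[OF M])
    show "H \<subseteq> carrier M" by (auto simp: H_def)
    have "{\<gamma> \<in> carrier \<Gamma>. \<pi> \<gamma> \<zero>\<^bsub>M\<^esub> \<noteq> \<zero>\<^bsub>M\<^esub>} = {}" using \<pi>0 by auto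
    then have "finite {\<gamma> \<in> carrier \<Gamma>. \<pi> \<gamma> \<zero>\<^bsub>M\<^esub> \<noteq> \<zero>\<^bsub>M\<^esub>}" by (simp only: finite.emptyI)
    then show "\<zero>\<^bsub>M\<^esub> \<in> H" unfolding H_def using \<pi>0 by (auto intro: M.fsum_zero)
    show "x \<oplus>\<^bsub>M\<^esub> y \<in> H" if x: "x \<in> H" and y: "y \<in> H" for x y
    proof -
      have xy: "x \<in> carrier M" "y \<in> carrier M" and fin: "finite {\<gamma> \<in> carrier \<Gamma>. \<pi> \<gamma> x \<noteq> \<zero>\<^bsub>M\<^esub>}"
        "finite {\<gamma> \<in> carrier \<Gamma>. \<pi> \<gamma> y \<noteq> \<zero>\<^bsub>M\<^esub>}" using x y by (auto simp: H_def)
      have "finite {\<gamma> \<in> carrier \<Gamma>. \<pi> \<gamma> (x \<oplus>\<^bsub>M\<^esub> y) \<noteq> \<zero>\<^bsub>M\<^esub>}"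
        by (rule finite_subset[OF _ finite_UnI[OF fin]]) (use additive_add[OF \<pi>] xy in auto)
      moreover have "fsum M (\<lambda>\<gamma>. \<pi> \<gamma> (x \<oplus>\<^bsub>M\<^esub> y)) (carrier \<Gamma>) = x \<oplus>\<^bsub>M\<^esub> y"
      proof -
        have "fsum M (\<lambda>\<gamma>. \<pi> \<gamma> (x \<oplus>\<^bsub>M\<^esub> y)) (carrier \<Gamma>) = fsum M (\<lambda>\<gamma>. \<pi> \<gamma> x \<oplus>\<^bsub>M\<^esub> \<pi> \<gamma> y) (carrier \<Gamma>)"
          by (rule M.fsum_cong) (use cl xy additive_add[OF \<pi>] in auto)
        also have "\<dots> = x \<oplus>\<^bsub>M\<^esub> y" using M.fsum_add[OF fin] cl xy x y by (simp add: H_def)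
        finally show ?thesis .
      qed
      ultimately show ?thesis using xy by (simp add: H_def)
    qed
    show "\<ominus>\<^bsub>M\<^esub> x \<in> H" if x: "x \<in> H" for x
    proof -
      have xc: "x \<in> carrier M" and fin: "finite {\<gamma> \<in> carrier \<Gamma>. \<pi> \<gamma> x \<noteq> \<zero>\<^bsub>M\<^esub>}"
        and sx: "fsum M (\<lambda>\<gamma>. \<pi> \<gamma> x) (carrier \<Gamma>) = x" using x by (auto simp: H_def)
      have neg: "additive_map M M (\<lambda>x. \<ominus>\<^bsub>M\<^esub> x)" by (rule additiveI) (auto simp: M.minus_add)
      have "finite {\<gamma> \<in> carrier \<Gamma>. \<pi> \<gamma> (\<ominus>\<^bsub>M\<^esub> x) \<noteq> \<zero>\<^bsub>M\<^esub>}"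
        by (rule finite_subset[OF _ fin]) (use additive_minus[OF M M \<pi>] xc in auto)
      moreover have "fsum M (\<lambda>\<gamma>. \<pi> \<gamma> (\<ominus>\<^bsub>M\<^esub> x)) (carrier \<Gamma>) = \<ominus>\<^bsub>M\<^esub> x"
      proof -
        have "fsum M (\<lambda>\<gamma>. \<pi> \<gamma> (\<ominus>\<^bsub>M\<^esub> x)) (carrier \<Gamma>) = fsum M (\<lambda>\<gamma>. \<ominus>\<^bsub>M\<^esub> \<pi> \<gamma> x) (carrier \<Gamma>)"
          by (rule M.fsum_cong) (use cl xc additive_minus[OF M M \<pi>] in auto)
        also have "\<dots> = \<ominus>\<^bsub>M\<^esub> x" using additive_fsum[OF M M neg fin] cl xc sx by simp
        finally show ?thesis .
      qed
      ultimately show ?thesis using xc by (simp add: H_def)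
    qed
  qed
  moreover have "part M \<gamma> \<subseteq> H" if \<gamma>: "\<gamma> \<in> carrier \<Gamma>" for \<gamma>
  proof
    fix x assume x: "x \<in> part M \<gamma>"
    have "finite {\<delta> \<in> carrier \<Gamma>. \<pi> \<delta> x \<noteq> \<zero>\<^bsub>M\<^esub>}"
      by (rule finite_subset[of _ "{\<gamma>}"]) (use \<pi>_zero[OF _ \<gamma> _ x] in auto)
    moreover have "fsum M (\<lambda>\<delta>. \<pi> \<delta> x) (carrier \<Gamma>) = \<pi> \<gamma> x"
      by (rule M.fsum_single[OF \<gamma>]) (use cl partc[OF \<gamma> x] \<pi>_zero[OF _ \<gamma> _ x] in auto)
    ultimately show "x \<in> H" using partc[OF \<gamma> x] \<pi>_id[OF \<gamma> x] by (simp add: H_def)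
  qed
  ultimately have H: "carrier M \<subseteq> H" by (rule gen)
  have ex: "decomposes \<Gamma> M x (restrict (\<lambda>\<gamma>. \<pi> \<gamma> x) (carrier \<Gamma>))" if x: "x \<in> carrier M" for x
  proof -
    have fin: "finite {\<gamma> \<in> carrier \<Gamma>. \<pi> \<gamma> x \<noteq> \<zero>\<^bsub>M\<^esub>}"
      and sx: "fsum M (\<lambda>\<gamma>. \<pi> \<gamma> x) (carrier \<Gamma>) = x" using x H by (auto simp: H_def)
    have "fsum M (restrict (\<lambda>\<gamma>. \<pi> \<gamma> x) (carrier \<Gamma>)) (carrier \<Gamma>) = x"
      by (subst sx[symmetric], rule M.fsum_cong) (use cl x in auto)
    moreover have "{\<gamma> \<in> carrier \<Gamma>. restrict (\<lambda>\<gamma>. \<pi> \<gamma> x) (carrier \<Gamma>) \<gamma> \<noteq> \<zero>\<^bsub>M\<^esub>} = {\<gamma> \<in> carrier \<Gamma>. \<pi> \<gamma> x \<noteq> \<zero>\<^bsub>M\<^esub>}"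
      by auto
    ultimately show ?thesis using fin \<pi>_part x by (auto simp: dec_iff)
  qed
  have un: "c = restrict (\<lambda>\<gamma>. \<pi> \<gamma> x) (carrier \<Gamma>)" if c: "decomposes \<Gamma> M x c" for x c
  proof (rule extensionalityI)
    show "c \<in> extensional (carrier \<Gamma>)" using c by (auto simp: decomposes_def PiE_iff)
    show "restrict (\<lambda>\<gamma>. \<pi> \<gamma> x) (carrier \<Gamma>) \<in> extensional (carrier \<Gamma>)" by simp
    fix \<gamma> assume \<gamma>: "\<gamma> \<in> carrier \<Gamma>"
    have cp: "c \<delta> \<in> part M \<delta>" if "\<delta> \<in> carrier \<Gamma>" for \<delta> using c that by (auto simp: decomposes_def PiE_iff)
    have fin: "finite {\<gamma> \<in> carrier \<Gamma>. c \<gamma> \<noteq> \<zero>\<^bsub>M\<^esub>}" and x: "x = fsum M c (carrier \<Gamma>)"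
      using c by (auto simp: dec_iff)
    have "\<pi> \<gamma> x = fsum M (\<lambda>\<delta>. \<pi> \<gamma> (c \<delta>)) (carrier \<Gamma>)"
      unfolding x by (rule additive_fsum[OF M M \<pi>[OF \<gamma>] fin]) (use cp partc in blast)
    also have "\<dots> = \<pi> \<gamma> (c \<gamma>)"
      by (rule M.fsum_single[OF \<gamma>]) (use cp partc cl \<gamma> \<pi>_zero in blast)+
    finally show "c \<gamma> = restrict (\<lambda>\<gamma>. \<pi> \<gamma> x) (carrier \<Gamma>) \<gamma>"
      using \<gamma> \<pi>_id[OF \<gamma> cp[OF \<gamma>]] by simp
  qed
  have ds: "direct_sum_of_parts \<Gamma> M"
    unfolding direct_sum_of_parts_def using ex un by blast
  then show gg: "graded_group \<Gamma> M"
    using part M by (simp add: graded_group_def graded_group_axioms_def)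
  show "homog_comp \<Gamma> M x \<gamma> = \<pi> \<gamma> x" if "x \<in> carrier M" "\<gamma> \<in> carrier \<Gamma>" for x \<gamma>
    using graded_group.comp_eqI[OF gg that(1) ex[OF that(1)]] that(2) by simp
qed

lemma base_module_simps [simp]:
  "carrier (base_module A M) = carrier M" "\<zero>\<^bsub>base_module A M\<^esub> = \<zero>\<^bsub>M\<^esub>"
  "x \<oplus>\<^bsub>base_module A M\<^esub> y = x \<oplus>\<^bsub>M\<^esub> y"
  "r \<odot>\<^bsub>base_module A M\<^esub> x = (r \<odot>\<^bsub>A\<^esub> \<one>\<^bsub>A\<^esub>) \<odot>\<^bsub>M\<^esub> x"
  by (simp_all add: base_module_def)

lemma abelian_group_cong:
  assumes "abelian_group V" "carrier W = carrier V" "\<zero>\<^bsub>W\<^esub> = \<zero>\<^bsub>V\<^esub>" "\<And>x y. x \<oplus>\<^bsub>W\<^esub> y = x \<oplus>\<^bsub>V\<^esub> y"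
  shows "abelian_group W"
proof -
  interpret V: abelian_group V by fact
  show ?thesis
  proof (rule abelian_groupI)
    fix x assume "x \<in> carrier W"
    then show "\<exists>y\<in>carrier W. y \<oplus>\<^bsub>W\<^esub> x = \<zero>\<^bsub>W\<^esub>"
      by (intro bexI[of _ "\<ominus>\<^bsub>V\<^esub> x"]) (auto simp: assms(2-4) V.l_neg)
  qed (auto simp: assms(2-4) V.a_ac)
qed

lemma module_base:
  assumes "unital_algebra R A" "left_module A M"
  shows "module R (base_module A M)"
proof -
  interpret A: unital_algebra R A by fact
  interpret M: left_module A M by fact
  show ?thesis
  proof (rule moduleI)
    show "cring R" by (rule A.R.is_cring)
    show "abelian_group (base_module A M)" by (rule abelian_group_cong[OF M.M.abelian_group_axioms]) simp_all
    show "(r \<otimes>\<^bsub>R\<^esub> s) \<odot>\<^bsub>base_module A M\<^esub> x = r \<odot>\<^bsub>base_module A M\<^esub> (s \<odot>\<^bsub>base_module A M\<^esub> x)"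
      if "r \<in> carrier R" "s \<in> carrier R" "x \<in> carrier (base_module A M)" for r s x
      using that by (simp add: M.smult_assoc[symmetric] A.smult_mult_left A.smult_assoc1)
  qed (auto simp: M.smult_closed M.smult_r_distr M.smult_l_distr A.smult_l_distr M.smult_one)
qed

lemma (in graded_algebra) unital: "unital_algebra R A" ..

lemma (in graded_algebra) graded_group_A: "graded_group \<Gamma> A"
proof (intro graded_group.intro graded_group_axioms.intro)
  show "abelian_group A" ..
  show "subgroup (part A \<gamma>) (add_monoid A)" if "\<gamma> \<in> carrier \<Gamma>" for \<gamma>
    using submodule.axioms(1)[OF part_submodule[OF that]] .
  show "direct_sum_of_parts \<Gamma> A" by (rule direct_sum)
qed

lemma (in graded_module) module_base_M: "module R (base_module A M)"
  by (rule module_base[OF alg.unital left_module_axioms])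

lemma (in graded_module) graded_group_M: "graded_group \<Gamma> M"
proof (intro graded_group.intro graded_group_axioms.intro)
  show "abelian_group M" ..
  show "subgroup (part M \<gamma>) (add_monoid M)" if "\<gamma> \<in> carrier \<Gamma>" for \<gamma>
    by (rule subgroup_add_cong[OF abelian_group_module[OF module_base_M] _ _ _ _
          submodule.axioms(1)[OF part_submodule[OF that]]])
      (simp_all add: M.abelian_group_axioms)
  show "direct_sum_of_parts \<Gamma> M" by (rule direct_sum)
qed

text \<open>
  The parts are automatically \<open>R\<close>-submodules: \<open>R\<close> acts through \<open>r 1\<^sub>A\<close>, which has the neutral degree.
\<close>

lemma graded_moduleI:
  assumes "graded_algebra R \<Gamma> A" "left_module A M" "graded_group \<Gamma> M"
    "\<And>\<alpha> \<beta> a x. \<lbrakk>\<alpha> \<in> carrier \<Gamma>; \<beta> \<in> carrier \<Gamma>; a \<in> part A \<alpha>; x \<in> part M \<beta>\<rbrakk> \<Longrightarrow>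
       a \<odot>\<^bsub>M\<^esub> x \<in> part M (\<alpha> \<otimes>\<^bsub>\<Gamma>\<^esub> \<beta>)"
  shows "graded_module R \<Gamma> A M"
proof (intro graded_module.intro graded_module_axioms.intro)
  interpret alg: graded_algebra R \<Gamma> A by fact
  interpret M: left_module A M by fact
  interpret G: graded_group \<Gamma> M by fact
  interpret B: module R "base_module A M" by (rule module_base[OF alg.unital assms(2)])
  interpret AG: graded_group \<Gamma> A by (rule alg.graded_group_A)
  show "submodule (part M \<gamma>) R (base_module A M)" if \<gamma>: "\<gamma> \<in> carrier \<Gamma>" for \<gamma>
  proof (intro submodule.intro submodule_axioms.intro)
    show "subgroup (part M \<gamma>) (add_monoid (base_module A M))"
      by (rule subgroup_add_cong[OF M.M.abelian_group_axioms B.M.abelian_group_axioms _ _ _ G.part_subgroup[OF \<gamma>]]) simp_all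
    fix r x assume r: "r \<in> carrier R" and x: "x \<in> part M \<gamma>"
    have "r \<odot>\<^bsub>A\<^esub> \<one>\<^bsub>A\<^esub> \<in> part A \<one>\<^bsub>\<Gamma>\<^esub>"
      using submodule.smult_closed[OF alg.part_submodule r alg.one_part] by simp
    from assms(4)[OF _ \<gamma> this x] \<gamma> show "r \<odot>\<^bsub>base_module A M\<^esub> x \<in> part M \<gamma>" by simp
  qed
  show "direct_sum_of_parts \<Gamma> M" by (rule G.parts_direct)
qed (use assms in auto)

text \<open>
  Together with the converse below, this describes subobjects by closure conditions: an additive subgroup
  is one if and only if it is closed under scalars and under taking homogeneous components.
\<close>

lemma graded_submoduleI:
  assumes M: "graded_module R \<Gamma> A M" and sg: "subgroup T (add_monoid M)"
    and sm: "\<And>a x. a \<in> carrier A \<Longrightarrow> x \<in> T \<Longrightarrow> a \<odot>\<^bsub>M\<^esub> x \<in> T"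
    and hc: "\<And>x \<gamma>. x \<in> T \<Longrightarrow> \<gamma> \<in> carrier \<Gamma> \<Longrightarrow> homog_comp \<Gamma> M x \<gamma> \<in> T"
  shows "graded_submodule R \<Gamma> A T M"
  unfolding graded_submodule_def
proof
  interpret M: graded_module R \<Gamma> A M by fact
  interpret G: graded_group \<Gamma> M by (rule M.graded_group_M)
  note T = subgroup_addD[OF M.M.abelian_group_axioms sg]
  show "T \<subseteq> carrier M" by (rule T)
  have Tc: "x \<in> carrier M" if "x \<in> T" for x using T that by auto
  let ?T = "M\<lparr>carrier := T, part := (\<lambda>\<gamma>. T \<inter> part M \<gamma>)\<rparr>"
  have ab: "abelian_group ?T"
  proof (rule abelian_groupI)
    fix x assume "x \<in> carrier ?T"
    then show "\<exists>y\<in>carrier ?T. y \<oplus>\<^bsub>?T\<^esub> x = \<zero>\<^bsub>?T\<^esub>"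
      by (intro bexI[of _ "\<ominus>\<^bsub>M\<^esub> x"]) (auto simp: T M.M.l_neg Tc)
  qed (auto simp: T M.M.a_ac Tc)
  have inv: "\<ominus>\<^bsub>?T\<^esub> x = \<ominus>\<^bsub>M\<^esub> x" if "x \<in> T" for x
    by (rule abelian_group.minus_equality[OF ab]) (use that in \<open>auto simp: T M.M.l_neg Tc\<close>)
  show "graded_module R \<Gamma> A ?T"
  proof (rule graded_moduleI)
    show "graded_algebra R \<Gamma> A" ..
    show "left_module A ?T"
      by (intro left_module.intro left_module_axioms.intro ab)
        (auto simp: Tc sm M.smult_l_distr M.smult_r_distr M.smult_assoc M.smult_one M.alg.ring_axioms)
    show "graded_group \<Gamma> ?T"
    proof (rule projections_direct_sum(1)[OF ab, where \<pi> = "\<lambda>\<gamma> x. homog_comp \<Gamma> M x \<gamma>"])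
      fix \<gamma> assume \<gamma>: "\<gamma> \<in> carrier \<Gamma>"
      show "subgroup (part ?T \<gamma>) (add_monoid ?T)"
        by (rule subgroup_addI[OF ab])
          (use subgroup_addD[OF M.M.abelian_group_axioms G.part_subgroup[OF \<gamma>]] T in \<open>auto simp: inv\<close>)
      show "additive_map ?T ?T (\<lambda>x. homog_comp \<Gamma> M x \<gamma>)"
        by (rule additiveI) (use \<gamma> hc Tc in \<open>auto simp: G.comp_add\<close>)
      show "homog_comp \<Gamma> M x \<gamma> \<in> part ?T \<gamma>" if "x \<in> carrier ?T" for x
        using that \<gamma> hc Tc by (auto simp: G.comp_part)
      show "homog_comp \<Gamma> M x \<gamma> = x" if "x \<in> part ?T \<gamma>" for x
        using that \<gamma> by (auto simp: G.comp_same)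
      show "homog_comp \<Gamma> M x \<gamma> = \<zero>\<^bsub>?T\<^esub>" if "\<delta> \<in> carrier \<Gamma>" "\<delta> \<noteq> \<gamma>" "x \<in> part ?T \<delta>" for \<delta> x
        using that \<gamma> by (auto simp: G.comp_homogeneous)
    next
      fix H assume H: "subgroup H (add_monoid ?T)"
        and pH: "\<And>\<gamma>. \<gamma> \<in> carrier \<Gamma> \<Longrightarrow> part ?T \<gamma> \<subseteq> H"
      note HD = subgroup_addD[OF ab H]
      have "subgroup H (add_monoid M)"
        by (rule subgroup_addI[OF M.M.abelian_group_axioms]) (use HD Tc inv in \<open>auto, metis subsetD\<close>)
      then have "fsum M (homog_comp \<Gamma> M x) (carrier \<Gamma>) \<in> H" if "x \<in> T" for x
        using pH hc[OF that] G.comp_part[OF Tc[OF that]] by (intro M.M.fsum_in_subgroup) auto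
      then show "carrier ?T \<subseteq> H" using G.fsum_comp Tc by auto
    qed
    show "a \<odot>\<^bsub>?T\<^esub> x \<in> part ?T (\<alpha> \<otimes>\<^bsub>\<Gamma>\<^esub> \<beta>)"
      if "\<alpha> \<in> carrier \<Gamma>" "\<beta> \<in> carrier \<Gamma>" "a \<in> part A \<alpha>" "x \<in> part ?T \<beta>" for \<alpha> \<beta> a x
      using that sm[of a x] M.part_smult[of \<alpha> \<beta> a x]
        graded_group.part_carrier[OF M.alg.graded_group_A, of \<alpha> a] by simp
  qed
qed

lemma graded_submoduleD:
  assumes M: "graded_module R \<Gamma> A M" and T: "graded_submodule R \<Gamma> A T M"
  shows "subgroup T (add_monoid M)"
    and "\<And>a x. a \<in> carrier A \<Longrightarrow> x \<in> T \<Longrightarrow> a \<odot>\<^bsub>M\<^esub> x \<in> T"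
    and "\<And>x \<gamma>. x \<in> T \<Longrightarrow> \<gamma> \<in> carrier \<Gamma> \<Longrightarrow> homog_comp \<Gamma> M x \<gamma> \<in> T"
proof -
  interpret M: graded_module R \<Gamma> A M by fact
  interpret G: graded_group \<Gamma> M by (rule M.graded_group_M)
  let ?T = "M\<lparr>carrier := T, part := (\<lambda>\<gamma>. T \<inter> part M \<gamma>)\<rparr>"
  have sub: "T \<subseteq> carrier M" and gT: "graded_module R \<Gamma> A ?T" using T by (auto simp: graded_submodule_def)
  interpret T: graded_module R \<Gamma> A ?T by (rule gT)
  interpret TG: graded_group \<Gamma> ?T by (rule T.graded_group_M)
  have inv: "\<ominus>\<^bsub>M\<^esub> x = \<ominus>\<^bsub>?T\<^esub> x" if x: "x \<in> T" for x
  proof (rule M.M.minus_equality)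
    show "\<ominus>\<^bsub>?T\<^esub> x \<oplus>\<^bsub>M\<^esub> x = \<zero>\<^bsub>M\<^esub>" using T.M.l_neg[of x] x by simp
    show "\<ominus>\<^bsub>?T\<^esub> x \<in> carrier M" using T.M.a_inv_closed[of x] x sub by auto
  qed (use x sub in auto)
  show sg: "subgroup T (add_monoid M)"
    by (rule subgroup_addI[OF M.M.abelian_group_axioms])
      (use sub T.M.zero_closed T.M.a_closed T.M.a_inv_closed in \<open>auto simp: inv\<close>)
  show "a \<odot>\<^bsub>M\<^esub> x \<in> T" if "a \<in> carrier A" "x \<in> T" for a x
    using T.smult_closed[of a x] that by simp
  show "homog_comp \<Gamma> M x \<gamma> \<in> T" if x: "x \<in> T" and \<gamma>: "\<gamma> \<in> carrier \<Gamma>" for x \<gamma>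
  proof -
    have a: "additive_map ?T M (\<lambda>x. x)" using sub by (auto simp: additive_map_def)
    have "homog_comp \<Gamma> M x \<gamma> = homog_comp \<Gamma> ?T x \<gamma>"
      using graded_map_comp[OF TG.graded_group_axioms G.graded_group_axioms a _ _ \<gamma>, of x] x by auto
    then show ?thesis using TG.comp_closed[of x \<gamma>] x \<gamma> by simp
  qed
qed

section \<open>The twisted action on a tensor product\<close>

lemma additive_map_cong_source:
  assumes "carrier V = carrier W" "\<And>x y. x \<oplus>\<^bsub>V\<^esub> y = x \<oplus>\<^bsub>W\<^esub> y"
  shows "additive_map V Y f = additive_map W Y f"
  by (simp add: additive_map_def assms)

lemma additive_map_cong_target:
  assumes "carrier V = carrier W" "\<And>x y. x \<oplus>\<^bsub>V\<^esub> y = x \<oplus>\<^bsub>W\<^esub> y"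
  shows "additive_map Y V f = additive_map Y W f"
  by (simp add: additive_map_def assms)

text \<open>
  The data for letting \<open>A \<ltimes> B\<close> act on \<open>M \<otimes> N\<close>, with the actions of \<open>A\<close> on \<open>M\<close> and of \<open>B\<close> on \<open>N\<close> given as
  functions. In this form it covers the modules \<open>M \<ltimes> N\<close> as well as the regular case \<open>M = A\<close>, \<open>N = B\<close>,
  in which it is the multiplication of \<open>A \<ltimes> B\<close>. The \<open>R\<close>-modules \<open>M\<^sub>R\<close> and \<open>N\<^sub>R\<close> are separate parameters
  because in the regular case the records themselves carry the \<open>R\<close>-action, while for modules it is derived
  from the action of \<open>A\<close> and \<open>B\<close>.
\<close>

locale smash_action = alg: graded_algebra R \<Gamma> A + act: monoid_algebra_action R \<Gamma> B +
  grp: graded_group \<Gamma> M + MN: tensor_pair R M\<^sub>R N\<^sub>R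
  for R :: "('r, 'u1) ring_scheme" and \<Gamma> :: "('g, 'u2) monoid_scheme"
    and A :: "('r, 'a, 'g, 'u3) graded_scheme" and B :: "('r, 'b, 'g, 'u4) acted_scheme"
    and M :: "('s, 'm, 'g, 'u5) graded_scheme" and M\<^sub>R :: "('r, 'm, 'u6) module_scheme"
    and N\<^sub>R :: "('r, 'n, 'u7) module_scheme" +
  fixes lact :: "'a \<Rightarrow> 'm \<Rightarrow> 'm" and ract :: "'b \<Rightarrow> 'n \<Rightarrow> 'n"
  assumes base: "carrier M\<^sub>R = carrier M" "\<zero>\<^bsub>M\<^sub>R\<^esub> = \<zero>\<^bsub>M\<^esub>" "\<And>x y. x \<oplus>\<^bsub>M\<^sub>R\<^esub> y = x \<oplus>\<^bsub>M\<^esub> y"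
    and lact_closed: "a \<in> carrier A \<Longrightarrow> m \<in> carrier M \<Longrightarrow> lact a m \<in> carrier M"
    and lact_add_left: "\<lbrakk>a \<in> carrier A; a' \<in> carrier A; m \<in> carrier M\<rbrakk> \<Longrightarrow>
        lact (a \<oplus>\<^bsub>A\<^esub> a') m = lact a m \<oplus>\<^bsub>M\<^esub> lact a' m"
    and lact_add_right: "\<lbrakk>a \<in> carrier A; m \<in> carrier M; m' \<in> carrier M\<rbrakk> \<Longrightarrow>
        lact a (m \<oplus>\<^bsub>M\<^esub> m') = lact a m \<oplus>\<^bsub>M\<^esub> lact a m'"
    and lact_smult_left: "\<lbrakk>r \<in> carrier R; a \<in> carrier A; m \<in> carrier M\<rbrakk> \<Longrightarrow>
        lact (r \<odot>\<^bsub>A\<^esub> a) m = r \<odot>\<^bsub>M\<^sub>R\<^esub> lact a m"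
    and lact_smult_right: "\<lbrakk>r \<in> carrier R; a \<in> carrier A; m \<in> carrier M\<rbrakk> \<Longrightarrow>
        lact a (r \<odot>\<^bsub>M\<^sub>R\<^esub> m) = r \<odot>\<^bsub>M\<^sub>R\<^esub> lact a m"
    and lact_assoc: "\<lbrakk>a \<in> carrier A; a' \<in> carrier A; m \<in> carrier M\<rbrakk> \<Longrightarrow>
        lact (a \<otimes>\<^bsub>A\<^esub> a') m = lact a (lact a' m)"
    and lact_one: "m \<in> carrier M \<Longrightarrow> lact \<one>\<^bsub>A\<^esub> m = m"
    and lact_part: "\<lbrakk>\<alpha> \<in> carrier \<Gamma>; \<beta> \<in> carrier \<Gamma>; a \<in> part A \<alpha>; m \<in> part M \<beta>\<rbrakk> \<Longrightarrow>
        lact a m \<in> part M (\<alpha> \<otimes>\<^bsub>\<Gamma>\<^esub> \<beta>)"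
    and ract_closed: "b \<in> carrier B \<Longrightarrow> x \<in> carrier N\<^sub>R \<Longrightarrow> ract b x \<in> carrier N\<^sub>R"
    and ract_add_left: "\<lbrakk>b \<in> carrier B; b' \<in> carrier B; x \<in> carrier N\<^sub>R\<rbrakk> \<Longrightarrow>
        ract (b \<oplus>\<^bsub>B\<^esub> b') x = ract b x \<oplus>\<^bsub>N\<^sub>R\<^esub> ract b' x"
    and ract_add_right: "\<lbrakk>b \<in> carrier B; x \<in> carrier N\<^sub>R; x' \<in> carrier N\<^sub>R\<rbrakk> \<Longrightarrow>
        ract b (x \<oplus>\<^bsub>N\<^sub>R\<^esub> x') = ract b x \<oplus>\<^bsub>N\<^sub>R\<^esub> ract b x'"
    and ract_smult_left: "\<lbrakk>r \<in> carrier R; b \<in> carrier B; x \<in> carrier N\<^sub>R\<rbrakk> \<Longrightarrow>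
        ract (r \<odot>\<^bsub>B\<^esub> b) x = r \<odot>\<^bsub>N\<^sub>R\<^esub> ract b x"
    and ract_smult_right: "\<lbrakk>r \<in> carrier R; b \<in> carrier B; x \<in> carrier N\<^sub>R\<rbrakk> \<Longrightarrow>
        ract b (r \<odot>\<^bsub>N\<^sub>R\<^esub> x) = r \<odot>\<^bsub>N\<^sub>R\<^esub> ract b x"
    and ract_assoc: "\<lbrakk>b \<in> carrier B; b' \<in> carrier B; x \<in> carrier N\<^sub>R\<rbrakk> \<Longrightarrow>
        ract (b \<otimes>\<^bsub>B\<^esub> b') x = ract b (ract b' x)"
    and ract_one: "x \<in> carrier N\<^sub>R \<Longrightarrow> ract \<one>\<^bsub>B\<^esub> x = x"
begin

lemma module_A: "module R A" and module_B: "module R B"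
  by unfold_locales

sublocale AB: tensor_pair R A B
  by (rule tensor_pairI[OF module_A module_B])

abbreviation T where "T \<equiv> tensor R M\<^sub>R N\<^sub>R"
abbreviation pt where "pt \<equiv> pure_tensor R M\<^sub>R N\<^sub>R"

lemma additive_base: "additive_map M\<^sub>R Y f = additive_map M Y f"
  by (rule additive_map_cong_source) (simp_all add: base)

lemma lact_smult_one: "r \<in> carrier R \<Longrightarrow> m \<in> carrier M \<Longrightarrow> r \<odot>\<^bsub>M\<^sub>R\<^esub> m = lact (r \<odot>\<^bsub>A\<^esub> \<one>\<^bsub>A\<^esub>) m"
  by (simp add: lact_smult_left lact_one)

lemma one_B: "\<one>\<^bsub>B\<^esub> \<in> carrier B" and one_\<Gamma>: "\<one>\<^bsub>\<Gamma>\<^esub> \<in> carrier \<Gamma>"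
  by auto

lemma part_smult_base:
  assumes "\<gamma> \<in> carrier \<Gamma>" "r \<in> carrier R" "m \<in> part M \<gamma>"
  shows "r \<odot>\<^bsub>M\<^sub>R\<^esub> m \<in> part M \<gamma>"
proof -
  have "r \<odot>\<^bsub>A\<^esub> \<one>\<^bsub>A\<^esub> \<in> part A \<one>\<^bsub>\<Gamma>\<^esub>"
    using submodule.smult_closed[OF alg.part_submodule assms(2) alg.one_part] by simp
  from lact_part[OF one_\<Gamma> assms(1) this assms(3)] show ?thesis
    using assms grp.part_carrier by (simp add: lact_smult_one)
qed

lemma act_closed: "\<gamma> \<in> carrier \<Gamma> \<Longrightarrow> b \<in> carrier B \<Longrightarrow> act B b \<gamma> \<in> carrier B"
  by (rule ring_hom_closed[OF act.act_hom])

lemma act_add: "\<lbrakk>\<gamma> \<in> carrier \<Gamma>; b \<in> carrier B; b' \<in> carrier B\<rbrakk> \<Longrightarrow>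
    act B (b \<oplus>\<^bsub>B\<^esub> b') \<gamma> = act B b \<gamma> \<oplus>\<^bsub>B\<^esub> act B b' \<gamma>"
  by (rule ring_hom_add[OF act.act_hom])

lemma act_times: "\<lbrakk>\<gamma> \<in> carrier \<Gamma>; b \<in> carrier B; b' \<in> carrier B\<rbrakk> \<Longrightarrow>
    act B (b \<otimes>\<^bsub>B\<^esub> b') \<gamma> = act B b \<gamma> \<otimes>\<^bsub>B\<^esub> act B b' \<gamma>"
  by (rule ring_hom_mult[OF act.act_hom])

lemma act_unit: "\<gamma> \<in> carrier \<Gamma> \<Longrightarrow> act B \<one>\<^bsub>B\<^esub> \<gamma> = \<one>\<^bsub>B\<^esub>"
  by (rule ring_hom_one[OF act.act_hom])

text \<open>
  The action of \<open>a \<otimes> b\<close> on \<open>m \<otimes> x\<close>: each component of \<open>m\<close> twists \<open>b\<close> by its degree. It is extended to all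
  tensors in two steps, first in \<open>m \<otimes> x\<close> and then in \<open>a \<otimes> b\<close>; each step needs a balanced map.
\<close>

definition inner :: "'a \<Rightarrow> 'b \<Rightarrow> 'm \<Rightarrow> 'n \<Rightarrow> ('m, 'n) tensor"
  where "inner a b m x = (\<Oplus>\<^bsub>T\<^esub>\<gamma>\<in>degrees \<Gamma> M m. pt (lact a (homog_comp \<Gamma> M m \<gamma>)) (ract (act B b \<gamma>) x))"

definition op :: "('a, 'b) tensor \<Rightarrow> ('m, 'n) tensor \<Rightarrow> ('m, 'n) tensor"
  where "op s t = tensor_lift T (\<lambda>(a, b). tensor_lift T (case_prod (inner a b)) t) s"

lemma pt_additive_left: "n \<in> carrier N\<^sub>R \<Longrightarrow> additive_map M T (\<lambda>m. pt m n)"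
  using MN.pt_balanced by (auto simp: balanced_def additive_base)

lemma pt_additive_right: "m \<in> carrier M \<Longrightarrow> additive_map N\<^sub>R T (pt m)"
  using MN.pt_balanced by (auto simp: balanced_def base)

text \<open>
  The main tool for identities: tensors \<open>m \<otimes> n\<close> with homogeneous \<open>m\<close> generate, and on them the action has
  no sum over degrees.
\<close>

lemma homogeneous_tensor_ext:
  assumes "abelian_group Y" "additive_map T Y f" "additive_map T Y g"
    "\<And>\<gamma> m n. \<gamma> \<in> carrier \<Gamma> \<Longrightarrow> m \<in> part M \<gamma> \<Longrightarrow> n \<in> carrier N\<^sub>R \<Longrightarrow> f (pt m n) = g (pt m n)"
    "t \<in> carrier T"
  shows "f t = g t"
proof (rule MN.tensor_hom_ext[OF assms(1-3) _ assms(5)])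
  fix m n assume m: "m \<in> carrier M\<^sub>R" and n: "n \<in> carrier N\<^sub>R"
  show "f (pt m n) = g (pt m n)"
    by (rule grp.homogeneous_ext[OF assms(1) additive_comp[OF pt_additive_left[OF n] assms(2)]
          additive_comp[OF pt_additive_left[OF n] assms(3)]])
      (use assms(4) m n base in auto)
qed

context
  fixes a b assumes a: "a \<in> carrier A" and b: "b \<in> carrier B"
begin

lemma summand_additive:
  assumes "n \<in> carrier N\<^sub>R" "\<gamma> \<in> carrier \<Gamma>"
  shows "additive_map M T (\<lambda>m. pt (lact a m) (ract (act B b \<gamma>) n))"
proof -
  have "additive_map M M (lact a)" by (rule additiveI) (use a in \<open>auto simp: lact_closed lact_add_right\<close>)
  moreover have "ract (act B b \<gamma>) n \<in> carrier N\<^sub>R" using assms b by (simp add: ract_closed act_closed)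
  ultimately show ?thesis by (rule additive_comp[OF _ pt_additive_left])
qed

lemma inner_homogeneous:
  assumes "\<gamma> \<in> carrier \<Gamma>" "m \<in> part M \<gamma>" "n \<in> carrier N\<^sub>R"
  shows "inner a b m n = pt (lact a m) (ract (act B b \<gamma>) n)"
  unfolding inner_def
  by (rule grp.degreewise_homogeneous[OF MN.abelian_group_T summand_additive[OF assms(3)] assms(1,2)])

lemma inner_additive_left: "n \<in> carrier N\<^sub>R \<Longrightarrow> additive_map M T (\<lambda>m. inner a b m n)"
  unfolding inner_def by (rule grp.degreewise_additive[OF MN.abelian_group_T summand_additive])

lemma inner_additive_right: "m \<in> carrier M \<Longrightarrow> additive_map N\<^sub>R T (inner a b m)"
  unfolding inner_def
proof (rule additive_finsum_fun[OF MN.abelian_group_T])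
  assume m: "m \<in> carrier M"
  show "finite (degrees \<Gamma> M m)" unfolding degrees_def by (rule grp.comp_finite[OF m])
  fix \<gamma> assume "\<gamma> \<in> degrees \<Gamma> M m"
  then have g: "\<gamma> \<in> carrier \<Gamma>" by (simp add: degrees_def)
  have "additive_map N\<^sub>R N\<^sub>R (ract (act B b \<gamma>))"
    by (rule additiveI) (use g b in \<open>auto simp: ract_closed ract_add_right act_closed\<close>)
  then show "additive_map N\<^sub>R T (\<lambda>x. pt (lact a (homog_comp \<Gamma> M m \<gamma>)) (ract (act B b \<gamma>) x))"
    by (rule additive_comp[OF _ pt_additive_right]) (use a m g in \<open>auto simp: lact_closed grp.comp_closed\<close>)
qed

lemma inner_balanced: "balanced R M\<^sub>R N\<^sub>R T (inner a b)"
proof (rule balancedI)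
  show "additive_map M\<^sub>R T (\<lambda>m. inner a b m n)" if "n \<in> carrier N\<^sub>R" for n
    using inner_additive_left[OF that] by (simp add: additive_base)
  show "additive_map N\<^sub>R T (inner a b m)" if "m \<in> carrier M\<^sub>R" for m
    using inner_additive_right that base by simp
  fix r m n assume r: "r \<in> carrier R" and m: "m \<in> carrier M\<^sub>R" and n: "n \<in> carrier N\<^sub>R"
  have sm: "additive_map M M (\<lambda>m. r \<odot>\<^bsub>M\<^sub>R\<^esub> m)"
    by (rule additiveI) (use r MN.M.smult_closed MN.M.smult_r_distr base in auto)
  show "inner a b (r \<odot>\<^bsub>M\<^sub>R\<^esub> m) n = inner a b m (r \<odot>\<^bsub>N\<^sub>R\<^esub> n)"
  proof (rule grp.homogeneous_ext[OF MN.abelian_group_T])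
    show "additive_map M T (\<lambda>m. inner a b (r \<odot>\<^bsub>M\<^sub>R\<^esub> m) n)"
      by (rule additive_comp[OF sm inner_additive_left[OF n]])
    show "additive_map M T (\<lambda>m. inner a b m (r \<odot>\<^bsub>N\<^sub>R\<^esub> n))"
      using r n by (intro inner_additive_left) simp
    show "m \<in> carrier M" using m base by simp
    fix \<gamma> m assume g: "\<gamma> \<in> carrier \<Gamma>" and m: "m \<in> part M \<gamma>"
    have mc: "m \<in> carrier M" by (rule grp.part_carrier[OF g m])
    show "inner a b (r \<odot>\<^bsub>M\<^sub>R\<^esub> m) n = inner a b m (r \<odot>\<^bsub>N\<^sub>R\<^esub> n)"
      using g m r n a b mc
      by (simp add: inner_homogeneous part_smult_base lact_smult_right ract_smult_right act_closed
          MN.pt_smult lact_closed ract_closed base)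
  qed
qed

lemma inner_lift_additive: "additive_map T T (tensor_lift T (case_prod (inner a b)))"
  by (rule MN.tensor_lift_additive[OF MN.abelian_group_T inner_balanced])

lemma inner_lift_homogeneous:
  assumes "\<gamma> \<in> carrier \<Gamma>" "m \<in> part M \<gamma>" "n \<in> carrier N\<^sub>R"
  shows "tensor_lift T (case_prod (inner a b)) (pt m n) = pt (lact a m) (ract (act B b \<gamma>) n)"
  using MN.tensor_lift_pure[OF MN.abelian_group_T inner_balanced, of m n] assms grp.part_carrier
  by (simp add: base inner_homogeneous)

end

lemma outer_balanced:
  assumes t: "t \<in> carrier T"
  shows "balanced R A B T (\<lambda>a b. tensor_lift T (case_prod (inner a b)) t)"
proof -
  note ext = homogeneous_tensor_ext[OF MN.abelian_group_T _ _ _ t]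
  note il = inner_lift_additive
  note cl = additive_closed[OF il t]
  note simps = inner_lift_homogeneous lact_closed ract_closed act_closed grp.part_carrier base
  show ?thesis
  proof (intro balancedI additiveI)
    fix a b assume ab: "a \<in> carrier A" "b \<in> carrier B"
    then show "tensor_lift T (case_prod (inner a b)) t \<in> carrier T"
      and "tensor_lift T (case_prod (inner a b)) t \<in> carrier T" by (auto intro: cl)
  next
    fix a a' b assume ab: "a \<in> carrier A" "a' \<in> carrier A" "b \<in> carrier B"
    then show "tensor_lift T (case_prod (inner (a \<oplus>\<^bsub>A\<^esub> a') b)) t =
        tensor_lift T (case_prod (inner a b)) t \<oplus>\<^bsub>T\<^esub> tensor_lift T (case_prod (inner a' b)) t"
      by (intro ext[OF il additive_map_plus[OF MN.abelian_group_T il il]])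
        (auto simp: simps lact_add_left MN.pt_add_left[unfolded base])
  next
    fix a b b' assume ab: "a \<in> carrier A" "b \<in> carrier B" "b' \<in> carrier B"
    then show "tensor_lift T (case_prod (inner a (b \<oplus>\<^bsub>B\<^esub> b'))) t =
        tensor_lift T (case_prod (inner a b)) t \<oplus>\<^bsub>T\<^esub> tensor_lift T (case_prod (inner a b')) t"
      by (intro ext[OF il additive_map_plus[OF MN.abelian_group_T il il]])
        (auto simp: simps act_add ract_add_left MN.pt_add_right)
  next
    fix r a b assume ab: "r \<in> carrier R" "a \<in> carrier A" "b \<in> carrier B"
    then show "tensor_lift T (case_prod (inner (r \<odot>\<^bsub>A\<^esub> a) b)) t = tensor_lift T (case_prod (inner a (r \<odot>\<^bsub>B\<^esub> b))) t"
      by (intro ext[OF il il])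
        (auto simp: simps act.act_smult lact_smult_left ract_smult_left MN.pt_smult)
  qed
qed

lemma op_additive_left: "t \<in> carrier T \<Longrightarrow> additive_map AB.T T (\<lambda>s. op s t)"
  unfolding op_def by (rule AB.tensor_lift_additive[OF MN.abelian_group_T outer_balanced])

lemma op_pure_left:
  "\<lbrakk>a \<in> carrier A; b \<in> carrier B; t \<in> carrier T\<rbrakk> \<Longrightarrow> op (AB.pt a b) t = tensor_lift T (case_prod (inner a b)) t"
  unfolding op_def by (rule AB.tensor_lift_pure[OF MN.abelian_group_T outer_balanced])

lemma op_closed: "s \<in> carrier AB.T \<Longrightarrow> t \<in> carrier T \<Longrightarrow> op s t \<in> carrier T"
  using additive_closed[OF op_additive_left] .

lemma op_additive_right:
  assumes s: "s \<in> carrier AB.T" shows "additive_map T T (op s)"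
proof (rule additiveI)
  show "op s t \<in> carrier T" if "t \<in> carrier T" for t using op_closed s that .
  fix t u assume tu: "t \<in> carrier T" "u \<in> carrier T"
  show "op s (t \<oplus>\<^bsub>T\<^esub> u) = op s t \<oplus>\<^bsub>T\<^esub> op s u"
    by (rule AB.tensor_hom_ext[OF MN.abelian_group_T op_additive_left
          additive_map_plus[OF MN.abelian_group_T op_additive_left op_additive_left] _ s])
      (use tu in \<open>auto simp: op_pure_left additive_add[OF inner_lift_additive]\<close>)
qed

lemma op_pure:
  assumes "a \<in> carrier A" "b \<in> carrier B" "\<gamma> \<in> carrier \<Gamma>" "m \<in> part M \<gamma>" "n \<in> carrier N\<^sub>R"
  shows "op (AB.pt a b) (pt m n) = pt (lact a m) (ract (act B b \<gamma>) n)"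
  using assms grp.part_carrier by (simp add: op_pure_left MN.pt_closed base inner_lift_homogeneous)

text \<open>
  As \<open>1\<^sub>B\<close> is fixed by \<open>\<Gamma>\<close>, the element \<open>a \<otimes> 1\<close> acts on the first factor only, also if \<open>m\<close> is not
  homogeneous.
\<close>

lemma op_one_pure:
  assumes "a \<in> carrier A" "m \<in> carrier M" "n \<in> carrier N\<^sub>R"
  shows "op (AB.pt a \<one>\<^bsub>B\<^esub>) (pt m n) = pt (lact a m) n"
proof (rule grp.homogeneous_ext[OF MN.abelian_group_T _ _ _ assms(2)])
  have s: "AB.pt a \<one>\<^bsub>B\<^esub> \<in> carrier AB.T" using assms by (simp add: AB.pt_closed)
  show "additive_map M T (\<lambda>m. op (AB.pt a \<one>\<^bsub>B\<^esub>) (pt m n))"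
    by (rule additive_comp[OF pt_additive_left[OF assms(3)] op_additive_right[OF s]])
  show "additive_map M T (\<lambda>m. pt (lact a m) n)"
    by (rule additiveI) (use assms in \<open>auto simp: lact_closed lact_add_right MN.pt_closed base MN.pt_add_left[unfolded base]\<close>)
  fix \<gamma> x assume "\<gamma> \<in> carrier \<Gamma>" "x \<in> part M \<gamma>"
  then show "op (AB.pt a \<one>\<^bsub>B\<^esub>) (pt x n) = pt (lact a x) n"
    using assms by (simp add: op_pure act_unit ract_one)
qed

lemma op_unit: "t \<in> carrier T \<Longrightarrow> op (AB.pt \<one>\<^bsub>A\<^esub> \<one>\<^bsub>B\<^esub>) t = t"
  by (rule MN.tensor_hom_ext[OF MN.abelian_group_T op_additive_right additive_id])
    (auto simp: AB.pt_closed op_one_pure base lact_one)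

definition proj :: "'g \<Rightarrow> ('m, 'n) tensor \<Rightarrow> ('m, 'n) tensor"
  where "proj \<gamma> = tensor_map R M\<^sub>R N\<^sub>R (\<lambda>m. homog_comp \<Gamma> M m \<gamma>)"

definition deg_part :: "'g \<Rightarrow> ('m, 'n) tensor set"
  where "deg_part \<gamma> = generate (add_monoid T) {pt m x | m x. m \<in> part M \<gamma> \<and> x \<in> carrier N\<^sub>R}"

lemma comp_linear:
  assumes \<gamma>: "\<gamma> \<in> carrier \<Gamma>"
  shows "linear_map R M\<^sub>R M\<^sub>R (\<lambda>m. homog_comp \<Gamma> M m \<gamma>)"
proof (rule linear_mapI)
  show "additive_map M\<^sub>R M\<^sub>R (\<lambda>m. homog_comp \<Gamma> M m \<gamma>)"
    using grp.comp_additive[OF \<gamma>] base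
      additive_map_cong_target[of M\<^sub>R M M "\<lambda>m. homog_comp \<Gamma> M m \<gamma>"] by (simp add: additive_base)
  fix r m assume r: "r \<in> carrier R" and m: "m \<in> carrier M\<^sub>R"
  have sm: "additive_map M M (\<lambda>m. r \<odot>\<^bsub>M\<^sub>R\<^esub> m)"
    by (rule additiveI) (use r MN.M.smult_closed MN.M.smult_r_distr base in auto)
  show "homog_comp \<Gamma> M (r \<odot>\<^bsub>M\<^sub>R\<^esub> m) \<gamma> = r \<odot>\<^bsub>M\<^sub>R\<^esub> homog_comp \<Gamma> M m \<gamma>"
    by (rule graded_map_comp[OF grp.graded_group_axioms grp.graded_group_axioms sm _ _ \<gamma>])
      (use r m base part_smult_base in auto)
qed

lemma proj_additive: "\<gamma> \<in> carrier \<Gamma> \<Longrightarrow> additive_map T T (proj \<gamma>)"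
  unfolding proj_def by (rule tensor_map_additive[OF MN.M.module_axioms MN.M.module_axioms MN.N.module_axioms comp_linear])

lemma proj_pure: "\<lbrakk>\<gamma> \<in> carrier \<Gamma>; m \<in> carrier M; n \<in> carrier N\<^sub>R\<rbrakk> \<Longrightarrow> proj \<gamma> (pt m n) = pt (homog_comp \<Gamma> M m \<gamma>) n"
  unfolding proj_def
  using tensor_map_pure[OF MN.M.module_axioms MN.M.module_axioms MN.N.module_axioms comp_linear] base by simp

lemma deg_generators: "\<gamma> \<in> carrier \<Gamma> \<Longrightarrow> {pt m x | m x. m \<in> part M \<gamma> \<and> x \<in> carrier N\<^sub>R} \<subseteq> carrier T"
  by (auto simp: MN.pt_closed base grp.part_carrier)

lemma deg_part_subgroup: "\<gamma> \<in> carrier \<Gamma> \<Longrightarrow> subgroup (deg_part \<gamma>) (add_monoid T)"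
  unfolding deg_part_def by (rule subgroup_generate_add[OF MN.abelian_group_T deg_generators])

lemma deg_part_carrier: "\<gamma> \<in> carrier \<Gamma> \<Longrightarrow> deg_part \<gamma> \<subseteq> carrier T"
  by (rule subgroup_addD(1)[OF MN.abelian_group_T deg_part_subgroup])

lemma pt_deg_part: "m \<in> part M \<gamma> \<Longrightarrow> n \<in> carrier N\<^sub>R \<Longrightarrow> pt m n \<in> deg_part \<gamma>"
  unfolding deg_part_def by (rule generate.incl) auto

lemma pt_zero_left: "n \<in> carrier N\<^sub>R \<Longrightarrow> pt \<zero>\<^bsub>M\<^esub> n = \<zero>\<^bsub>T\<^esub>"
  by (rule additive_zero[OF grp.abelian_group_axioms MN.abelian_group_T pt_additive_left])

lemma deg_part_subset:
  assumes "subgroup H (add_monoid T)" "\<And>m n. m \<in> part M \<gamma> \<Longrightarrow> n \<in> carrier N\<^sub>R \<Longrightarrow> pt m n \<in> H"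
  shows "deg_part \<gamma> \<subseteq> H"
  unfolding deg_part_def by (rule generate_add_subset[OF MN.abelian_group_T _ assms(1)]) (use assms(2) in auto)

lemma op_deg:
  assumes \<alpha>: "\<alpha> \<in> carrier \<Gamma>" and \<beta>: "\<beta> \<in> carrier \<Gamma>" and t: "t \<in> deg_part \<beta>"
    and s: "s \<in> generate (add_monoid AB.T) {AB.pt a b | a b. a \<in> part A \<alpha> \<and> b \<in> carrier B}"
  shows "op s t \<in> deg_part (\<alpha> \<otimes>\<^bsub>\<Gamma>\<^esub> \<beta>)"
proof -
  have \<alpha>\<beta>: "\<alpha> \<otimes>\<^bsub>\<Gamma>\<^esub> \<beta> \<in> carrier \<Gamma>" using \<alpha> \<beta> by simp
  have Ac: "a \<in> carrier A" if "a \<in> part A \<alpha>" for a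
    using graded_group.part_carrier[OF alg.graded_group_A \<alpha> that] .
  have tc: "t \<in> carrier T" using t deg_part_carrier[OF \<beta>] by auto
  have 1: "op (AB.pt a b) t \<in> deg_part (\<alpha> \<otimes>\<^bsub>\<Gamma>\<^esub> \<beta>)" if a: "a \<in> part A \<alpha>" and b: "b \<in> carrier B" for a b
  proof -
    have ab: "AB.pt a b \<in> carrier AB.T" using a b Ac by (simp add: AB.pt_closed)
    have "deg_part \<beta> \<subseteq> {t \<in> carrier T. op (AB.pt a b) t \<in> deg_part (\<alpha> \<otimes>\<^bsub>\<Gamma>\<^esub> \<beta>)}"
    proof (rule deg_part_subset)
      show "subgroup {t \<in> carrier T. op (AB.pt a b) t \<in> deg_part (\<alpha> \<otimes>\<^bsub>\<Gamma>\<^esub> \<beta>)} (add_monoid T)"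
        by (rule subgroup_vimage[OF MN.abelian_group_T MN.abelian_group_T op_additive_right[OF ab] deg_part_subgroup[OF \<alpha>\<beta>]])
      fix m n assume "m \<in> part M \<beta>" "n \<in> carrier N\<^sub>R"
      then show "pt m n \<in> {t \<in> carrier T. op (AB.pt a b) t \<in> deg_part (\<alpha> \<otimes>\<^bsub>\<Gamma>\<^esub> \<beta>)}"
        using a b Ac \<alpha> \<beta> grp.part_carrier[OF \<beta>]
        by (auto simp: MN.pt_closed base op_pure intro!: pt_deg_part lact_part ract_closed act_closed)
    qed
    then show ?thesis using t by auto
  qed
  have "generate (add_monoid AB.T) {AB.pt a b | a b. a \<in> part A \<alpha> \<and> b \<in> carrier B} \<subseteq>
      {s \<in> carrier AB.T. op s t \<in> deg_part (\<alpha> \<otimes>\<^bsub>\<Gamma>\<^esub> \<beta>)}"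
    by (rule generate_add_subset[OF AB.abelian_group_T _
          subgroup_vimage[OF AB.abelian_group_T MN.abelian_group_T op_additive_left[OF tc] deg_part_subgroup[OF \<alpha>\<beta>]]])
      (auto simp: 1 AB.pt_closed Ac)
  then show ?thesis using s by auto
qed

text \<open>
  Stated for any record over \<open>M \<otimes> N\<close>, so that it applies to the algebra and to the modules.
\<close>

lemma graded_group_tensor:
  fixes G :: "('t, ('m, 'n) tensor, 'g, 'w) graded_scheme"
  assumes G: "carrier G = carrier T" "\<zero>\<^bsub>G\<^esub> = \<zero>\<^bsub>T\<^esub>" "\<And>x y. x \<oplus>\<^bsub>G\<^esub> y = x \<oplus>\<^bsub>T\<^esub> y"
    and part: "\<And>\<gamma>. \<gamma> \<in> carrier \<Gamma> \<Longrightarrow> part G \<gamma> = deg_part \<gamma>"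
  shows "graded_group \<Gamma> G"
    and "\<And>x \<gamma>. x \<in> carrier T \<Longrightarrow> \<gamma> \<in> carrier \<Gamma> \<Longrightarrow> homog_comp \<Gamma> G x \<gamma> = proj \<gamma> x"
proof -
  have ab: "abelian_group G" by (rule abelian_group_cong[OF MN.abelian_group_T G])
  have sub: "subgroup (part G \<gamma>) (add_monoid G)" if "\<gamma> \<in> carrier \<Gamma>" for \<gamma>
    using subgroup_add_cong[OF MN.abelian_group_T ab _ _ _ deg_part_subgroup[OF that]] G part[OF that] by simp
  have ad: "additive_map G G (proj \<gamma>)" if "\<gamma> \<in> carrier \<Gamma>" for \<gamma>
    using proj_additive[OF that] by (simp add: additive_map_def G)
  have pp: "proj \<gamma> x \<in> part G \<gamma>" if g: "\<gamma> \<in> carrier \<Gamma>" and x: "x \<in> carrier G" for \<gamma> x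
  proof -
    have "{x \<in> carrier T. proj \<gamma> x \<in> deg_part \<gamma>} = carrier T"
      by (rule MN.tensor_subgroup_eqI[OF subgroup_vimage[OF MN.abelian_group_T MN.abelian_group_T
              proj_additive[OF g] deg_part_subgroup[OF g]]])
        (use g in \<open>auto simp: MN.pt_closed base proj_pure grp.comp_part intro!: pt_deg_part\<close>)
    then show ?thesis using x g part G by auto
  qed
  have dp: "proj \<gamma> x = (if \<gamma> = \<delta> then x else \<zero>\<^bsub>T\<^esub>)"
    if g: "\<gamma> \<in> carrier \<Gamma>" and d: "\<delta> \<in> carrier \<Gamma>" and x: "x \<in> deg_part \<delta>" for \<gamma> \<delta> x
  proof (rule additive_eq_on_generate[OF MN.abelian_group_T MN.abelian_group_T proj_additive[OF g] _ deg_generators[OF d]])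
    show "additive_map T T (\<lambda>x. if \<gamma> = \<delta> then x else \<zero>\<^bsub>T\<^esub>)"
      by (cases "\<gamma> = \<delta>") (simp_all add: additive_id additive_const_zero[OF MN.abelian_group_T])
    show "x \<in> generate (add_monoid T) {pt m x |m x. m \<in> part M \<delta> \<and> x \<in> carrier N\<^sub>R}"
      using x by (simp add: deg_part_def)
    fix y assume "y \<in> {pt m x |m x. m \<in> part M \<delta> \<and> x \<in> carrier N\<^sub>R}"
    then show "proj \<gamma> y = (if \<gamma> = \<delta> then y else \<zero>\<^bsub>T\<^esub>)"
      using grp.comp_homogeneous[OF d _ g] grp.part_carrier[OF d] g by (auto simp: proj_pure pt_zero_left)
  qed
  note ds = projections_direct_sum[where \<pi> = proj and \<Gamma> = \<Gamma>, OF ab sub ad pp]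
  have gen: "carrier G \<subseteq> H" if H: "subgroup H (add_monoid G)"
    and pH: "\<And>\<gamma>. \<gamma> \<in> carrier \<Gamma> \<Longrightarrow> part G \<gamma> \<subseteq> H" for H
  proof -
    have H': "subgroup H (add_monoid T)"
      by (rule subgroup_add_cong[OF ab MN.abelian_group_T _ _ _ H]) (simp_all add: G)
    have "H = carrier T"
    proof (rule MN.tensor_subgroup_eqI[OF H'])
      fix m n assume m: "m \<in> carrier M\<^sub>R" and n: "n \<in> carrier N\<^sub>R"
      have "{m \<in> carrier M. pt m n \<in> H} = carrier M"
        by (rule grp.subgroup_of_parts[OF subgroup_vimage[OF grp.abelian_group_axioms MN.abelian_group_T
                pt_additive_left[OF n] H']])
          (use pH part n pt_deg_part grp.part_carrier in blast)
      then show "pt m n \<in> H" using m base by auto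
    qed
    then show ?thesis using G by simp
  qed
  show "graded_group \<Gamma> G" by (rule ds(1)) (use dp part G gen in auto)
  show "homog_comp \<Gamma> G x \<gamma> = proj \<gamma> x" if "x \<in> carrier T" "\<gamma> \<in> carrier \<Gamma>" for x \<gamma>
    by (rule ds(2)) (use dp part G gen that in auto)
qed

end

section \<open>The algebra \<open>A \<ltimes> B\<close> and its modules \<open>M \<ltimes> N\<close>\<close>

lemma smash_action_algebra:
  assumes "graded_algebra R \<Gamma> A" "monoid_algebra_action R \<Gamma> B"
  shows "smash_action R \<Gamma> A B A A B (\<lambda>a a'. a \<otimes>\<^bsub>A\<^esub> a') (\<lambda>b b'. b \<otimes>\<^bsub>B\<^esub> b')"
proof -
  interpret A: graded_algebra R \<Gamma> A by fact
  interpret B: monoid_algebra_action R \<Gamma> B by fact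
  have mA: "module R A" and mB: "module R B" by unfold_locales
  have rA: "ring A" and rB: "ring B" by unfold_locales
  show ?thesis
  proof (rule smash_action.intro[OF assms A.graded_group_A tensor_pairI[OF mA mB]], rule smash_action_axioms.intro)
  qed (simp_all add: A.part_mult A.smult_mult_left A.smult_mult_right B.smult_mult_left B.smult_mult_right
      ring.ring_simprules(5,11,12,13,23)[OF rA] ring.ring_simprules(5,11,12,13,23)[OF rB])
qed

lemma smash_action_module:
  assumes "monoid_algebra_action R \<Gamma> B" "left_module B N" "graded_module R \<Gamma> A M"
  shows "smash_action R \<Gamma> A B M (base_module A M) (base_module B N) (\<lambda>a m. a \<odot>\<^bsub>M\<^esub> m) (\<lambda>b x. b \<odot>\<^bsub>N\<^esub> x)"
proof -
  interpret M: graded_module R \<Gamma> A M by fact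
  interpret B: monoid_algebra_action R \<Gamma> B by fact
  interpret N: left_module B N by fact
  have gA: "graded_algebra R \<Gamma> A" ..
  have uB: "unital_algebra R B" ..
  have rA: "ring A" and rB: "ring B" by unfold_locales
  have mA: "module R A" and mB: "module R B" by unfold_locales
  have cA: "(r \<odot>\<^bsub>A\<^esub> \<one>\<^bsub>A\<^esub>) \<otimes>\<^bsub>A\<^esub> a = r \<odot>\<^bsub>A\<^esub> a" "a \<otimes>\<^bsub>A\<^esub> (r \<odot>\<^bsub>A\<^esub> \<one>\<^bsub>A\<^esub>) = r \<odot>\<^bsub>A\<^esub> a"
    if "r \<in> carrier R" "a \<in> carrier A" for r a
    using that by (simp_all add: M.alg.smult_mult_left M.alg.smult_mult_right
        ring.ring_simprules(6,12)[OF rA] monoid.r_one[OF ring.is_monoid[OF rA]])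
  have cB: "(r \<odot>\<^bsub>B\<^esub> \<one>\<^bsub>B\<^esub>) \<otimes>\<^bsub>B\<^esub> a = r \<odot>\<^bsub>B\<^esub> a" "a \<otimes>\<^bsub>B\<^esub> (r \<odot>\<^bsub>B\<^esub> \<one>\<^bsub>B\<^esub>) = r \<odot>\<^bsub>B\<^esub> a"
    if "r \<in> carrier R" "a \<in> carrier B" for r a
    using that by (simp_all add: B.smult_mult_left B.smult_mult_right
        ring.ring_simprules(6,12)[OF rB] monoid.r_one[OF ring.is_monoid[OF rB]])
  show ?thesis
  proof (rule smash_action.intro[OF gA assms(1) M.graded_group_M tensor_pairI[OF M.module_base_M
          module_base[OF uB N.left_module_axioms]]], rule smash_action_axioms.intro)
  qed (simp_all add: M.smult_closed M.smult_l_distr M.smult_r_distr M.smult_one M.part_smult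
        N.smult_closed N.smult_l_distr N.smult_r_distr N.smult_one
        M.smult_assoc[symmetric] N.smult_assoc[symmetric] cA cB ring.ring_simprules(6)[OF rA]
        ring.ring_simprules(6)[OF rB] module.smult_closed[OF mA] module.smult_closed[OF mB])
qed

text \<open>
  On homogeneous pure tensors associativity is \<open>(b\<^sup>\<beta> b')\<^sup>\<gamma> = b\<^sup>\<beta>\<^sup>\<gamma> b'\<^sup>\<gamma>\<close>, together with the fact that \<open>a' m\<close> has
  degree \<open>\<beta>\<gamma>\<close>. The three arguments are then freed one at a time. For \<open>M = A\<close> and \<open>N = B\<close> this is the
  associativity of \<open>A \<ltimes> B\<close>.
\<close>

lemma (in smash_action) op_assoc:
  fixes mul defines "mul \<equiv> smash_action.op R \<Gamma> B A A B (\<lambda>a a'. a \<otimes>\<^bsub>A\<^esub> a') (\<lambda>b b'. b \<otimes>\<^bsub>B\<^esub> b')"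
  assumes s: "s \<in> carrier AB.T" and t: "t \<in> carrier AB.T" and u: "u \<in> carrier T"
  shows "op (mul s t) u = op s (op t u)"
proof -
  interpret S: smash_action R \<Gamma> A B A A B "\<lambda>a a'. a \<otimes>\<^bsub>A\<^esub> a'" "\<lambda>b b'. b \<otimes>\<^bsub>B\<^esub> b'"
    by (rule smash_action_algebra) unfold_locales
  have mul: "mul = S.op" by (simp add: mul_def)
  have Ac: "a \<in> carrier A" if "\<beta> \<in> carrier \<Gamma>" "a \<in> part A \<beta>" for \<beta> a
    using S.grp.part_carrier that .
  have 1: "op (S.op (AB.pt a b) (AB.pt a' b')) (pt m n) = op (AB.pt a b) (op (AB.pt a' b') (pt m n))"
    if ab: "a \<in> carrier A" "b \<in> carrier B" and \<beta>: "\<beta> \<in> carrier \<Gamma>" and a': "a' \<in> part A \<beta>" and b': "b' \<in> carrier B"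
      and \<gamma>: "\<gamma> \<in> carrier \<Gamma>" and m: "m \<in> part M \<gamma>" and n: "n \<in> carrier N\<^sub>R" for a b \<beta> a' b' \<gamma> m n
  proof -
    have a'c: "a' \<in> carrier A" and mc: "m \<in> carrier M" using Ac[OF \<beta> a'] grp.part_carrier[OF \<gamma> m] .
    have "op (S.op (AB.pt a b) (AB.pt a' b')) (pt m n) =
        op (AB.pt (a \<otimes>\<^bsub>A\<^esub> a') (act B b \<beta> \<otimes>\<^bsub>B\<^esub> b')) (pt m n)"
      using S.op_pure[OF ab \<beta> a' b'] by simp
    also have "\<dots> = pt (lact (a \<otimes>\<^bsub>A\<^esub> a') m) (ract (act B (act B b \<beta> \<otimes>\<^bsub>B\<^esub> b') \<gamma>) n)"
      using ab a'c b' \<beta> by (intro op_pure[OF _ _ \<gamma> m n]) (auto simp: S.lact_closed S.ract_closed act_closed)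
    also have "\<dots> = pt (lact a (lact a' m)) (ract (act B b (\<beta> \<otimes>\<^bsub>\<Gamma>\<^esub> \<gamma>)) (ract (act B b' \<gamma>) n))"
      using ab a'c b' \<beta> \<gamma> mc n by (simp add: lact_assoc act_times act_closed ract_assoc act.act_mult)
    also have "\<dots> = op (AB.pt a b) (pt (lact a' m) (ract (act B b' \<gamma>) n))"
      using ab a' b' \<beta> \<gamma> m n
      by (intro op_pure[symmetric]) (auto simp: ract_closed act_closed intro!: lact_part)
    also have "\<dots> = op (AB.pt a b) (op (AB.pt a' b') (pt m n))"
      using op_pure[OF a'c b' \<gamma> m n] by simp
    finally show ?thesis .
  qed
  have 2: "op (S.op (AB.pt a b) t) (pt m n) = op (AB.pt a b) (op t (pt m n))"
    if ab: "a \<in> carrier A" "b \<in> carrier B"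
      and \<gamma>: "\<gamma> \<in> carrier \<Gamma>" and m: "m \<in> part M \<gamma>" and n: "n \<in> carrier N\<^sub>R" for a b \<gamma> m n
  proof (rule S.homogeneous_tensor_ext[OF MN.abelian_group_T _ _ _ t])
    have mc: "pt m n \<in> carrier T" using grp.part_carrier[OF \<gamma> m] n by (simp add: MN.pt_closed base)
    have abc: "AB.pt a b \<in> carrier AB.T" using ab by (simp add: AB.pt_closed)
    show "additive_map AB.T T (\<lambda>t. op (S.op (AB.pt a b) t) (pt m n))"
      by (rule additive_comp[OF S.op_additive_right[OF abc] op_additive_left[OF mc]])
    show "additive_map AB.T T (\<lambda>t. op (AB.pt a b) (op t (pt m n)))"
      by (rule additive_comp[OF op_additive_left[OF mc] op_additive_right[OF abc]])
  qed (rule 1[OF ab _ _ _ \<gamma> m n])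
  have 3: "op (S.op s t) (pt m n) = op s (op t (pt m n))"
    if \<gamma>: "\<gamma> \<in> carrier \<Gamma>" and m: "m \<in> part M \<gamma>" and n: "n \<in> carrier N\<^sub>R" for \<gamma> m n
  proof (rule AB.tensor_hom_ext[OF MN.abelian_group_T _ _ _ s])
    have mc: "pt m n \<in> carrier T" using grp.part_carrier[OF \<gamma> m] n by (simp add: MN.pt_closed base)
    show "additive_map AB.T T (\<lambda>s. op (S.op s t) (pt m n))"
      by (rule additive_comp[OF S.op_additive_left[OF t] op_additive_left[OF mc]])
    show "additive_map AB.T T (\<lambda>s. op s (op t (pt m n)))"
      by (rule op_additive_left[OF op_closed[OF t mc]])
  qed (rule 2[OF _ _ \<gamma> m n])
  show ?thesis unfolding mul
  proof (rule homogeneous_tensor_ext[OF MN.abelian_group_T _ _ _ u])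
    show "additive_map T T (op (S.op s t))"
      by (rule op_additive_right[OF S.op_closed[OF s t]])
    show "additive_map T T (\<lambda>u. op s (op t u))"
      by (rule additive_comp[OF op_additive_right[OF t] op_additive_right[OF s]])
  qed (rule 3)
qed

locale smash_setting = A: graded_algebra R \<Gamma> A + B: monoid_algebra_action R \<Gamma> B
  for R :: "('r, 'u1) ring_scheme" and \<Gamma> :: "('g, 'u2) monoid_scheme"
    and A :: "('r, 'a, 'g, 'u3) graded_scheme" and B :: "('r, 'b, 'g, 'u4) acted_scheme"
begin

sublocale S: smash_action R \<Gamma> A B A A B "\<lambda>a a'. a \<otimes>\<^bsub>A\<^esub> a'" "\<lambda>b b'. b \<otimes>\<^bsub>B\<^esub> b'"
  by (rule smash_action_algebra) unfold_locales

abbreviation SA where "SA \<equiv> smash_algebra R \<Gamma> A B"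

lemma SA_simps:
  "carrier SA = carrier S.MN.T" "x \<otimes>\<^bsub>SA\<^esub> y = S.op x y" "\<one>\<^bsub>SA\<^esub> = S.MN.pt \<one>\<^bsub>A\<^esub> \<one>\<^bsub>B\<^esub>"
  "\<zero>\<^bsub>SA\<^esub> = \<zero>\<^bsub>S.MN.T\<^esub>" "x \<oplus>\<^bsub>SA\<^esub> y = x \<oplus>\<^bsub>S.MN.T\<^esub> y" "r \<odot>\<^bsub>SA\<^esub> x = r \<odot>\<^bsub>S.MN.T\<^esub> x"
  "part SA \<gamma> = S.deg_part \<gamma>"
  by (simp_all add: smash_algebra_def Let_def S.op_def S.inner_def[abs_def] S.deg_part_def)

lemma SA_right_unit: "s \<in> carrier S.MN.T \<Longrightarrow> S.op s (S.MN.pt \<one>\<^bsub>A\<^esub> \<one>\<^bsub>B\<^esub>) = s"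
proof (rule S.MN.tensor_hom_ext[OF S.MN.abelian_group_T S.op_additive_left additive_id])
  show "S.MN.pt \<one>\<^bsub>A\<^esub> \<one>\<^bsub>B\<^esub> \<in> carrier S.MN.T" by (simp add: S.MN.pt_closed)
  fix a b assume "a \<in> carrier A" "b \<in> carrier B"
  then show "S.op (S.MN.pt a b) (S.MN.pt \<one>\<^bsub>A\<^esub> \<one>\<^bsub>B\<^esub>) = S.MN.pt a b"
    using S.op_pure[OF _ _ S.one_\<Gamma> A.one_part S.one_B, of a b] by (simp add: B.act_one)
qed

lemma abelian_group_SA: "abelian_group SA"
  by (rule abelian_group_cong[OF S.MN.abelian_group_T]) (simp_all add: SA_simps)

lemma ring_SA: "ring SA"
proof (rule ringI[OF abelian_group_SA])
  have one: "S.MN.pt \<one>\<^bsub>A\<^esub> \<one>\<^bsub>B\<^esub> \<in> carrier S.MN.T" by (simp add: S.MN.pt_closed)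
  show "monoid SA"
    by (rule monoidI) (auto simp: SA_simps S.op_closed S.op_assoc S.op_unit SA_right_unit one)
qed (auto simp: SA_simps additive_add[OF S.op_additive_left] additive_add[OF S.op_additive_right])

lemma module_SA: "module R SA"
proof -
  interpret T: module R S.MN.T by (rule S.MN.module_T)
  show ?thesis
    by (rule moduleI) (auto simp: SA_simps A.R.is_cring abelian_group_SA T.smult_l_distr T.smult_r_distr T.smult_assoc1)
qed

lemma unital_algebra_SA: "unital_algebra R SA"
proof (intro unital_algebra.intro unital_algebra_axioms.intro module_SA ring_SA)
  note sm = S.MN.smult_additive
  fix r s t assume r: "r \<in> carrier R" and s: "s \<in> carrier SA" and t: "t \<in> carrier SA"
  have s': "s \<in> carrier S.MN.T" and t': "t \<in> carrier S.MN.T" using s t by (simp_all add: SA_simps)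
  have "S.op (r \<odot>\<^bsub>S.MN.T\<^esub> s) t = r \<odot>\<^bsub>S.MN.T\<^esub> S.op s t"
  proof (rule S.MN.tensor_hom_ext[OF S.MN.abelian_group_T additive_comp[OF sm[OF r] S.op_additive_left[OF t']]
          additive_comp[OF S.op_additive_left[OF t'] sm[OF r]] _ s'])
    fix a b assume ab: "a \<in> carrier A" "b \<in> carrier B"
    then have abc: "S.MN.pt a b \<in> carrier S.MN.T" and rabc: "S.MN.pt (r \<odot>\<^bsub>A\<^esub> a) b \<in> carrier S.MN.T"
      using r by (auto simp: S.MN.pt_closed)
    have "S.op (S.MN.pt (r \<odot>\<^bsub>A\<^esub> a) b) t = r \<odot>\<^bsub>S.MN.T\<^esub> S.op (S.MN.pt a b) t"
    proof (rule S.homogeneous_tensor_ext[OF S.MN.abelian_group_T S.op_additive_right[OF rabc]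
          additive_comp[OF S.op_additive_right[OF abc] sm[OF r]] _ t'])
      fix \<gamma> m n assume g: "\<gamma> \<in> carrier \<Gamma>" "m \<in> part A \<gamma>" "n \<in> carrier B"
      then show "S.op (S.MN.pt (r \<odot>\<^bsub>A\<^esub> a) b) (S.MN.pt m n) = r \<odot>\<^bsub>S.MN.T\<^esub> S.op (S.MN.pt a b) (S.MN.pt m n)"
        using ab r S.grp.part_carrier[OF g(1,2)]
        by (simp add: S.op_pure A.smult_mult_left S.MN.smult_pt S.lact_closed S.ract_closed S.act_closed)
    qed
    then show "S.op (r \<odot>\<^bsub>S.MN.T\<^esub> S.MN.pt a b) t = r \<odot>\<^bsub>S.MN.T\<^esub> S.op (S.MN.pt a b) t"
      using r ab by (simp add: S.MN.smult_pt)
  qed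
  then show "(r \<odot>\<^bsub>SA\<^esub> s) \<otimes>\<^bsub>SA\<^esub> t = r \<odot>\<^bsub>SA\<^esub> (s \<otimes>\<^bsub>SA\<^esub> t)" by (simp add: SA_simps)
  have "S.op s (r \<odot>\<^bsub>S.MN.T\<^esub> t) = r \<odot>\<^bsub>S.MN.T\<^esub> S.op s t"
  proof (rule S.MN.tensor_hom_ext[OF S.MN.abelian_group_T S.op_additive_left
          additive_comp[OF S.op_additive_left[OF t'] sm[OF r]] _ s'])
    show "r \<odot>\<^bsub>S.MN.T\<^esub> t \<in> carrier S.MN.T" by (rule additive_closed[OF sm[OF r] t'])
    fix a b assume ab: "a \<in> carrier A" "b \<in> carrier B"
    then have abc: "S.MN.pt a b \<in> carrier S.MN.T" by (auto simp: S.MN.pt_closed)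
    show "S.op (S.MN.pt a b) (r \<odot>\<^bsub>S.MN.T\<^esub> t) = r \<odot>\<^bsub>S.MN.T\<^esub> S.op (S.MN.pt a b) t"
    proof (rule S.homogeneous_tensor_ext[OF S.MN.abelian_group_T
          additive_comp[OF sm[OF r] S.op_additive_right[OF abc]]
          additive_comp[OF S.op_additive_right[OF abc] sm[OF r]] _ t'])
      fix \<gamma> m n assume g: "\<gamma> \<in> carrier \<Gamma>" "m \<in> part A \<gamma>" "n \<in> carrier B"
      then show "S.op (S.MN.pt a b) (r \<odot>\<^bsub>S.MN.T\<^esub> S.MN.pt m n) = r \<odot>\<^bsub>S.MN.T\<^esub> S.op (S.MN.pt a b) (S.MN.pt m n)"
        using ab r S.grp.part_carrier[OF g(1,2)] S.part_smult_base[OF g(1) r g(2)]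
        by (simp add: S.op_pure A.smult_mult_right S.MN.smult_pt S.lact_closed S.ract_closed S.act_closed)
    qed
  qed
  then show "s \<otimes>\<^bsub>SA\<^esub> (r \<odot>\<^bsub>SA\<^esub> t) = r \<odot>\<^bsub>SA\<^esub> (s \<otimes>\<^bsub>SA\<^esub> t)" by (simp add: SA_simps)
qed

lemma graded_group_SA: "graded_group \<Gamma> SA"
  by (rule S.graded_group_tensor(1)) (simp_all add: SA_simps)

lemma graded_algebra_SA: "graded_algebra R \<Gamma> SA"
proof (intro graded_algebra.intro graded_algebra_axioms.intro unital_algebra_SA)
  interpret G: graded_group \<Gamma> SA by (rule graded_group_SA)
  show "monoid \<Gamma>" ..
  show "direct_sum_of_parts \<Gamma> SA" by (rule G.parts_direct)
  show "\<one>\<^bsub>SA\<^esub> \<in> part SA \<one>\<^bsub>\<Gamma>\<^esub>" using A.one_part by (simp add: SA_simps S.pt_deg_part)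
  show "s \<otimes>\<^bsub>SA\<^esub> t \<in> part SA (\<alpha> \<otimes>\<^bsub>\<Gamma>\<^esub> \<beta>)"
    if "\<alpha> \<in> carrier \<Gamma>" "\<beta> \<in> carrier \<Gamma>" "s \<in> part SA \<alpha>" "t \<in> part SA \<beta>" for \<alpha> \<beta> s t
    using S.op_deg[OF that(1,2)] that(3,4) by (simp add: SA_simps S.deg_part_def)
  fix \<gamma> assume \<gamma>: "\<gamma> \<in> carrier \<Gamma>"
  show "submodule (part SA \<gamma>) R SA"
  proof (intro submodule.intro submodule_axioms.intro)
    show "subgroup (part SA \<gamma>) (add_monoid SA)" by (rule G.part_subgroup[OF \<gamma>])
    fix r s assume r: "r \<in> carrier R" and s: "s \<in> part SA \<gamma>"
    have "S.deg_part \<gamma> \<subseteq> {s \<in> carrier S.MN.T. r \<odot>\<^bsub>S.MN.T\<^esub> s \<in> S.deg_part \<gamma>}"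
      by (rule S.deg_part_subset[OF subgroup_vimage[OF S.MN.abelian_group_T S.MN.abelian_group_T
              S.MN.smult_additive[OF r] S.deg_part_subgroup[OF \<gamma>]]])
        (use r \<gamma> S.part_smult_base S.grp.part_carrier in \<open>auto simp: S.MN.pt_closed S.MN.smult_pt intro!: S.pt_deg_part\<close>)
    then show "r \<odot>\<^bsub>SA\<^esub> s \<in> part SA \<gamma>" using s by (auto simp: SA_simps)
  qed
qed

end

locale smash_module_setting = smash_setting R \<Gamma> A B + M: graded_module R \<Gamma> A M + N: left_module B N
  for R :: "('r, 'u1) ring_scheme" and \<Gamma> :: "('g, 'u2) monoid_scheme"
    and A :: "('r, 'a, 'g, 'u3) graded_scheme" and B :: "('r, 'b, 'g, 'u4) acted_scheme"
    and M :: "('a, 'm, 'g, 'u5) graded_scheme" and N :: "('b, 'n, 'u6) module_scheme"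
begin

sublocale Q: smash_action R \<Gamma> A B M "base_module A M" "base_module B N" "\<lambda>a m. a \<odot>\<^bsub>M\<^esub> m" "\<lambda>b x. b \<odot>\<^bsub>N\<^esub> x"
  by (rule smash_action_module) unfold_locales

abbreviation SM where "SM \<equiv> smash_module R \<Gamma> A B N M"

lemma SM_simps:
  "carrier SM = carrier Q.T" "\<zero>\<^bsub>SM\<^esub> = \<zero>\<^bsub>Q.T\<^esub>" "x \<oplus>\<^bsub>SM\<^esub> y = x \<oplus>\<^bsub>Q.T\<^esub> y"
  "s \<odot>\<^bsub>SM\<^esub> t = Q.op s t" "part SM \<gamma> = Q.deg_part \<gamma>"
  by (simp_all add: smash_module_def Let_def Q.op_def Q.inner_def[abs_def] Q.deg_part_def)

lemma abelian_group_SM: "abelian_group SM"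
  by (rule abelian_group_cong[OF Q.MN.abelian_group_T]) (simp_all add: SM_simps)

lemma left_module_SM: "left_module SA SM"
  by (intro left_module.intro left_module_axioms.intro ring_SA abelian_group_SM)
    (simp_all add: SA_simps SM_simps Q.op_closed additive_add[OF Q.op_additive_left]
      additive_add[OF Q.op_additive_right] Q.op_assoc Q.op_unit)

lemma graded_group_SM: "graded_group \<Gamma> SM"
  by (rule Q.graded_group_tensor(1)) (simp_all add: SM_simps)

lemma homog_comp_SM: "x \<in> carrier SM \<Longrightarrow> \<gamma> \<in> carrier \<Gamma> \<Longrightarrow> homog_comp \<Gamma> SM x \<gamma> = Q.proj \<gamma> x"
  by (rule Q.graded_group_tensor(2)) (simp_all add: SM_simps)

lemma graded_module_SM: "graded_module R \<Gamma> SA SM"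
  by (rule graded_moduleI[OF graded_algebra_SA left_module_SM graded_group_SM])
    (simp add: SA_simps SM_simps S.deg_part_def Q.op_deg)

end

text \<open>
  A graded map preserves the degrees, which are all that the twisted action sees of the first factor.
\<close>

lemma graded_map_smash:
  fixes R :: "('r, 'u1) ring_scheme" and A :: "('r, 'a, 'g, 'u3) graded_scheme" and B :: "('r, 'b, 'g, 'u4) acted_scheme"
    and M :: "('a, 'm, 'g, 'u5) graded_scheme" and M' :: "('a, 'l, 'g, 'u7) graded_scheme"
    and N :: "('b, 'n, 'u6) module_scheme"
  assumes B: "monoid_algebra_action R \<Gamma> B" and N: "left_module B N"
    and M: "graded_module R \<Gamma> A M" and M': "graded_module R \<Gamma> A M'" and f: "graded_map \<Gamma> A M M' f"
  shows "graded_map \<Gamma> (smash_algebra R \<Gamma> A B) (smash_module R \<Gamma> A B N M) (smash_module R \<Gamma> A B N M')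
     (smash_map R A B N M' f)"
proof -
  interpret M: graded_module R \<Gamma> A M by fact
  interpret S: smash_module_setting R \<Gamma> A B M N
    by (intro smash_module_setting.intro smash_setting.intro M.alg.graded_algebra_axioms B N M)
  interpret S': smash_module_setting R \<Gamma> A B M' N
    by (intro smash_module_setting.intro smash_setting.intro M.alg.graded_algebra_axioms B N M')
  have fl: "linear_map A M M' f" and fp: "\<And>\<gamma> m. \<gamma> \<in> carrier \<Gamma> \<Longrightarrow> m \<in> part M \<gamma> \<Longrightarrow> f m \<in> part M' \<gamma>"
    using f by (auto simp: graded_map_def)
  let ?MR = "base_module A M" and ?MR' = "base_module A M'" and ?NR = "base_module B N"
  have lin: "linear_map R ?MR ?MR' f"
    using fl by (auto simp: linear_map_def)
  let ?f = "smash_map R A B N M' f"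
  have mods: "module R ?MR" "module R ?MR'" "module R ?NR"
    using S.Q.MN.M.module_axioms S'.Q.MN.M.module_axioms S.Q.MN.N.module_axioms by auto
  have fe: "?f = tensor_map R ?MR' ?NR f" by (simp add: smash_map_def[abs_def])
  have ad: "additive_map S.Q.T S'.Q.T ?f" unfolding fe by (rule tensor_map_additive[OF mods lin])
  have pure: "?f (S.Q.pt m n) = S'.Q.pt (f m) n" if "m \<in> carrier M" "n \<in> carrier N" for m n
    unfolding fe using tensor_map_pure[OF mods lin] that by simp
  have fc: "f m \<in> carrier M'" if "m \<in> carrier M" for m by (rule linear_map_closed[OF fl that])
  have eq: "?f (S.Q.op s t) = S'.Q.op s (?f t)" if s: "s \<in> carrier S.S.MN.T" and t: "t \<in> carrier S.Q.T" for s t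
  proof (rule S.S.MN.tensor_hom_ext[OF S'.Q.MN.abelian_group_T _ _ _ s])
    show "additive_map S.S.MN.T S'.Q.T (\<lambda>s. ?f (S.Q.op s t))"
      by (rule additive_comp[OF S.Q.op_additive_left[OF t] ad])
    show "additive_map S.S.MN.T S'.Q.T (\<lambda>s. S'.Q.op s (?f t))"
      by (rule S'.Q.op_additive_left[OF additive_closed[OF ad t]])
    fix a b assume ab: "a \<in> carrier A" "b \<in> carrier B"
    then have abc: "S.S.MN.pt a b \<in> carrier S.S.MN.T" by (simp add: S.S.MN.pt_closed)
    show "?f (S.Q.op (S.S.MN.pt a b) t) = S'.Q.op (S.S.MN.pt a b) (?f t)"
    proof (rule S.Q.homogeneous_tensor_ext[OF S'.Q.MN.abelian_group_T _ _ _ t])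
      show "additive_map S.Q.T S'.Q.T (\<lambda>t. ?f (S.Q.op (S.S.MN.pt a b) t))"
        by (rule additive_comp[OF S.Q.op_additive_right[OF abc] ad])
      show "additive_map S.Q.T S'.Q.T (\<lambda>t. S'.Q.op (S.S.MN.pt a b) (?f t))"
        by (rule additive_comp[OF ad S'.Q.op_additive_right[OF abc]])
      fix \<gamma> m n assume g: "\<gamma> \<in> carrier \<Gamma>" and m: "m \<in> part M \<gamma>" and n: "n \<in> carrier (base_module B N)"
      have mc: "m \<in> carrier M" by (rule S.Q.grp.part_carrier[OF g m])
      show "?f (S.Q.op (S.S.MN.pt a b) (S.Q.pt m n)) = S'.Q.op (S.S.MN.pt a b) (?f (S.Q.pt m n))"
        using ab g m n mc fp[OF g m] S.Q.lact_closed[OF ab(1) mc] S.Q.ract_closed[OF S.Q.act_closed[OF g ab(2)] n]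
        by (simp add: S.Q.op_pure S'.Q.op_pure pure linear_map_smult[OF fl])
    qed
  qed
  show ?thesis unfolding graded_map_def
  proof (intro conjI ballI)
    show "linear_map S.SA S.SM S'.SM ?f"
      by (rule linear_mapI)
        (use ad eq in \<open>auto simp: S.SA_simps S.SM_simps S'.SM_simps additive_map_def\<close>)
    fix \<gamma> assume \<gamma>: "\<gamma> \<in> carrier \<Gamma>"
    have "S.Q.deg_part \<gamma> \<subseteq> {t \<in> carrier S.Q.T. ?f t \<in> S'.Q.deg_part \<gamma>}"
      by (rule S.Q.deg_part_subset[OF subgroup_vimage[OF S.Q.MN.abelian_group_T S'.Q.MN.abelian_group_T ad
              S'.Q.deg_part_subgroup[OF \<gamma>]]])
        (use S.Q.grp.part_carrier[OF \<gamma>] fp[OF \<gamma>] in \<open>auto simp: S.Q.MN.pt_closed pure intro!: S'.Q.pt_deg_part\<close>)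
    then show "?f ` part S.SM \<gamma> \<subseteq> part S'.SM \<gamma>" by (auto simp: S.SM_simps S'.SM_simps)
  qed
qed

section \<open>Superfluous submodules of \<open>M \<ltimes> N\<close>\<close>

lemma subgroup_sum:
  assumes "abelian_group V" "subgroup H (add_monoid V)" "subgroup H' (add_monoid V)"
  shows "subgroup {x \<oplus>\<^bsub>V\<^esub> y | x y. x \<in> H \<and> y \<in> H'} (add_monoid V)"
proof (rule subgroup_addI[OF assms(1)])
  interpret V: abelian_group V by fact
  note H = subgroup_addD[OF assms(1,2)] and H' = subgroup_addD[OF assms(1,3)]
  let ?S = "{x \<oplus>\<^bsub>V\<^esub> y | x y. x \<in> H \<and> y \<in> H'}"
  show "?S \<subseteq> carrier V" using H H' by auto
  show "\<zero>\<^bsub>V\<^esub> \<in> ?S" using H H' by (auto intro!: exI[of _ "\<zero>\<^bsub>V\<^esub>"])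
  show "u \<oplus>\<^bsub>V\<^esub> v \<in> ?S" if "u \<in> ?S" "v \<in> ?S" for u v
  proof -
    from that obtain x y x' y' where e: "u = x \<oplus>\<^bsub>V\<^esub> y" "v = x' \<oplus>\<^bsub>V\<^esub> y'" "x \<in> H" "x' \<in> H" "y \<in> H'" "y' \<in> H'" by blast
    then have "u \<oplus>\<^bsub>V\<^esub> v = (x \<oplus>\<^bsub>V\<^esub> x') \<oplus>\<^bsub>V\<^esub> (y \<oplus>\<^bsub>V\<^esub> y')"
      using H(1) H'(1) by (simp add: V.a_ac subset_iff)
    then show ?thesis using e H(3) H'(3) by blast
  qed
  show "\<ominus>\<^bsub>V\<^esub> u \<in> ?S" if "u \<in> ?S" for u
  proof -
    from that obtain x y where e: "u = x \<oplus>\<^bsub>V\<^esub> y" "x \<in> H" "y \<in> H'" by blast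
    then have "\<ominus>\<^bsub>V\<^esub> u = \<ominus>\<^bsub>V\<^esub> x \<oplus>\<^bsub>V\<^esub> \<ominus>\<^bsub>V\<^esub> y"
      using H(1) H'(1) by (simp add: V.minus_add subset_iff)
    then show ?thesis using e H(4) H'(4) by blast
  qed
qed

context smash_module_setting begin

abbreviation V where "V \<equiv> Q.T"

text \<open>
  Closure under \<open>A\<close>, acting by \<open>a \<otimes> 1\<close>, and under components: the graded \<open>A\<close>-submodules of \<open>M \<otimes> N\<close>.
  Minimality is proved for these, because the map \<open>m \<mapsto> m \<otimes> n\<close> only respects the action of \<open>A\<close>.
\<close>

definition scalar_closed :: "('m, 'n) tensor set \<Rightarrow> bool"
  where "scalar_closed W \<longleftrightarrow> subgroup W (add_monoid V) \<and>
    (\<forall>a\<in>carrier A. \<forall>t\<in>W. Q.op (S.MN.pt a \<one>\<^bsub>B\<^esub>) t \<in> W) \<and> (\<forall>\<gamma>\<in>carrier \<Gamma>. \<forall>t\<in>W. Q.proj \<gamma> t \<in> W)"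

definition span_over :: "'m set \<Rightarrow> 'n set \<Rightarrow> ('m, 'n) tensor set"
  where "span_over K F = generate (add_monoid V) {Q.pt k s | k s. k \<in> K \<and> s \<in> F}"

lemma left_pure_closed: "a \<in> carrier A \<Longrightarrow> S.MN.pt a \<one>\<^bsub>B\<^esub> \<in> carrier S.MN.T"
  by (simp add: S.MN.pt_closed)

lemma op_one_pt: "a \<in> carrier A \<Longrightarrow> m \<in> carrier M \<Longrightarrow> n \<in> carrier N \<Longrightarrow>
    Q.op (S.MN.pt a \<one>\<^bsub>B\<^esub>) (Q.pt m n) = Q.pt (a \<odot>\<^bsub>M\<^esub> m) n"
  using Q.op_one_pure[of a m n] by simp

lemma proj_pt: "\<gamma> \<in> carrier \<Gamma> \<Longrightarrow> m \<in> carrier M \<Longrightarrow> n \<in> carrier N \<Longrightarrow>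
    Q.proj \<gamma> (Q.pt m n) = Q.pt (homog_comp \<Gamma> M m \<gamma>) n"
  using Q.proj_pure[of \<gamma> m n] by simp

lemma pt_left: "n \<in> carrier N \<Longrightarrow> additive_map M V (\<lambda>m. Q.pt m n)"
  using Q.pt_additive_left[of n] by simp

context
  fixes K assumes K: "superfluous R \<Gamma> A K M"
begin

lemma K_submodule: "graded_submodule R \<Gamma> A K M"
  using K by (simp add: superfluous_def)

lemmas KD = graded_submoduleD[OF M.graded_module_axioms K_submodule]

lemma K_carrier: "k \<in> K \<Longrightarrow> k \<in> carrier M"
  using K_submodule by (auto simp: graded_submodule_def)

text \<open>
  The image \<open>K \<otimes> n\<close> of a superfluous submodule is superfluous: the preimage \<open>S'\<close> of \<open>W\<close> under \<open>m \<mapsto> m \<otimes> n\<close>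
  satisfies \<open>K + S' = M\<close>, hence \<open>S' = M\<close>, and then \<open>W\<close> already contains \<open>K \<otimes> n\<close>.
\<close>

lemma superfluous_slice:
  assumes W: "scalar_closed W" and n: "n \<in> carrier N"
    and cover: "\<And>t. t \<in> carrier V \<Longrightarrow> \<exists>w\<in>W. \<exists>k\<in>K. t = w \<oplus>\<^bsub>V\<^esub> Q.pt k n"
  shows "W = carrier V"
proof -
  have sg: "subgroup W (add_monoid V)" using W by (simp add: scalar_closed_def)
  note WD = subgroup_addD[OF Q.MN.abelian_group_T sg]
  define S' where "S' = {p \<in> carrier M. Q.pt p n \<in> W}"
  have sub: "graded_submodule R \<Gamma> A S' M"
  proof (rule graded_submoduleI[OF M.graded_module_axioms])
    show "subgroup S' (add_monoid M)" unfolding S'_def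
      by (rule subgroup_vimage[OF M.M.abelian_group_axioms Q.MN.abelian_group_T pt_left[OF n] sg])
    show "a \<odot>\<^bsub>M\<^esub> x \<in> S'" if "a \<in> carrier A" "x \<in> S'" for a x
      using that W n by (auto simp: S'_def M.smult_closed op_one_pt[symmetric] scalar_closed_def)
    show "homog_comp \<Gamma> M x \<gamma> \<in> S'" if "x \<in> S'" "\<gamma> \<in> carrier \<Gamma>" for x \<gamma>
      using that W n by (auto simp: S'_def Q.grp.comp_closed proj_pt[symmetric] scalar_closed_def)
  qed
  have "K <+>\<^bsub>M\<^esub> S' = carrier M"
  proof
    show "K <+>\<^bsub>M\<^esub> S' \<subseteq> carrier M" using K_carrier by (auto simp: set_add_def' S'_def)
    show "carrier M \<subseteq> K <+>\<^bsub>M\<^esub> S'"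
    proof
      fix p assume p: "p \<in> carrier M"
      then have "Q.pt p n \<in> carrier V" using n by (simp add: Q.MN.pt_closed)
      then obtain w k where wk: "w \<in> W" "k \<in> K" "Q.pt p n = w \<oplus>\<^bsub>V\<^esub> Q.pt k n" using cover by blast
      have kc: "k \<in> carrier M" using K_carrier wk by blast
      have wc: "w \<in> carrier V" using wk WD by auto
      have kn: "Q.pt k n \<in> carrier V" using kc n by (simp add: Q.MN.pt_closed)
      have "Q.pt (p \<ominus>\<^bsub>M\<^esub> k) n = Q.pt p n \<ominus>\<^bsub>V\<^esub> Q.pt k n"
        using additive_add[OF pt_left[OF n], of p "\<ominus>\<^bsub>M\<^esub> k"] p kc
          additive_minus[OF M.M.abelian_group_axioms Q.MN.abelian_group_T pt_left[OF n] kc]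
        by (simp add: M.M.minus_eq Q.MN.T.minus_eq)
      also have "\<dots> = w" unfolding wk(3) using wc kn by (simp add: Q.MN.T.minus_eq Q.MN.T.a_assoc Q.MN.T.r_neg)
      finally have "p \<ominus>\<^bsub>M\<^esub> k \<in> S'" using p kc wk by (simp add: S'_def)
      moreover have "p = k \<oplus>\<^bsub>M\<^esub> (p \<ominus>\<^bsub>M\<^esub> k)" using p kc
        by (simp add: M.M.minus_eq M.M.a_comm[of p "\<ominus>\<^bsub>M\<^esub> k"] M.M.r_neg2)
      ultimately show "p \<in> K <+>\<^bsub>M\<^esub> S'" using wk(2) by (auto simp: set_add_def')
    qed
  qed
  then have "S' = carrier M" using K sub by (simp add: superfluous_def)
  then have pW: "Q.pt p n \<in> W" if "p \<in> carrier M" for p using that by (auto simp: S'_def)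
  show ?thesis
  proof
    show "W \<subseteq> carrier V" by (rule WD)
    show "carrier V \<subseteq> W"
    proof
      fix t assume "t \<in> carrier V"
      then obtain w k where "w \<in> W" "k \<in> K" "t = w \<oplus>\<^bsub>V\<^esub> Q.pt k n" using cover by blast
      then show "t \<in> W" using WD(3) pW K_carrier by blast
    qed
  qed
qed

lemma span_generators: "F \<subseteq> carrier N \<Longrightarrow> {Q.pt k s | k s. k \<in> K \<and> s \<in> F} \<subseteq> carrier V"
  using K_carrier by (auto simp: Q.MN.pt_closed subset_iff)

lemma slice_subgroup: "n \<in> carrier N \<Longrightarrow> subgroup ((\<lambda>k. Q.pt k n) ` K) (add_monoid V)"
  by (rule subgroup_image[OF M.M.abelian_group_axioms Q.MN.abelian_group_T pt_left KD(1)])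

text \<open>
  To remove the span over \<open>insert n F\<close>, add \<open>K \<otimes> n\<close> to \<open>W\<close> first. The induction hypothesis shows that the
  larger submodule \<open>W'\<close> is everything, and then the case of one generator applies to \<open>W\<close>.
\<close>

lemma superfluous_finite:
  assumes "finite F" "F \<subseteq> carrier N" "scalar_closed W"
    "\<And>t. t \<in> carrier V \<Longrightarrow> \<exists>w\<in>W. \<exists>i\<in>span_over K F. t = w \<oplus>\<^bsub>V\<^esub> i"
  shows "W = carrier V"
  using assms
proof (induction F arbitrary: W)
  case empty
  have sg: "subgroup W (add_monoid V)" using empty by (simp add: scalar_closed_def)
  note WD = subgroup_addD[OF Q.MN.abelian_group_T sg]
  have "span_over K {} \<subseteq> {\<zero>\<^bsub>V\<^esub>}"
    unfolding span_over_def
    by (rule generate_add_subset[OF Q.MN.abelian_group_T]) (use Q.MN.T.add.triv_subgroup in auto)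
  moreover have "w \<oplus>\<^bsub>V\<^esub> \<zero>\<^bsub>V\<^esub> = w" if "w \<in> W" for w using that WD(1) by auto
  ultimately have "t \<in> W" if "t \<in> carrier V" for t using empty.prems(3)[OF that] by auto
  then show ?case using WD(1) by blast
next
  case (insert n F)
  have n: "n \<in> carrier N" and F: "F \<subseteq> carrier N" using insert.prems by auto
  let ?H = "(\<lambda>k. Q.pt k n) ` K"
  define W' where "W' = {w \<oplus>\<^bsub>V\<^esub> h | w h. w \<in> W \<and> h \<in> ?H}"
  have sg: "subgroup W (add_monoid V)" using insert.prems by (simp add: scalar_closed_def)
  note WD = subgroup_addD[OF Q.MN.abelian_group_T sg]
  note HD = subgroup_addD[OF Q.MN.abelian_group_T slice_subgroup[OF n]]
  have fsg: "subgroup (span_over K F) (add_monoid V)"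
    unfolding span_over_def by (rule subgroup_generate_add[OF Q.MN.abelian_group_T span_generators[OF F]])
  note FD = subgroup_addD[OF Q.MN.abelian_group_T fsg]
  have W'_good: "scalar_closed W'"
    unfolding scalar_closed_def
  proof (intro conjI ballI)
    show "subgroup W' (add_monoid V)"
      unfolding W'_def by (rule subgroup_sum[OF Q.MN.abelian_group_T sg slice_subgroup[OF n]])
    fix t assume "t \<in> W'"
    then obtain w k where wk: "t = w \<oplus>\<^bsub>V\<^esub> Q.pt k n" "w \<in> W" "k \<in> K" by (auto simp: W'_def)
    then have c: "w \<in> carrier V" "k \<in> carrier M" "Q.pt k n \<in> carrier V" using WD(1) HD(1) K_carrier by auto
    show "Q.op (S.MN.pt a \<one>\<^bsub>B\<^esub>) t \<in> W'" if a: "a \<in> carrier A" for a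
    proof -
      have "Q.op (S.MN.pt a \<one>\<^bsub>B\<^esub>) t = Q.op (S.MN.pt a \<one>\<^bsub>B\<^esub>) w \<oplus>\<^bsub>V\<^esub> Q.pt (a \<odot>\<^bsub>M\<^esub> k) n"
        using additive_add[OF Q.op_additive_right[OF left_pure_closed[OF a]]] c n a wk(1) by (simp add: op_one_pt)
      moreover have "Q.op (S.MN.pt a \<one>\<^bsub>B\<^esub>) w \<in> W" using insert.prems(2) wk a by (simp add: scalar_closed_def)
      moreover have "Q.pt (a \<odot>\<^bsub>M\<^esub> k) n \<in> ?H" using KD(2)[OF a wk(3)] by simp
      ultimately show ?thesis unfolding W'_def by blast
    qed
    show "Q.proj \<gamma> t \<in> W'" if g: "\<gamma> \<in> carrier \<Gamma>" for \<gamma>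
    proof -
      have "Q.proj \<gamma> t = Q.proj \<gamma> w \<oplus>\<^bsub>V\<^esub> Q.pt (homog_comp \<Gamma> M k \<gamma>) n"
        using additive_add[OF Q.proj_additive[OF g]] c n g wk(1) by (simp add: proj_pt)
      moreover have "Q.proj \<gamma> w \<in> W" using insert.prems(2) wk g by (simp add: scalar_closed_def)
      moreover have "Q.pt (homog_comp \<Gamma> M k \<gamma>) n \<in> ?H" using KD(3)[OF wk(3) g] by simp
      ultimately show ?thesis unfolding W'_def by blast
    qed
  qed
  have split: "span_over K (insert n F) \<subseteq> {h \<oplus>\<^bsub>V\<^esub> i | h i. h \<in> ?H \<and> i \<in> span_over K F}" (is "_ \<subseteq> ?Z")
    unfolding span_over_def[of K "insert n F"]
  proof (rule generate_add_subset[OF Q.MN.abelian_group_T _ subgroup_sum[OF Q.MN.abelian_group_T slice_subgroup[OF n] fsg]])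
    show "{Q.pt k s |k s. k \<in> K \<and> s \<in> insert n F} \<subseteq> ?Z"
    proof
      fix y assume "y \<in> {Q.pt k s |k s. k \<in> K \<and> s \<in> insert n F}"
      then obtain k s where y: "y = Q.pt k s" "k \<in> K" "s \<in> insert n F" by blast
      show "y \<in> ?Z"
      proof (cases "s = n")
        case True
        have "y = y \<oplus>\<^bsub>V\<^esub> \<zero>\<^bsub>V\<^esub>" using y True HD(1) by auto
        then show ?thesis using y True FD(2) by blast
      next
        case False
        then have "y \<in> span_over K F" using y unfolding span_over_def by (intro generate.incl) auto
        moreover from this have "y = \<zero>\<^bsub>V\<^esub> \<oplus>\<^bsub>V\<^esub> y" using FD(1) by auto
        ultimately show ?thesis using HD(2) by blast
      qed
    qed
  qed
  have "W' = carrier V"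
  proof (rule insert.IH[OF F W'_good])
    fix t assume "t \<in> carrier V"
    then obtain w i where wi: "w \<in> W" "i \<in> span_over K (insert n F)" "t = w \<oplus>\<^bsub>V\<^esub> i" using insert.prems(3) by blast
    then obtain h j where hj: "h \<in> ?H" "j \<in> span_over K F" "i = h \<oplus>\<^bsub>V\<^esub> j" using split by blast
    have "t = (w \<oplus>\<^bsub>V\<^esub> h) \<oplus>\<^bsub>V\<^esub> j"
      using wi hj WD(1) HD(1) FD(1) by (simp add: Q.MN.T.a_assoc subset_iff)
    moreover have "w \<oplus>\<^bsub>V\<^esub> h \<in> W'" using wi hj unfolding W'_def by blast
    ultimately show "\<exists>w\<in>W'. \<exists>i\<in>span_over K F. t = w \<oplus>\<^bsub>V\<^esub> i" using hj by blast
  qed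
  then have "\<exists>w\<in>W. \<exists>k\<in>K. t = w \<oplus>\<^bsub>V\<^esub> Q.pt k n" if "t \<in> carrier V" for t
    using that unfolding W'_def by blast
  then show ?case by (rule superfluous_slice[OF insert.prems(2) n])
qed

text \<open>
  If \<open>F\<close> generates \<open>N\<close> over \<open>R\<close>, then \<open>k \<otimes> (\<Sum> c\<^sub>s s) = \<Sum> (c\<^sub>s k) \<otimes> s\<close>, so \<open>K \<otimes> N\<close> is spanned by the slices
  over the finite set \<open>F\<close>.
\<close>

lemma superfluous_smash:
  assumes fg: "finitely_generated R (base_module B N)"
    and sub: "graded_submodule R \<Gamma> SA (span_over K (carrier N)) SM"
  shows "superfluous R \<Gamma> SA (span_over K (carrier N)) SM"
  unfolding superfluous_def
proof (intro conjI allI impI sub)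
  from fg obtain F where F: "finite F" "F \<subseteq> carrier N"
    "\<And>x. x \<in> carrier N \<Longrightarrow> \<exists>c\<in>F \<rightarrow> carrier R. x = (\<Oplus>\<^bsub>base_module B N\<^esub>s\<in>F. c s \<odot>\<^bsub>base_module B N\<^esub> s)"
    by (auto simp: finitely_generated_def)
  have fsg: "subgroup (span_over K F) (add_monoid V)"
    unfolding span_over_def by (rule subgroup_generate_add[OF Q.MN.abelian_group_T span_generators[OF F(2)]])
  have span: "span_over K (carrier N) \<subseteq> span_over K F"
    unfolding span_over_def[of K "carrier N"]
  proof (rule generate_add_subset[OF Q.MN.abelian_group_T _ fsg], rule)
    fix y assume "y \<in> {Q.pt k s |k s. k \<in> K \<and> s \<in> carrier N}"
    then obtain k x where y: "y = Q.pt k x" "k \<in> K" "x \<in> carrier N" by blast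
    from F(3)[OF y(3)] obtain c where c: "c \<in> F \<rightarrow> carrier R"
      and x: "x = (\<Oplus>\<^bsub>base_module B N\<^esub>s\<in>F. c s \<odot>\<^bsub>base_module B N\<^esub> s)" by blast
    have kc: "k \<in> carrier M" using K_carrier y by blast
    have cs: "c s \<odot>\<^bsub>base_module B N\<^esub> s \<in> carrier (base_module B N)" if "s \<in> F" for s
      using that c F(2) by (intro Q.MN.N.smult_closed) (auto simp: subset_iff)
    have "y = (\<Oplus>\<^bsub>V\<^esub>s\<in>F. Q.pt k (c s \<odot>\<^bsub>base_module B N\<^esub> s))"
      unfolding y(1) x
      by (rule additive_finsum[OF Q.MN.N.abelian_group_axioms Q.MN.abelian_group_T Q.pt_additive_right[OF kc] F(1) cs])
    also have "\<dots> \<in> span_over K F"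
    proof (rule Q.MN.T.finsum_in_subgroup[OF fsg F(1)])
      fix s assume s: "s \<in> F"
      have sc: "s \<in> carrier (base_module B N)" using F s by auto
      have r: "c s \<in> carrier R" using c s by auto
      have "Q.pt k (c s \<odot>\<^bsub>base_module B N\<^esub> s) = Q.pt (c s \<odot>\<^bsub>base_module A M\<^esub> k) s"
        using Q.MN.pt_smult[OF r _ sc, of k] kc by simp
      moreover have "c s \<odot>\<^bsub>base_module A M\<^esub> k \<in> K"
        using KD(2)[of "c s \<odot>\<^bsub>A\<^esub> \<one>\<^bsub>A\<^esub>" k] r y(2) by simp
      ultimately show "Q.pt k (c s \<odot>\<^bsub>base_module B N\<^esub> s) \<in> span_over K F"
        unfolding span_over_def using s by (intro generate.incl) auto
    qed
    finally show "y \<in> span_over K F" .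
  qed
  fix T' assume T': "graded_submodule R \<Gamma> SA T' SM" and cover: "span_over K (carrier N) <+>\<^bsub>SM\<^esub> T' = carrier SM"
  note TD = graded_submoduleD[OF graded_module_SM T']
  have sgT: "subgroup T' (add_monoid V)"
    by (rule subgroup_add_cong[OF abelian_group_SM Q.MN.abelian_group_T _ _ _ TD(1)]) (simp_all add: SM_simps)
  have Tc: "T' \<subseteq> carrier V" by (rule subgroup_addD(1)[OF Q.MN.abelian_group_T sgT])
  have "scalar_closed T'"
    unfolding scalar_closed_def
  proof (intro conjI ballI sgT)
    show "Q.op (S.MN.pt a \<one>\<^bsub>B\<^esub>) t \<in> T'" if "a \<in> carrier A" "t \<in> T'" for a t
      using TD(2)[of "S.MN.pt a \<one>\<^bsub>B\<^esub>" t] that left_pure_closed by (simp add: SA_simps SM_simps)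
    show "Q.proj \<gamma> t \<in> T'" if "\<gamma> \<in> carrier \<Gamma>" "t \<in> T'" for \<gamma> t
      using TD(3)[of t \<gamma>] homog_comp_SM[of t \<gamma>] that Tc by (auto simp: SM_simps)
  qed
  then have "T' = carrier V"
  proof (rule superfluous_finite[OF F(1,2)])
    fix t assume "t \<in> carrier V"
    then have "t \<in> span_over K (carrier N) <+>\<^bsub>SM\<^esub> T'" using cover by (simp add: SM_simps)
    then obtain i w where iw: "i \<in> span_over K (carrier N)" "w \<in> T'" "t = i \<oplus>\<^bsub>V\<^esub> w"
      by (auto simp: set_add_def' SM_simps)
    have ic: "i \<in> span_over K F" using iw span by blast
    then have "i \<in> carrier V" using subgroup_addD(1)[OF Q.MN.abelian_group_T fsg] by auto
    then have "t = w \<oplus>\<^bsub>V\<^esub> i" using iw Tc by (auto simp: Q.MN.T.a_comm)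
    then show "\<exists>w\<in>T'. \<exists>i\<in>span_over K F. t = w \<oplus>\<^bsub>V\<^esub> i" using iw ic by blast
  qed
  then show "T' = carrier SM" by (simp add: SM_simps)
qed

end

end

section \<open>Free modules and dual bases\<close>

text \<open>
  The free module on \<open>H\<close>, realised in the left summand of the type for which projectivity is assumed.
\<close>

definition free_module :: "'w \<Rightarrow> ('a, 'y) ring_scheme \<Rightarrow> 'm set \<Rightarrow> ('a, ('m \<Rightarrow> 'a) + 'd, 'w) module_scheme"
  where "free_module w A H = \<lparr>
    carrier = Inl ` {c. (\<forall>h. c h \<in> carrier A) \<and> (\<forall>h. h \<notin> H \<longrightarrow> c h = \<zero>\<^bsub>A\<^esub>) \<and> finite {h. c h \<noteq> \<zero>\<^bsub>A\<^esub>}},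
    monoid.mult = undefined, one = undefined,
    ring.zero = Inl (\<lambda>h. \<zero>\<^bsub>A\<^esub>), ring.add = (\<lambda>x y. Inl (\<lambda>h. projl x h \<oplus>\<^bsub>A\<^esub> projl y h)),
    smult = (\<lambda>a x. Inl (\<lambda>h. a \<otimes>\<^bsub>A\<^esub> projl x h)), \<dots> = w\<rparr>"

lemma free_module_simps [simp]:
  "\<zero>\<^bsub>free_module w A H\<^esub> = Inl (\<lambda>h. \<zero>\<^bsub>A\<^esub>)"
  "x \<oplus>\<^bsub>free_module w A H\<^esub> y = Inl (\<lambda>h. projl x h \<oplus>\<^bsub>A\<^esub> projl y h)"
  "a \<odot>\<^bsub>free_module w A H\<^esub> x = Inl (\<lambda>h. a \<otimes>\<^bsub>A\<^esub> projl x h)"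
  by (simp_all add: free_module_def)

lemma free_module_carrier:
  "x \<in> carrier (free_module w A H) \<longleftrightarrow> (\<exists>c. x = Inl c \<and> (\<forall>h. c h \<in> carrier A) \<and>
     (\<forall>h. h \<notin> H \<longrightarrow> c h = \<zero>\<^bsub>A\<^esub>) \<and> finite {h. c h \<noteq> \<zero>\<^bsub>A\<^esub>})"
  by (auto simp: free_module_def)

lemma free_module_coords:
  fixes A :: "('a, 'y) ring_scheme" and H :: "'m set" and x :: "('m \<Rightarrow> 'a) + 'd" and w :: 'w
  assumes "x \<in> carrier (free_module w A H)"
  shows "Inl (projl x) = x" "projl x h \<in> carrier A" "h \<notin> H \<Longrightarrow> projl x h = \<zero>\<^bsub>A\<^esub>"
    "finite {h. projl x h \<noteq> \<zero>\<^bsub>A\<^esub>}"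
  using assms by (auto simp: free_module_carrier)

lemma abelian_group_free:
  fixes A :: "('a, 'y) ring_scheme" and H :: "'m set"
  assumes "ring A" shows "abelian_group (free_module w A H :: ('a, ('m \<Rightarrow> 'a) + 'd, 'w) module_scheme)"
proof -
  let ?F = "free_module w A H :: ('a, ('m \<Rightarrow> 'a) + 'd, 'w) module_scheme"
  interpret ring A by fact
  show ?thesis
  proof (rule abelian_groupI)
    fix x y assume x: "x \<in> carrier ?F" and y: "y \<in> carrier ?F"
    note X = free_module_coords[OF x] and Y = free_module_coords[OF y]
    have "finite {h. projl x h \<oplus>\<^bsub>A\<^esub> projl y h \<noteq> \<zero>\<^bsub>A\<^esub>}"
      by (rule finite_subset[OF _ finite_UnI[OF X(4) Y(4)]]) auto
    then show "x \<oplus>\<^bsub>?F\<^esub> y \<in> carrier ?F"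
      using X Y by (simp add: free_module_carrier)
    show "x \<oplus>\<^bsub>?F\<^esub> y = y \<oplus>\<^bsub>?F\<^esub> x"
      using X(2) Y(2) by (simp add: a_comm)
    fix z assume z: "z \<in> carrier ?F"
    show "x \<oplus>\<^bsub>?F\<^esub> y \<oplus>\<^bsub>?F\<^esub> z = x \<oplus>\<^bsub>?F\<^esub> (y \<oplus>\<^bsub>?F\<^esub> z)"
      using X(2) Y(2) free_module_coords(2)[OF z] by (simp add: a_assoc)
  next
    show "\<zero>\<^bsub>?F\<^esub> \<in> carrier ?F" by (simp add: free_module_carrier)
  next
    fix x assume x: "x \<in> carrier ?F"
    note X = free_module_coords[OF x]
    show "\<zero>\<^bsub>?F\<^esub> \<oplus>\<^bsub>?F\<^esub> x = x" using X by simp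
    have "{h. \<ominus>\<^bsub>A\<^esub> projl x h \<noteq> \<zero>\<^bsub>A\<^esub>} \<subseteq> {h. projl x h \<noteq> \<zero>\<^bsub>A\<^esub>}" using X(2) by auto
    then have "finite {h. \<ominus>\<^bsub>A\<^esub> projl x h \<noteq> \<zero>\<^bsub>A\<^esub>}" by (rule finite_subset[OF _ X(4)])
    then show "\<exists>y\<in>carrier ?F. y \<oplus>\<^bsub>?F\<^esub> x = \<zero>\<^bsub>?F\<^esub>"
      using X by (intro bexI[of _ "Inl (\<lambda>h. \<ominus>\<^bsub>A\<^esub> projl x h)"]) (simp_all add: free_module_carrier l_neg)
  qed
qed

lemma left_module_free:
  assumes "ring A" shows "left_module A (free_module w A H)"
proof -
  interpret ring A by fact
  show ?thesis
  proof (intro left_module.intro left_module_axioms.intro assms abelian_group_free)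
    fix a x assume a: "a \<in> carrier A" and x: "x \<in> carrier (free_module w A H)"
    note X = free_module_coords[OF x]
    have "finite {h. a \<otimes>\<^bsub>A\<^esub> projl x h \<noteq> \<zero>\<^bsub>A\<^esub>}"
      by (rule finite_subset[OF _ X(4)]) (use a X in auto)
    then show "a \<odot>\<^bsub>free_module w A H\<^esub> x \<in> carrier (free_module w A H)"
      using a X by (simp add: free_module_carrier)
  qed (auto simp: free_module_carrier l_distr r_distr m_assoc)
qed

definition linear_combination :: "('a, 'm, 'z) module_scheme \<Rightarrow> 'm set \<Rightarrow> ('m \<Rightarrow> 'a) + 'd \<Rightarrow> 'm"
  where "linear_combination P H x = fsum P (\<lambda>h. projl x h \<odot>\<^bsub>P\<^esub> h) H"

definition single :: "('a, 'y) ring_scheme \<Rightarrow> 'm \<Rightarrow> 'a \<Rightarrow> ('m \<Rightarrow> 'a) + 'd"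
  where "single A h a = Inl (\<lambda>h'. if h' = h then a else \<zero>\<^bsub>A\<^esub>)"

lemma projl_single [simp]: "projl (single A h a) h' = (if h' = h then a else \<zero>\<^bsub>A\<^esub>)"
  by (simp add: single_def)

lemma single_carrier:
  assumes "ring A" "h \<in> H" "a \<in> carrier A"
  shows "single A h a \<in> carrier (free_module w A H)"
proof -
  interpret ring A by fact
  have "finite {h'. (if h' = h then a else \<zero>\<^bsub>A\<^esub>) \<noteq> \<zero>\<^bsub>A\<^esub>}"
    by (rule finite_subset[of _ "{h}"]) auto
  then show ?thesis using assms by (auto simp: free_module_carrier single_def)
qed

lemma single_additive:
  assumes "ring A" "h \<in> H"
  shows "additive_map A (free_module w A H) (single A h)"
proof (rule additiveI)
  interpret ring A by fact
  show "single A h x \<in> carrier (free_module w A H)" if "x \<in> carrier A" for x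
    by (rule single_carrier[OF assms that])
  show "single A h (x \<oplus>\<^bsub>A\<^esub> y) = single A h x \<oplus>\<^bsub>free_module w A H\<^esub> single A h y" for x y
    by (simp, simp add: single_def fun_eq_iff)
qed

lemma coordinate_additive: "additive_map (free_module w A H) A (\<lambda>x. projl x h)"
  by (rule additiveI) (auto simp: free_module_coords(2))

lemma (in left_module) scalar_additive: "x \<in> carrier M \<Longrightarrow> additive_map A M (\<lambda>a. a \<odot>\<^bsub>M\<^esub> x)"
  by (rule additiveI) (auto simp: smult_closed smult_l_distr)

lemma (in left_module) smult_additive: "a \<in> carrier A \<Longrightarrow> additive_map M M (\<lambda>x. a \<odot>\<^bsub>M\<^esub> x)"
  by (rule additiveI) (auto simp: smult_closed smult_r_distr)

lemma (in left_module) zero_smult: "x \<in> carrier M \<Longrightarrow> \<zero>\<^bsub>A\<^esub> \<odot>\<^bsub>M\<^esub> x = \<zero>\<^bsub>M\<^esub>"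
  by (rule additive_zero[OF A.abelian_group_axioms M.abelian_group_axioms scalar_additive])

lemma linear_combination_linear:
  assumes "left_module A P" "H \<subseteq> carrier P"
  shows "linear_map A (free_module w A H) P (linear_combination P H)"
proof (rule linear_mapI)
  interpret left_module A P by fact
  let ?F = "free_module w A H"
  have Hc: "h \<in> carrier P" if "h \<in> H" for h using assms(2) that by auto
  have fin: "finite {h \<in> H. projl x h \<odot>\<^bsub>P\<^esub> h \<noteq> \<zero>\<^bsub>P\<^esub>}" if x: "x \<in> carrier ?F" for x
    by (rule finite_subset[OF _ free_module_coords(4)[OF x]]) (use zero_smult Hc in auto)
  show "additive_map ?F P (linear_combination P H)"
    unfolding linear_combination_def[abs_def]
    by (rule additive_fsum_fun[OF M.abelian_group_axioms additive_comp[OF coordinate_additive scalar_additive] fin])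
      (use Hc in auto)
  fix a x assume a: "a \<in> carrier A" and x: "x \<in> carrier ?F"
  have "a \<odot>\<^bsub>P\<^esub> linear_combination P H x = fsum P (\<lambda>h. a \<odot>\<^bsub>P\<^esub> (projl x h \<odot>\<^bsub>P\<^esub> h)) H"
    unfolding linear_combination_def
    by (rule additive_fsum[OF M.abelian_group_axioms M.abelian_group_axioms smult_additive[OF a] fin[OF x]])
      (use Hc free_module_coords(2)[OF x] smult_closed in auto)
  also have "\<dots> = linear_combination P H (a \<odot>\<^bsub>?F\<^esub> x)"
    unfolding linear_combination_def
    by (rule M.fsum_cong) (use a Hc free_module_coords(2)[OF x] in \<open>auto simp: smult_closed smult_assoc\<close>)
  finally show "linear_combination P H (a \<odot>\<^bsub>?F\<^esub> x) = a \<odot>\<^bsub>P\<^esub> linear_combination P H x" by simp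
qed

lemma linear_combination_single:
  fixes P :: "('a, 'm, 'z) module_scheme"
  assumes "left_module A P" "H \<subseteq> carrier P" "h \<in> H" "a \<in> carrier A"
  shows "linear_combination P H (single A h a :: ('m \<Rightarrow> 'a) + 'd) = a \<odot>\<^bsub>P\<^esub> h"
proof -
  interpret left_module A P by fact
  let ?s = "single A h a :: ('m \<Rightarrow> 'a) + 'd"
  have "fsum P (\<lambda>h'. projl ?s h' \<odot>\<^bsub>P\<^esub> h') H = projl ?s h \<odot>\<^bsub>P\<^esub> h"
    by (rule M.fsum_single[OF assms(3)]) (use assms(2-4) zero_smult smult_closed in \<open>auto simp: subset_iff\<close>)
  then show ?thesis by (simp add: linear_combination_def)
qed

lemma free_module_expansion:
  fixes A :: "('a, 'y) ring_scheme" and H :: "'m set" and x :: "('m \<Rightarrow> 'a) + 'd" and w :: 'w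
  assumes "ring A" "x \<in> carrier (free_module w A H)"
  shows "x = fsum (free_module w A H) (\<lambda>h. single A h (projl x h)) H"
proof -
  interpret ring A by fact
  let ?F = "free_module w A H :: ('a, ('m \<Rightarrow> 'a) + 'd, 'w) module_scheme"
  let ?g = "single A :: 'm \<Rightarrow> 'a \<Rightarrow> ('m \<Rightarrow> 'a) + 'd"
  note ab = abelian_group_free[OF assms(1), where w = w and H = H and ?'d = 'd]
  note c = free_module_coords[OF assms(2)]
  let ?s = "fsum ?F (\<lambda>h. ?g h (projl x h)) H"
  have sc: "?g h (projl x h) \<in> carrier ?F" if "h \<in> H" for h
    by (rule single_carrier[OF assms(1) that c(2)])
  have sF: "?s \<in> carrier ?F" by (rule abelian_group.fsum_closed[OF ab sc])
  have fin: "finite {h \<in> H. ?g h (projl x h) \<noteq> \<zero>\<^bsub>?F\<^esub>}"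
    by (rule finite_subset[OF _ c(4)]) (auto simp: single_def)
  have "projl ?s h' = projl x h'" for h'
  proof -
    have e: "projl ?s h' = fsum A (\<lambda>h. projl (?g h (projl x h)) h') H"
      by (rule additive_fsum[OF ab abelian_group_axioms coordinate_additive fin sc])
    show ?thesis
    proof (cases "h' \<in> H")
      case True
      have "fsum A (\<lambda>h. projl (?g h (projl x h)) h') H = projl (?g h' (projl x h')) h'"
        by (rule fsum_single[OF True]) (use c(2) in auto)
      then show ?thesis using e by simp
    next
      case False
      then have "fsum A (\<lambda>h. projl (?g h (projl x h)) h') H = \<zero>\<^bsub>A\<^esub>"
        by (intro fsum_zero) auto
      then show ?thesis using e c(3)[OF False] by simp
    qed
  qed
  then have "projl ?s = projl x" by auto
  then show ?thesis using free_module_coords(1)[OF sF] c(1) by metis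
qed

definition dual_basis :: "('a, 'y) ring_scheme \<Rightarrow> ('a, 'm, 'z) module_scheme \<Rightarrow> 'm set \<Rightarrow> ('m \<Rightarrow> 'm \<Rightarrow> 'a) \<Rightarrow> bool"
  where "dual_basis A P H c \<longleftrightarrow> H \<subseteq> carrier P \<and>
    (\<forall>x\<in>carrier P. \<forall>h. c x h \<in> carrier A) \<and> (\<forall>x\<in>carrier P. finite {h. c x h \<noteq> \<zero>\<^bsub>A\<^esub>}) \<and>
    (\<forall>h. additive_map P A (\<lambda>x. c x h)) \<and>
    (\<forall>a\<in>carrier A. \<forall>x\<in>carrier P. \<forall>h. c (a \<odot>\<^bsub>P\<^esub> x) h = a \<otimes>\<^bsub>A\<^esub> c x h) \<and>
    (\<forall>x\<in>carrier P. x = fsum P (\<lambda>h. c x h \<odot>\<^bsub>P\<^esub> h) H)"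

text \<open>
  A section of the canonical map from the free module on \<open>H\<close> is the same as a family of coordinates.
\<close>

lemma section_dual_basis:
  assumes "left_module A P" "H \<subseteq> carrier P" and s: "linear_map A P (free_module w A H) s"
    and sec: "\<And>x. x \<in> carrier P \<Longrightarrow> linear_combination P H (s x) = x"
  shows "dual_basis A P H (\<lambda>x. projl (s x))"
  unfolding dual_basis_def
proof (intro conjI ballI allI assms(2))
  interpret left_module A P by fact
  fix x assume x: "x \<in> carrier P"
  note c = free_module_coords[OF linear_map_closed[OF s x]]
  show "projl (s x) h \<in> carrier A" for h by (rule c(2))
  show "finite {h. projl (s x) h \<noteq> \<zero>\<^bsub>A\<^esub>}" by (rule c(4))
  show "x = fsum P (\<lambda>h. projl (s x) h \<odot>\<^bsub>P\<^esub> h) H"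
    using sec[OF x] by (simp add: linear_combination_def)
  show "projl (s (a \<odot>\<^bsub>P\<^esub> x)) h = a \<otimes>\<^bsub>A\<^esub> projl (s x) h" if "a \<in> carrier A" for a h
    using linear_map_smult[OF s that x] by simp
next
  show "additive_map P A (\<lambda>x. projl (s x) h)" for h
    by (rule additive_comp[OF linear_map_additive[OF s] coordinate_additive])
qed

text \<open>
  The test type contains the free module on the elements of \<open>P\<close> and a copy of \<open>P\<close>. Lifting the identity of
  \<open>P\<close> along the canonical surjection between them splits it.
\<close>

lemma projective_dual_basis:
  fixes P :: "('a, 'm, 'z) module_scheme"
  assumes "projective_module TYPE(('a, 'm) test) A P"
  shows "\<exists>c. dual_basis A P (carrier P) c"
proof -
  have P: "left_module A P" using assms by (simp add: projective_module_def)
  interpret left_module A P by (rule P)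
  define E :: "('a, ('a, 'm) test) module" where "E = free_module () A (carrier P)"
  define F :: "('a, ('a, 'm) test) module" where "F = copy_module () P"
  define g :: "('a, 'm) test \<Rightarrow> ('a, 'm) test" where "g = (\<lambda>x. Inr (linear_combination P (carrier P) x))"
  have lc: "linear_map A E P (linear_combination P (carrier P))"
    unfolding E_def by (rule linear_combination_linear[OF P]) simp
  have E: "left_module A E" unfolding E_def by (rule left_module_free[OF A.ring_axioms])
  have F: "left_module A F" unfolding F_def by (rule left_module_copy[OF P])
  have f: "linear_map A P F Inr" unfolding F_def by (rule linear_map_Inr)
  have g: "linear_map A E F g" unfolding g_def by (rule linear_map_comp[OF lc f])
  have "Inr x \<in> g ` carrier E" if x: "x \<in> carrier P" for x
  proof (rule image_eqI)
    show "single A x \<one>\<^bsub>A\<^esub> \<in> carrier E" unfolding E_def by (rule single_carrier[OF A.ring_axioms x]) simp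
    show "Inr x = g (single A x \<one>\<^bsub>A\<^esub>)"
      using linear_combination_single[OF P subset_refl x A.one_closed, where ?'d = 'm] x by (simp add: g_def smult_one)
  qed
  then have "carrier F \<subseteq> g ` carrier E" by (auto simp: F_def)
  moreover have "g ` carrier E \<subseteq> carrier F" using linear_map_closed[OF g] by auto
  ultimately have surj: "g ` carrier E = carrier F" by (rule subset_antisym[rotated])
  obtain s where s: "linear_map A P E s" "\<And>p. p \<in> carrier P \<Longrightarrow> g (s p) = Inr p"
    using assms E F g surj f unfolding projective_module_def by blast
  have "dual_basis A P (carrier P) (\<lambda>x. projl (s x))"
    by (rule section_dual_basis[OF P subset_refl s(1)[unfolded E_def]]) (use s(2) in \<open>simp add: g_def\<close>)
  then show ?thesis by blast
qed

context graded_algebra begin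

text \<open>
  The elements \<open>a\<close> for which \<open>a h\<close> has degree \<open>\<gamma>\<close> when \<open>h\<close> is a generator of degree \<open>d\<close>. As \<open>\<Gamma>\<close> need not be
  cancellative, several degrees \<open>\<alpha>\<close> may satisfy \<open>\<alpha> d = \<gamma>\<close>, and this is the sum of their parts.
\<close>

definition coarse_part :: "'g \<Rightarrow> 'g \<Rightarrow> 'a set"
  where "coarse_part d \<gamma> = {a \<in> carrier A. \<forall>\<alpha>\<in>carrier \<Gamma>. homog_comp \<Gamma> A a \<alpha> \<noteq> \<zero>\<^bsub>A\<^esub> \<longrightarrow> \<alpha> \<otimes>\<^bsub>\<Gamma>\<^esub> d = \<gamma>}"

lemma abelian_A: "abelian_group A" ..

lemma ring_A: "ring A" ..

lemma coarse_part_subset: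
  assumes "subgroup W (add_monoid A)" "\<And>\<epsilon>. \<epsilon> \<in> carrier \<Gamma> \<Longrightarrow> \<epsilon> \<otimes>\<^bsub>\<Gamma>\<^esub> d = \<gamma> \<Longrightarrow> part A \<epsilon> \<subseteq> W"
  shows "coarse_part d \<gamma> \<subseteq> W"
proof
  interpret G: graded_group \<Gamma> A by (rule graded_group_A)
  fix a assume a: "a \<in> coarse_part d \<gamma>"
  then have ac: "a \<in> carrier A" by (simp add: coarse_part_def)
  have "fsum A (homog_comp \<Gamma> A a) (carrier \<Gamma>) \<in> W"
  proof (rule abelian_group.fsum_in_subgroup[OF abelian_A assms(1)])
    fix \<epsilon> assume e: "\<epsilon> \<in> carrier \<Gamma>"
    show "homog_comp \<Gamma> A a \<epsilon> \<in> W"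
      using assms(2)[OF e] a e G.comp_part[OF ac e] subgroup_addD(2)[OF abelian_A assms(1)]
      by (cases "homog_comp \<Gamma> A a \<epsilon> = \<zero>\<^bsub>A\<^esub>") (auto simp: coarse_part_def)
  qed
  then show "a \<in> W" by (simp add: G.fsum_comp[OF ac])
qed

lemma coarse_part_subgroup: "subgroup (coarse_part d \<gamma>) (add_monoid A)"
proof (rule subgroup_addI[OF abelian_A])
  interpret G: graded_group \<Gamma> A by (rule graded_group_A)
  have z: "homog_comp \<Gamma> A \<zero>\<^bsub>A\<^esub> \<alpha> = \<zero>\<^bsub>A\<^esub>" if "\<alpha> \<in> carrier \<Gamma>" for \<alpha>
    by (rule additive_zero[OF abelian_A abelian_A G.comp_additive[OF that]])
  then show "\<zero>\<^bsub>A\<^esub> \<in> coarse_part d \<gamma>" by (auto simp: coarse_part_def)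
  show "coarse_part d \<gamma> \<subseteq> carrier A" by (auto simp: coarse_part_def)
  show "x \<oplus>\<^bsub>A\<^esub> y \<in> coarse_part d \<gamma>" if x: "x \<in> coarse_part d \<gamma>" and y: "y \<in> coarse_part d \<gamma>" for x y
  proof -
    have c: "x \<in> carrier A" "y \<in> carrier A" using x y by (auto simp: coarse_part_def)
    have "\<alpha> \<otimes>\<^bsub>\<Gamma>\<^esub> d = \<gamma>" if a: "\<alpha> \<in> carrier \<Gamma>" and n: "homog_comp \<Gamma> A (x \<oplus>\<^bsub>A\<^esub> y) \<alpha> \<noteq> \<zero>\<^bsub>A\<^esub>" for \<alpha>
    proof -
      have "homog_comp \<Gamma> A x \<alpha> \<noteq> \<zero>\<^bsub>A\<^esub> \<or> homog_comp \<Gamma> A y \<alpha> \<noteq> \<zero>\<^bsub>A\<^esub>"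
        using n c a by (auto simp: G.comp_add)
      then show ?thesis using x y a by (auto simp: coarse_part_def)
    qed
    then show ?thesis using c by (auto simp: coarse_part_def)
  qed
  show "\<ominus>\<^bsub>A\<^esub> x \<in> coarse_part d \<gamma>" if x: "x \<in> coarse_part d \<gamma>" for x
    using x additive_minus[OF abelian_A abelian_A G.comp_additive, of _ x]
    by (auto simp: coarse_part_def)
qed

lemma part_coarse:
  assumes "\<epsilon> \<in> carrier \<Gamma>" "a \<in> part A \<epsilon>" "\<epsilon> \<otimes>\<^bsub>\<Gamma>\<^esub> d = \<gamma>"
  shows "a \<in> coarse_part d \<gamma>"
proof -
  interpret G: graded_group \<Gamma> A by (rule graded_group_A)
  show ?thesis using assms G.part_carrier[OF assms(1,2)] G.comp_homogeneous[OF assms(1,2)]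
    by (auto simp: coarse_part_def split: if_splits)
qed

definition coarse_proj :: "'g \<Rightarrow> 'g \<Rightarrow> 'a \<Rightarrow> 'a"
  where "coarse_proj d \<gamma> a = (\<Oplus>\<^bsub>A\<^esub>\<alpha>\<in>degrees \<Gamma> A a.
    (\<lambda>x. if \<alpha> \<otimes>\<^bsub>\<Gamma>\<^esub> d = \<gamma> then x else \<zero>\<^bsub>A\<^esub>) (homog_comp \<Gamma> A a \<alpha>))"

lemma coarse_summand: "additive_map A A (\<lambda>x. if \<alpha> \<otimes>\<^bsub>\<Gamma>\<^esub> d = \<gamma> then x else \<zero>\<^bsub>A\<^esub>)"
  by (cases "\<alpha> \<otimes>\<^bsub>\<Gamma>\<^esub> d = \<gamma>") (simp_all add: additive_id additive_const_zero[OF abelian_A])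

lemma coarse_proj_additive: "additive_map A A (coarse_proj d \<gamma>)"
  unfolding coarse_proj_def[abs_def]
  by (rule graded_group.degreewise_additive[OF graded_group_A abelian_A coarse_summand])

lemma coarse_proj_homogeneous:
  "\<epsilon> \<in> carrier \<Gamma> \<Longrightarrow> a \<in> part A \<epsilon> \<Longrightarrow> coarse_proj d \<gamma> a = (if \<epsilon> \<otimes>\<^bsub>\<Gamma>\<^esub> d = \<gamma> then a else \<zero>\<^bsub>A\<^esub>)"
  unfolding coarse_proj_def
  by (rule graded_group.degreewise_homogeneous[OF graded_group_A abelian_A coarse_summand])

lemma coarse_proj_in:
  assumes "a \<in> carrier A" shows "coarse_proj d \<gamma> a \<in> coarse_part d \<gamma>"
proof -
  interpret G: graded_group \<Gamma> A by (rule graded_group_A)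
  have "{a \<in> carrier A. coarse_proj d \<gamma> a \<in> coarse_part d \<gamma>} = carrier A"
    by (rule G.subgroup_of_parts[OF subgroup_vimage[OF abelian_A abelian_A coarse_proj_additive coarse_part_subgroup]])
      (use subgroup_addD(2)[OF abelian_A coarse_part_subgroup] G.part_carrier in
        \<open>auto simp: coarse_proj_homogeneous intro: part_coarse\<close>)
  then show ?thesis using assms by auto
qed

lemma coarse_proj_on_part:
  assumes "a \<in> coarse_part d \<delta>" shows "coarse_proj d \<gamma> a = (if \<delta> = \<gamma> then a else \<zero>\<^bsub>A\<^esub>)"
proof -
  interpret G: graded_group \<Gamma> A by (rule graded_group_A)
  have ad: "additive_map A A (\<lambda>x. if \<delta> = \<gamma> then x else \<zero>\<^bsub>A\<^esub>)"
    by (cases "\<delta> = \<gamma>") (simp_all add: additive_id additive_const_zero[OF abelian_A])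
  have "subgroup {x \<in> carrier A. coarse_proj d \<gamma> x = (if \<delta> = \<gamma> then x else \<zero>\<^bsub>A\<^esub>)} (add_monoid A)"
    by (rule subgroup_addI[OF abelian_A])
      (use additive_zero[OF abelian_A abelian_A coarse_proj_additive] additive_add[OF coarse_proj_additive]
        additive_minus[OF abelian_A abelian_A coarse_proj_additive] in \<open>auto\<close>)
  then have "coarse_part d \<delta> \<subseteq> {x \<in> carrier A. coarse_proj d \<gamma> x = (if \<delta> = \<gamma> then x else \<zero>\<^bsub>A\<^esub>)}"
    by (rule coarse_part_subset) (use G.part_carrier in \<open>auto simp: coarse_proj_homogeneous\<close>)
  then show ?thesis using assms by auto
qed

definition free_part :: "'m set \<Rightarrow> ('m \<Rightarrow> 'g) \<Rightarrow> 'g \<Rightarrow> (('m \<Rightarrow> 'a) + 'd) set"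
  where "free_part H dg \<gamma> = {x \<in> carrier (free_module () A H). \<forall>h\<in>H. projl x h \<in> coarse_part (dg h) \<gamma>}"

definition graded_free :: "'m set \<Rightarrow> ('m \<Rightarrow> 'g) \<Rightarrow> ('a, ('m \<Rightarrow> 'a) + 'd, 'g) graded"
  where "graded_free H dg = free_module (graded.fields (free_part H dg)) A H"

lemma graded_free_part: "part (graded_free H dg) = free_part H dg"
  by (simp add: graded_free_def free_module_def graded.defs)

lemma free_carrier_cong: "carrier (free_module w A H) = carrier (free_module w' A H)"
  by (simp add: free_module_def)

lemma free_part_iff:
  fixes x :: "('m \<Rightarrow> 'a) + 'd"
  shows "x \<in> free_part H dg \<gamma> \<longleftrightarrow>
    x \<in> carrier (graded_free H dg) \<and> (\<forall>h\<in>H. projl x h \<in> coarse_part (dg h) \<gamma>)"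
proof -
  have "carrier (graded_free H dg :: ('a, ('m \<Rightarrow> 'a) + 'd, 'g) graded) =
      carrier (free_module () A H :: ('a, ('m \<Rightarrow> 'a) + 'd) module)"
    unfolding graded_free_def by (rule free_carrier_cong)
  then show ?thesis by (simp add: free_part_def)
qed

text \<open>
  The free module graded by the degrees of its generators: the projections are taken coordinatewise, from
  the grading of \<open>A\<close> that is coarsened along \<open>\<alpha> \<mapsto> \<alpha> d\<close>.
\<close>

lemma graded_module_free:
  fixes H :: "'m set"
  assumes dg: "\<And>h. h \<in> H \<Longrightarrow> dg h \<in> carrier \<Gamma>"
  shows "graded_module R \<Gamma> A (graded_free H dg :: ('a, ('m \<Rightarrow> 'a) + 'd, 'g) graded)"
proof (rule graded_moduleI[OF graded_algebra_axioms])
  interpret G: graded_group \<Gamma> A by (rule graded_group_A)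
  let ?F = "graded_free H dg :: ('a, ('m \<Rightarrow> 'a) + 'd, 'g) graded"
  show lm: "left_module A ?F" unfolding graded_free_def by (rule left_module_free[OF ring_A])
  interpret F: left_module A ?F by (rule lm)
  have ab: "abelian_group ?F" ..
  have ops: "\<zero>\<^bsub>?F\<^esub> = Inl (\<lambda>h. \<zero>\<^bsub>A\<^esub>)" "x \<oplus>\<^bsub>?F\<^esub> y = Inl (\<lambda>h. projl x h \<oplus>\<^bsub>A\<^esub> projl y h)"
    "a \<odot>\<^bsub>?F\<^esub> x = Inl (\<lambda>h. a \<otimes>\<^bsub>A\<^esub> projl x h)" for a x y by (simp_all add: graded_free_def)
  have coord: "additive_map ?F A (\<lambda>x. projl x h)" for h unfolding graded_free_def by (rule coordinate_additive)
  note fc = free_module_coords[where ?'d = 'd and A = A and H = H and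
      w = "graded.fields (free_part H dg :: 'g \<Rightarrow> (('m \<Rightarrow> 'a) + 'd) set)", folded graded_free_def]
  define \<pi> where "\<pi> = (\<lambda>\<gamma> (x :: ('m \<Rightarrow> 'a) + 'd). Inl (\<lambda>h. coarse_proj (dg h) \<gamma> (projl x h)) :: ('m \<Rightarrow> 'a) + 'd)"
  have cz: "coarse_proj d \<gamma> \<zero>\<^bsub>A\<^esub> = \<zero>\<^bsub>A\<^esub>" for d \<gamma>
    by (rule additive_zero[OF abelian_A abelian_A coarse_proj_additive])
  have \<pi>c: "\<pi> \<gamma> x \<in> carrier ?F" if x: "x \<in> carrier ?F" for \<gamma> x
  proof -
    note X = fc[OF x]
    have "finite {h. coarse_proj (dg h) \<gamma> (projl x h) \<noteq> \<zero>\<^bsub>A\<^esub>}"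
      by (rule finite_subset[OF _ X(4)]) (auto simp: cz)
    then show ?thesis using X(3) additive_closed[OF coarse_proj_additive X(2)]
      by (auto simp: \<pi>_def graded_free_def free_module_carrier cz)
  qed
  show "graded_group \<Gamma> ?F"
  proof (rule projections_direct_sum(1)[OF ab, where \<pi> = \<pi>])
    fix \<gamma> assume \<gamma>: "\<gamma> \<in> carrier \<Gamma>"
    have "part ?F \<gamma> = (\<Inter>h\<in>H. {x \<in> carrier ?F. projl x h \<in> coarse_part (dg h) \<gamma>}) \<inter> carrier ?F"
      by (auto simp: graded_free_part free_part_iff)
    also have "subgroup \<dots> (add_monoid ?F)"
    proof (rule subgroup_addI[OF ab])
      have sv: "subgroup {x \<in> carrier ?F. projl x h \<in> coarse_part (dg h) \<gamma>} (add_monoid ?F)" for h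
        by (rule subgroup_vimage[OF ab abelian_A coord coarse_part_subgroup])
      show "\<zero>\<^bsub>?F\<^esub> \<in> (\<Inter>h\<in>H. {x \<in> carrier ?F. projl x h \<in> coarse_part (dg h) \<gamma>}) \<inter> carrier ?F"
        by (intro IntI INT_I subgroup_addD(2)[OF ab sv] F.M.zero_closed)
      show "x \<oplus>\<^bsub>?F\<^esub> y \<in> (\<Inter>h\<in>H. {x \<in> carrier ?F. projl x h \<in> coarse_part (dg h) \<gamma>}) \<inter> carrier ?F"
        if "x \<in> (\<Inter>h\<in>H. {x \<in> carrier ?F. projl x h \<in> coarse_part (dg h) \<gamma>}) \<inter> carrier ?F"
          "y \<in> (\<Inter>h\<in>H. {x \<in> carrier ?F. projl x h \<in> coarse_part (dg h) \<gamma>}) \<inter> carrier ?F" for x y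
        using that by (intro IntI INT_I subgroup_addD(3)[OF ab sv] F.M.a_closed) auto
      show "\<ominus>\<^bsub>?F\<^esub> x \<in> (\<Inter>h\<in>H. {x \<in> carrier ?F. projl x h \<in> coarse_part (dg h) \<gamma>}) \<inter> carrier ?F"
        if "x \<in> (\<Inter>h\<in>H. {x \<in> carrier ?F. projl x h \<in> coarse_part (dg h) \<gamma>}) \<inter> carrier ?F" for x
        using that by (intro IntI INT_I subgroup_addD(4)[OF ab sv] F.M.a_inv_closed) auto
    qed auto
    finally show "subgroup (part ?F \<gamma>) (add_monoid ?F)" .
    show "additive_map ?F ?F (\<pi> \<gamma>)"
    proof (rule additiveI[OF \<pi>c])
      fix x y assume "x \<in> carrier ?F" "y \<in> carrier ?F"
      then show "\<pi> \<gamma> (x \<oplus>\<^bsub>?F\<^esub> y) = \<pi> \<gamma> x \<oplus>\<^bsub>?F\<^esub> \<pi> \<gamma> y"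
        using fc(2) by (simp add: ops \<pi>_def additive_add[OF coarse_proj_additive])
    qed
    show "\<pi> \<gamma> x \<in> part ?F \<gamma>" if x: "x \<in> carrier ?F" for x
      using \<pi>c[OF x] coarse_proj_in[OF fc(2)[OF x]] by (simp add: graded_free_part free_part_iff \<pi>_def)
    have on: "\<pi> \<gamma> x = (if \<delta> = \<gamma> then x else \<zero>\<^bsub>?F\<^esub>)" if x: "x \<in> part ?F \<delta>" for x \<delta>
    proof -
      have xc: "x \<in> carrier ?F" and xp: "\<And>h. h \<in> H \<Longrightarrow> projl x h \<in> coarse_part (dg h) \<delta>"
        using x by (auto simp: graded_free_part free_part_iff)
      have "coarse_proj (dg h) \<gamma> (projl x h) = (if \<delta> = \<gamma> then projl x h else \<zero>\<^bsub>A\<^esub>)" for h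
        using coarse_proj_on_part[OF xp] fc(3)[OF xc] by (cases "h \<in> H") (auto simp: cz)
      then show ?thesis using fc(1)[OF xc] by (simp add: \<pi>_def ops)
    qed
    show "\<pi> \<gamma> x = x" if "x \<in> part ?F \<gamma>" for x using on[OF that] by simp
    show "\<pi> \<gamma> x = \<zero>\<^bsub>?F\<^esub>" if "\<delta> \<in> carrier \<Gamma>" "\<delta> \<noteq> \<gamma>" "x \<in> part ?F \<delta>" for \<delta> x
      using on[OF that(3)] that(2) by simp
  next
    fix W assume W: "subgroup W (add_monoid ?F)" and pW: "\<And>\<gamma>. \<gamma> \<in> carrier \<Gamma> \<Longrightarrow> part ?F \<gamma> \<subseteq> W"
    have sW: "single A h a \<in> W" if h: "h \<in> H" and a: "a \<in> carrier A" for h a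
    proof -
      have sa: "additive_map A ?F (single A h)" unfolding graded_free_def by (rule single_additive[OF ring_A h])
      have "{a \<in> carrier A. single A h a \<in> W} = carrier A"
      proof (rule G.subgroup_of_parts[OF subgroup_vimage[OF abelian_A ab sa W]], rule)
        fix \<alpha> a assume \<alpha>: "\<alpha> \<in> carrier \<Gamma>" and a: "a \<in> part A \<alpha>"
        have ac: "a \<in> carrier A" by (rule G.part_carrier[OF \<alpha> a])
        have "single A h a \<in> part ?F (\<alpha> \<otimes>\<^bsub>\<Gamma>\<^esub> dg h)"
          using additive_closed[OF sa ac] part_coarse[OF \<alpha> a refl] subgroup_addD(2)[OF abelian_A coarse_part_subgroup]
          by (auto simp: graded_free_part free_part_iff)
        then show "a \<in> {a \<in> carrier A. single A h a \<in> W}" using pW[of "\<alpha> \<otimes>\<^bsub>\<Gamma>\<^esub> dg h"] \<alpha> dg[OF h] ac by auto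
      qed
      then show ?thesis using a by auto
    qed
    show "carrier ?F \<subseteq> W"
    proof
      fix x assume x: "x \<in> carrier ?F"
      have "x = fsum ?F (\<lambda>h. single A h (projl x h)) H"
        using free_module_expansion[OF ring_A, of x "graded.fields (free_part H dg)" H] x by (simp add: graded_free_def)
      also have "\<dots> \<in> W" by (rule F.M.fsum_in_subgroup[OF W]) (use sW fc(2)[OF x] in auto)
      finally show "x \<in> W" .
    qed
  qed
  fix \<alpha> \<beta> a x assume \<alpha>: "\<alpha> \<in> carrier \<Gamma>" and \<beta>: "\<beta> \<in> carrier \<Gamma>" and a: "a \<in> part A \<alpha>" and x: "x \<in> part ?F \<beta>"
  have ac: "a \<in> carrier A" by (rule G.part_carrier[OF \<alpha> a])
  have xc: "x \<in> carrier ?F" using x by (auto simp: graded_free_part free_part_iff)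
  have "a \<otimes>\<^bsub>A\<^esub> projl x h \<in> coarse_part (dg h) (\<alpha> \<otimes>\<^bsub>\<Gamma>\<^esub> \<beta>)" if h: "h \<in> H" for h
  proof -
    have am: "additive_map A A (\<lambda>y. a \<otimes>\<^bsub>A\<^esub> y)" by (rule additiveI) (use ac in \<open>auto simp: r_distr\<close>)
    have "coarse_part (dg h) \<beta> \<subseteq> {y \<in> carrier A. a \<otimes>\<^bsub>A\<^esub> y \<in> coarse_part (dg h) (\<alpha> \<otimes>\<^bsub>\<Gamma>\<^esub> \<beta>)}"
    proof (rule coarse_part_subset[OF subgroup_vimage[OF abelian_A abelian_A am coarse_part_subgroup]], rule)
      fix \<epsilon> y assume e: "\<epsilon> \<in> carrier \<Gamma>" and ed: "\<epsilon> \<otimes>\<^bsub>\<Gamma>\<^esub> dg h = \<beta>" and y: "y \<in> part A \<epsilon>"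
      have "a \<otimes>\<^bsub>A\<^esub> y \<in> part A (\<alpha> \<otimes>\<^bsub>\<Gamma>\<^esub> \<epsilon>)" by (rule part_mult[OF \<alpha> e a y])
      then show "y \<in> {y \<in> carrier A. a \<otimes>\<^bsub>A\<^esub> y \<in> coarse_part (dg h) (\<alpha> \<otimes>\<^bsub>\<Gamma>\<^esub> \<beta>)}"
        using \<alpha> e ed dg[OF h] G.part_carrier[OF e y]
        by (auto simp: \<Gamma>.m_assoc intro: part_coarse[of "\<alpha> \<otimes>\<^bsub>\<Gamma>\<^esub> \<epsilon>"])
    qed
    then show ?thesis using x h by (auto simp: graded_free_part free_part_iff)
  qed
  then show "a \<odot>\<^bsub>?F\<^esub> x \<in> part ?F (\<alpha> \<otimes>\<^bsub>\<Gamma>\<^esub> \<beta>)"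
    using F.smult_closed[OF ac xc] by (simp add: graded_free_part free_part_iff ops)
qed

end

section \<open>Projectivity of \<open>M \<ltimes> N\<close>\<close>

lemma dual_basisD:
  assumes "dual_basis A P H c"
  shows "H \<subseteq> carrier P" "\<And>x h. x \<in> carrier P \<Longrightarrow> c x h \<in> carrier A"
    "\<And>x. x \<in> carrier P \<Longrightarrow> finite {h. c x h \<noteq> \<zero>\<^bsub>A\<^esub>}" "\<And>h. additive_map P A (\<lambda>x. c x h)"
    "\<And>a x h. a \<in> carrier A \<Longrightarrow> x \<in> carrier P \<Longrightarrow> c (a \<odot>\<^bsub>P\<^esub> x) h = a \<otimes>\<^bsub>A\<^esub> c x h"
    "\<And>x. x \<in> carrier P \<Longrightarrow> fsum P (\<lambda>h. c x h \<odot>\<^bsub>P\<^esub> h) H = x"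
  using assms by (auto simp: dual_basis_def)

text \<open>
  The condition on \<open>c x h\<close> says that the coordinates form a graded map to the free module.
\<close>

definition (in graded_algebra) graded_dual_basis ::
  "('a, 'm, 'g, 'w) graded_scheme \<Rightarrow> 'm set \<Rightarrow> ('m \<Rightarrow> 'g) \<Rightarrow> ('m \<Rightarrow> 'm \<Rightarrow> 'a) \<Rightarrow> bool"
  where "graded_dual_basis P H dg c \<longleftrightarrow> dual_basis A P H c \<and>
    (\<forall>h\<in>H. dg h \<in> carrier \<Gamma> \<and> h \<in> part P (dg h)) \<and>
    (\<forall>\<gamma>\<in>carrier \<Gamma>. \<forall>x\<in>part P \<gamma>. \<forall>h\<in>H. c x h \<in> coarse_part (dg h) \<gamma>)"

lemma graded_module_copy:
  fixes P :: "('a, 'm, 'g, 'z) graded_scheme"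
  assumes "graded_module R \<Gamma> A P"
  shows "graded_module R \<Gamma> A (copy_module (graded.fields (\<lambda>\<gamma>. Inr ` part P \<gamma>)) P :: ('a, 'c + 'm, 'g) graded)"
proof -
  interpret P: graded_module R \<Gamma> A P by fact
  interpret G: graded_group \<Gamma> P by (rule P.graded_group_M)
  let ?F = "copy_module (graded.fields (\<lambda>\<gamma>. Inr ` part P \<gamma>)) P :: ('a, 'c + 'm, 'g) graded"
  have pF: "part ?F \<gamma> = Inr ` part P \<gamma>" for \<gamma> by (simp add: copy_module_def graded.defs)
  have ab: "abelian_group ?F" by (rule abelian_group_copy[OF P.M.abelian_group_axioms])
  have i: "additive_map P ?F Inr" by (rule linear_map_additive[OF linear_map_Inr])
  have j: "additive_map ?F P projr" by (rule linear_map_additive[OF linear_map_projr])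
  show ?thesis
  proof (rule graded_moduleI)
    show "graded_algebra R \<Gamma> A" ..
    show "left_module A ?F" by (rule left_module_copy) unfold_locales
    show "graded_group \<Gamma> ?F"
    proof (rule projections_direct_sum(1)[OF ab, where \<pi> = "\<lambda>\<gamma> x. Inr (homog_comp \<Gamma> P (projr x) \<gamma>)"])
      fix \<gamma> assume \<gamma>: "\<gamma> \<in> carrier \<Gamma>"
      show "subgroup (part ?F \<gamma>) (add_monoid ?F)"
        unfolding pF by (rule subgroup_image[OF P.M.abelian_group_axioms ab i G.part_subgroup[OF \<gamma>]])
      show "additive_map ?F ?F (\<lambda>x. Inr (homog_comp \<Gamma> P (projr x) \<gamma>))"
        by (rule additive_comp[OF additive_comp[OF j G.comp_additive[OF \<gamma>]] i])
      show "Inr (homog_comp \<Gamma> P (projr x) \<gamma>) \<in> part ?F \<gamma>" if "x \<in> carrier ?F" for x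
        using that \<gamma> by (auto simp: pF G.comp_part)
      show "Inr (homog_comp \<Gamma> P (projr x) \<gamma>) = x" if "x \<in> part ?F \<gamma>" for x
        using that \<gamma> by (auto simp: pF G.comp_same)
      show "Inr (homog_comp \<Gamma> P (projr x) \<gamma>) = \<zero>\<^bsub>?F\<^esub>" if "\<delta> \<in> carrier \<Gamma>" "\<delta> \<noteq> \<gamma>" "x \<in> part ?F \<delta>" for \<delta> x
        using that \<gamma> by (auto simp: pF G.comp_homogeneous)
    next
      fix W assume W: "subgroup W (add_monoid ?F)" and pW: "\<And>\<gamma>. \<gamma> \<in> carrier \<Gamma> \<Longrightarrow> part ?F \<gamma> \<subseteq> W"
      have "{x \<in> carrier P. Inr x \<in> W} = carrier P"
        by (rule G.subgroup_of_parts[OF subgroup_vimage[OF P.M.abelian_group_axioms ab i W]])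
          (use pW pF G.part_carrier in auto)
      then show "carrier ?F \<subseteq> W" by auto
    qed
    show "a \<odot>\<^bsub>?F\<^esub> x \<in> part ?F (\<alpha> \<otimes>\<^bsub>\<Gamma>\<^esub> \<beta>)"
      if "\<alpha> \<in> carrier \<Gamma>" "\<beta> \<in> carrier \<Gamma>" "a \<in> part A \<alpha>" "x \<in> part ?F \<beta>" for \<alpha> \<beta> a x
      using that by (auto simp: pF P.part_smult)
  qed
qed

text \<open>
  All homogeneous elements serve as generators. An element that is homogeneous of several degrees is zero,
  so any choice of degree \<open>dg h\<close> will do.
\<close>

lemma (in graded_algebra) graded_projective_dual_basis:
  fixes P :: "('a, 'm, 'g, 'z) graded_scheme"
  assumes proj: "graded_projective TYPE(('a, 'm) test) R \<Gamma> A P"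
  shows "\<exists>H dg c. graded_dual_basis P H dg c"
proof -
  have P: "graded_module R \<Gamma> A P" using proj by (simp add: graded_projective_def)
  interpret P: graded_module R \<Gamma> A P by (rule P)
  interpret G: graded_group \<Gamma> P by (rule P.graded_group_M)
  interpret AG: graded_group \<Gamma> A by (rule graded_group_A)
  have lP: "left_module A P" ..
  define H where "H = (\<Union>\<gamma>\<in>carrier \<Gamma>. part P \<gamma>)"
  define dg where "dg h = (SOME \<gamma>. \<gamma> \<in> carrier \<Gamma> \<and> h \<in> part P \<gamma>)" for h
  have dg: "dg h \<in> carrier \<Gamma> \<and> h \<in> part P (dg h)" if h: "h \<in> H" for h
    unfolding dg_def by (rule someI_ex) (use h in \<open>auto simp: H_def\<close>)
  have HP: "H \<subseteq> carrier P" using G.part_carrier by (auto simp: H_def)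
  define E :: "('a, ('a, 'm) test, 'g) graded" where "E = graded_free H dg"
  define F :: "('a, ('a, 'm) test, 'g) graded" where "F = copy_module (graded.fields (\<lambda>\<gamma>. Inr ` part P \<gamma>)) P"
  have pF: "part F \<gamma> = Inr ` part P \<gamma>" for \<gamma> by (simp add: F_def copy_module_def graded.defs)
  have pE: "part E = free_part H dg" by (simp add: E_def graded_free_part)
  define g :: "('a, 'm) test \<Rightarrow> ('a, 'm) test" where "g = (\<lambda>x. Inr (linear_combination P H x))"
  have E: "graded_module R \<Gamma> A E" unfolding E_def by (rule graded_module_free) (use dg in blast)
  have F: "graded_module R \<Gamma> A F" unfolding F_def by (rule graded_module_copy[OF P])
  have lc: "linear_map A E P (linear_combination P H)"
    unfolding E_def graded_free_def by (rule linear_combination_linear[OF lP HP])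
  have f: "linear_map A P F Inr" unfolding F_def by (rule linear_map_Inr)
  have fg: "graded_map \<Gamma> A P F Inr" using f by (auto simp: graded_map_def pF)
  have coordE: "projl x h \<in> carrier A" "finite {h \<in> H. projl x h \<odot>\<^bsub>P\<^esub> h \<noteq> \<zero>\<^bsub>P\<^esub>}" if "x \<in> carrier E" for x h
  proof -
    note c = free_module_coords[OF that[unfolded E_def graded_free_def]]
    show "projl x h \<in> carrier A" by (rule c(2))
    show "finite {h \<in> H. projl x h \<odot>\<^bsub>P\<^esub> h \<noteq> \<zero>\<^bsub>P\<^esub>}"
      by (rule finite_subset[OF _ c(4)]) (use HP P.zero_smult in auto)
  qed
  have lcp: "linear_combination P H x \<in> part P \<gamma>" if \<gamma>: "\<gamma> \<in> carrier \<Gamma>" and x: "x \<in> free_part H dg \<gamma>" for x \<gamma>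
    unfolding linear_combination_def
  proof (rule P.M.fsum_in_subgroup[OF G.part_subgroup[OF \<gamma>]])
    fix h assume h: "h \<in> H"
    have hc: "h \<in> carrier P" using HP h by auto
    have "coarse_part (dg h) \<gamma> \<subseteq> {a \<in> carrier A. a \<odot>\<^bsub>P\<^esub> h \<in> part P \<gamma>}"
      by (rule coarse_part_subset[OF subgroup_vimage[OF abelian_A P.M.abelian_group_axioms
              P.scalar_additive[OF hc] G.part_subgroup[OF \<gamma>]]])
        (use dg[OF h] AG.part_carrier P.part_smult in auto)
    then show "projl x h \<odot>\<^bsub>P\<^esub> h \<in> part P \<gamma>" using x h by (auto simp: free_part_iff)
  qed
  have gg: "graded_map \<Gamma> A E F g"
    unfolding graded_map_def g_def using linear_map_comp[OF lc f] lcp by (auto simp: pE pF)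
  have "linear_combination P H ` carrier E = carrier P"
  proof (rule G.subgroup_of_parts)
    interpret E: graded_module R \<Gamma> A E by (rule E)
    show "subgroup (linear_combination P H ` carrier E) (add_monoid P)"
      using subgroup_image[OF E.M.abelian_group_axioms P.M.abelian_group_axioms linear_map_additive[OF lc], of "carrier E"]
        E.M.add.subgroup_self by simp
    fix \<gamma> assume \<gamma>: "\<gamma> \<in> carrier \<Gamma>"
    show "part P \<gamma> \<subseteq> linear_combination P H ` carrier E"
    proof
      fix h assume "h \<in> part P \<gamma>"
      then have h: "h \<in> H" using \<gamma> by (auto simp: H_def)
      have "single A h \<one>\<^bsub>A\<^esub> \<in> carrier E"
        unfolding E_def graded_free_def by (rule single_carrier[OF ring_A h]) simp
      moreover have "linear_combination P H (single A h \<one>\<^bsub>A\<^esub> :: ('a, 'm) test) = h"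
        using linear_combination_single[OF lP HP h, where ?'d = 'm, of "\<one>\<^bsub>A\<^esub>"] h HP P.smult_one by auto
      ultimately show "h \<in> linear_combination P H ` carrier E" by (metis imageI)
    qed
  qed
  then have surj: "g ` carrier E = carrier F" by (auto simp: g_def F_def)
  obtain s where s: "graded_map \<Gamma> A P E s" "\<And>p. p \<in> carrier P \<Longrightarrow> g (s p) = Inr p"
    using proj E F gg surj fg unfolding graded_projective_def by blast
  have sl: "linear_map A P E s" using s(1) by (simp add: graded_map_def)
  have "dual_basis A P H (\<lambda>x. projl (s x))"
    by (rule section_dual_basis[OF lP HP sl[unfolded E_def graded_free_def]]) (use s(2) in \<open>simp add: g_def\<close>)
  moreover have "projl (s x) h \<in> coarse_part (dg h) \<gamma>" if "\<gamma> \<in> carrier \<Gamma>" "x \<in> part P \<gamma>" "h \<in> H" for x h \<gamma>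
  proof -
    have "s x \<in> free_part H dg \<gamma>" using s(1) that by (auto simp: graded_map_def pE)
    then show ?thesis using that(3) by (simp add: free_part_iff)
  qed
  ultimately have "graded_dual_basis P H dg (\<lambda>x. projl (s x))"
    unfolding graded_dual_basis_def using dg by blast
  then show ?thesis by blast
qed

context smash_module_setting begin

text \<open>
  The two embeddings \<open>a \<mapsto> a \<otimes> 1\<close> and \<open>b \<mapsto> 1 \<otimes> b\<close>. They generate \<open>A \<ltimes> B\<close>, since
  \<open>(a \<otimes> 1) (1 \<otimes> b) = a \<otimes> b\<close>; their commutation rule \<open>(1 \<otimes> b) (a \<otimes> 1) = a \<otimes> b\<^sup>\<epsilon>\<close> for \<open>a\<close> of degree \<open>\<epsilon>\<close>
  carries the twist.
\<close>

definition left_el where "left_el a = S.MN.pt a \<one>\<^bsub>B\<^esub>"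
definition right_el where "right_el b = S.MN.pt \<one>\<^bsub>A\<^esub> b"

lemma left_el_closed: "a \<in> carrier A \<Longrightarrow> left_el a \<in> carrier SA"
  by (simp add: left_el_def S.MN.pt_closed SA_simps)

lemma right_el_closed: "b \<in> carrier B \<Longrightarrow> right_el b \<in> carrier SA"
  by (simp add: right_el_def S.MN.pt_closed SA_simps)

lemma left_el_additive: "additive_map A SA left_el"
  by (rule additiveI) (simp_all add: left_el_def SA_simps S.MN.pt_closed S.MN.pt_add_left)

lemma right_el_additive: "additive_map B SA right_el"
  by (rule additiveI) (simp_all add: right_el_def SA_simps S.MN.pt_closed S.MN.pt_add_right)

lemma pt_left_el: "a \<in> carrier A \<Longrightarrow> b \<in> carrier B \<Longrightarrow> \<epsilon> \<in> carrier \<Gamma> \<Longrightarrow> a' \<in> part A \<epsilon> \<Longrightarrow>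
    S.MN.pt a b \<otimes>\<^bsub>SA\<^esub> left_el a' = S.MN.pt (a \<otimes>\<^bsub>A\<^esub> a') (act B b \<epsilon>)"
  unfolding left_el_def SA_simps by (simp add: S.op_pure S.act_closed)

lemma left_right_el: "a \<in> carrier A \<Longrightarrow> b \<in> carrier B \<Longrightarrow> left_el a \<otimes>\<^bsub>SA\<^esub> right_el b = S.MN.pt a b"
  unfolding left_el_def right_el_def SA_simps
  using S.op_pure[OF _ _ S.one_\<Gamma> A.one_part, of a "\<one>\<^bsub>B\<^esub>" b] by (simp add: S.act_unit)

lemma right_right_el: "b \<in> carrier B \<Longrightarrow> b' \<in> carrier B \<Longrightarrow> right_el b \<otimes>\<^bsub>SA\<^esub> right_el b' = right_el (b \<otimes>\<^bsub>B\<^esub> b')"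
  unfolding right_el_def SA_simps
  using S.op_pure[OF _ _ S.one_\<Gamma> A.one_part, of "\<one>\<^bsub>A\<^esub>" b b'] by (simp add: B.act_one)

lemma left_el_part: "\<alpha> \<in> carrier \<Gamma> \<Longrightarrow> a \<in> part A \<alpha> \<Longrightarrow> left_el a \<in> part SA \<alpha>"
  by (simp add: left_el_def SA_simps S.pt_deg_part)

lemma right_el_part: "b \<in> carrier B \<Longrightarrow> right_el b \<in> part SA \<one>\<^bsub>\<Gamma>\<^esub>"
  using A.one_part by (simp add: right_el_def SA_simps S.pt_deg_part)

lemma left_el_pt: "a \<in> carrier A \<Longrightarrow> m \<in> carrier M \<Longrightarrow> n \<in> carrier N \<Longrightarrow>
    left_el a \<odot>\<^bsub>SM\<^esub> Q.pt m n = Q.pt (a \<odot>\<^bsub>M\<^esub> m) n"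
  by (simp add: left_el_def SM_simps op_one_pt)

lemma right_el_pt: "b \<in> carrier B \<Longrightarrow> \<gamma> \<in> carrier \<Gamma> \<Longrightarrow> m \<in> part M \<gamma> \<Longrightarrow> n \<in> carrier N \<Longrightarrow>
    right_el b \<odot>\<^bsub>SM\<^esub> Q.pt m n = Q.pt m (act B b \<gamma> \<odot>\<^bsub>N\<^esub> n)"
  using Q.op_pure[of "\<one>\<^bsub>A\<^esub>" b \<gamma> m n] Q.grp.part_carrier[of \<gamma> m]
  by (simp add: right_el_def SM_simps M.smult_one)

text \<open>
  The lift \<open>k\<close> of \<open>f\<close> along \<open>g\<close> is built in two stages. For a generator \<open>h\<close> of \<open>M\<close> the map \<open>\<Lambda> h\<close> lifts
  \<open>x \<mapsto> f (h \<otimes> x)\<close>, which is \<open>B\<close>-linear from the twist of \<open>N\<close> by the degree of \<open>h\<close>; then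
  \<open>k (p \<otimes> x) = \<Sum>\<^sub>h (c\<^sub>h(p) \<otimes> 1) \<Lambda> h x\<close>.
\<close>

lemma graded_projective_smash:
  assumes db: "A.graded_dual_basis M H dg c"
    and dN: "\<And>\<beta>. \<beta> \<in> carrier \<Gamma> \<Longrightarrow> dual_basis B (twisted_module B \<beta> N) (carrier N) (\<psi> \<beta>)"
  shows "graded_projective TYPE('u) R \<Gamma> SA SM"
  unfolding graded_projective_def
proof (intro conjI allI impI graded_module_SM)
  fix E F :: "(('a, 'b) tensor, 'u, 'g) graded" and g f
  assume E: "graded_module R \<Gamma> SA E" and F: "graded_module R \<Gamma> SA F"
    and g: "graded_map \<Gamma> SA E F g" and surj: "g ` carrier E = carrier F" and f: "graded_map \<Gamma> SA SM F f"
  interpret E: graded_module R \<Gamma> SA E by (rule E)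
  interpret F: graded_module R \<Gamma> SA F by (rule F)
  have EG: "graded_group \<Gamma> E" and FG: "graded_group \<Gamma> F" by (rule E.graded_group_M, rule F.graded_group_M)
  interpret EG: graded_group \<Gamma> E by (rule EG)
  interpret FG: graded_group \<Gamma> F by (rule FG)
  have abE: "abelian_group E" and abF: "abelian_group F" by (rule E.M.abelian_group_axioms, rule F.M.abelian_group_axioms)
  have dbA: "dual_basis A M H c" and dgH: "\<And>h. h \<in> H \<Longrightarrow> dg h \<in> carrier \<Gamma>" "\<And>h. h \<in> H \<Longrightarrow> h \<in> part M (dg h)"
    and cdeg: "\<And>\<gamma> x h. \<gamma> \<in> carrier \<Gamma> \<Longrightarrow> x \<in> part M \<gamma> \<Longrightarrow> h \<in> H \<Longrightarrow> c x h \<in> A.coarse_part (dg h) \<gamma>"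
    using db by (auto simp: A.graded_dual_basis_def)
  note c = dual_basisD[OF dbA]
  have Hc: "h \<in> carrier M" if "h \<in> H" for h using c(1) that by auto
  have tw: "carrier (twisted_module B \<beta> N) = carrier N" "\<zero>\<^bsub>twisted_module B \<beta> N\<^esub> = \<zero>\<^bsub>N\<^esub>"
    "x \<oplus>\<^bsub>twisted_module B \<beta> N\<^esub> y = x \<oplus>\<^bsub>N\<^esub> y"
    "b \<odot>\<^bsub>twisted_module B \<beta> N\<^esub> x = act B b \<beta> \<odot>\<^bsub>N\<^esub> x" for \<beta> x y b
    by (simp_all add: twisted_module_def)
  have abtw: "abelian_group (twisted_module B \<beta> N)" for \<beta>
    by (rule abelian_group_cong[OF N.M.abelian_group_axioms]) (simp_all add: tw)
  have \<psi>c: "\<psi> \<beta> x y \<in> carrier B" if "\<beta> \<in> carrier \<Gamma>" "x \<in> carrier N" for \<beta> x y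
    using dual_basisD(2)[OF dN[OF that(1)]] that(2) by (simp add: tw)
  have \<psi>fin: "finite {y. \<psi> \<beta> x y \<noteq> \<zero>\<^bsub>B\<^esub>}" if "\<beta> \<in> carrier \<Gamma>" "x \<in> carrier N" for \<beta> x
    using dual_basisD(3)[OF dN[OF that(1)]] that(2) by (simp add: tw)
  have \<psi>add: "additive_map N B (\<lambda>x. \<psi> \<beta> x y)" if "\<beta> \<in> carrier \<Gamma>" for \<beta> y
    using dual_basisD(4)[OF dN[OF that]] by (simp add: additive_map_def tw)
  have \<psi>lin: "\<psi> \<beta> (act B b \<beta> \<odot>\<^bsub>N\<^esub> x) y = b \<otimes>\<^bsub>B\<^esub> \<psi> \<beta> x y"
    if "\<beta> \<in> carrier \<Gamma>" "b \<in> carrier B" "x \<in> carrier N" for \<beta> b x y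
    using dual_basisD(5)[OF dN[OF that(1)] that(2)] that(3) by (simp add: tw)
  have \<psi>sum: "fsum (twisted_module B \<beta> N) (\<lambda>y. act B (\<psi> \<beta> x y) \<beta> \<odot>\<^bsub>N\<^esub> y) (carrier N) = x"
    if "\<beta> \<in> carrier \<Gamma>" "x \<in> carrier N" for \<beta> x
    using dual_basisD(6)[OF dN[OF that(1)]] that(2) by (simp add: tw)
  have abA: "abelian_group A" by (rule A.abelian_A)
  have abB: "abelian_group B" by unfold_locales
  have gl: "linear_map SA E F g" and gp: "\<And>\<gamma>. \<gamma> \<in> carrier \<Gamma> \<Longrightarrow> g ` part E \<gamma> \<subseteq> part F \<gamma>"
    using g by (auto simp: graded_map_def)
  have fl: "linear_map SA SM F f" and fp: "\<And>\<gamma>. \<gamma> \<in> carrier \<Gamma> \<Longrightarrow> f ` part SM \<gamma> \<subseteq> part F \<gamma>"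
    using f by (auto simp: graded_map_def)
  have ga: "additive_map E F g" and fa: "additive_map SM F f"
    using linear_map_additive[OF gl] linear_map_additive[OF fl] .
  have fT: "additive_map V F f" using fa by (simp add: additive_map_def SM_simps)
  \<comment> \<open>a homogeneous element has a homogeneous preimage, namely a component of any preimage\<close>
  have lift_ex: "\<exists>e\<in>part E \<gamma>. g e = v" if \<gamma>: "\<gamma> \<in> carrier \<Gamma>" and v: "v \<in> part F \<gamma>" for \<gamma> v
  proof -
    have "v \<in> g ` carrier E" unfolding surj by (rule FG.part_carrier[OF \<gamma> v])
    then obtain e where e: "e \<in> carrier E" "g e = v" by (elim imageE) simp
    have "g (homog_comp \<Gamma> E e \<gamma>) = homog_comp \<Gamma> F (g e) \<gamma>"
      by (rule graded_map_comp[OF EG FG ga gp e(1) \<gamma>, symmetric])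
    also have "\<dots> = v" using FG.comp_same[OF \<gamma> v] e by simp
    finally show ?thesis using EG.comp_part[OF e(1) \<gamma>] by blast
  qed
  have fpt: "f (Q.pt h y) \<in> part F (dg h)" if "h \<in> H" "y \<in> carrier N" for h y
  proof -
    have "Q.pt h y \<in> part SM (dg h)" using dgH(2)[OF that(1)] that(2) by (simp add: SM_simps Q.pt_deg_part)
    then show ?thesis using fp[OF dgH(1)[OF that(1)]] by blast
  qed
  define e where "e h y = (SOME e. e \<in> part E (dg h) \<and> g e = f (Q.pt h y))" for h y
  have e: "e h y \<in> part E (dg h) \<and> g (e h y) = f (Q.pt h y)" if "h \<in> H" "y \<in> carrier N" for h y
    unfolding e_def by (rule someI_ex) (use lift_ex[OF dgH(1)[OF that(1)] fpt[OF that]] in blast)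
  have ec: "e h y \<in> carrier E" if "h \<in> H" "y \<in> carrier N" for h y
    using EG.part_carrier[OF dgH(1)[OF that(1)]] e[OF that] by blast
  have rE: "right_el b \<odot>\<^bsub>E\<^esub> v \<in> carrier E" if "b \<in> carrier B" "v \<in> carrier E" for b v
    by (rule E.smult_closed[OF right_el_closed[OF that(1)] that(2)])
  have lE: "left_el a \<odot>\<^bsub>E\<^esub> v \<in> carrier E" if "a \<in> carrier A" "v \<in> carrier E" for a v
    by (rule E.smult_closed[OF left_el_closed[OF that(1)] that(2)])
  have radd: "additive_map B E (\<lambda>b. right_el b \<odot>\<^bsub>E\<^esub> v)" if "v \<in> carrier E" for v
    by (rule additive_comp[OF right_el_additive E.scalar_additive[OF that]])
  have ladd: "additive_map A E (\<lambda>a. left_el a \<odot>\<^bsub>E\<^esub> v)" if "v \<in> carrier E" for v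
    by (rule additive_comp[OF left_el_additive E.scalar_additive[OF that]])
  have rzero: "right_el \<zero>\<^bsub>B\<^esub> \<odot>\<^bsub>E\<^esub> v = \<zero>\<^bsub>E\<^esub>" if "v \<in> carrier E" for v
    by (rule additive_zero[OF abB abE radd[OF that]])
  have lzero: "left_el \<zero>\<^bsub>A\<^esub> \<odot>\<^bsub>E\<^esub> v = \<zero>\<^bsub>E\<^esub>" if "v \<in> carrier E" for v
    by (rule additive_zero[OF abA abE ladd[OF that]])
  \<comment> \<open>the section from the twisted module to the free module on \<open>N\<close>, followed by the map that sends the
      basis element of \<open>y\<close> to the chosen lift of \<open>f (h \<otimes> y)\<close>\<close>
  define \<Lambda> where "\<Lambda> h x = fsum E (\<lambda>y. right_el (\<psi> (dg h) x y) \<odot>\<^bsub>E\<^esub> e h y) (carrier N)" for h x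
  have \<Lambda>fin: "finite {y \<in> carrier N. right_el (\<psi> (dg h) x y) \<odot>\<^bsub>E\<^esub> e h y \<noteq> \<zero>\<^bsub>E\<^esub>}"
    if "h \<in> H" "x \<in> carrier N" for h x
    by (rule finite_subset[OF _ \<psi>fin[OF dgH(1)[OF that(1)] that(2)]]) (use rzero ec that in auto)
  have \<Lambda>term: "right_el (\<psi> (dg h) x y) \<odot>\<^bsub>E\<^esub> e h y \<in> carrier E"
    if "h \<in> H" "x \<in> carrier N" "y \<in> carrier N" for h x y
    by (rule rE[OF \<psi>c[OF dgH(1)[OF that(1)] that(2)] ec[OF that(1,3)]])
  have \<Lambda>c: "\<Lambda> h x \<in> carrier E" if "h \<in> H" "x \<in> carrier N" for h x
    unfolding \<Lambda>_def by (rule E.M.fsum_closed) (rule \<Lambda>term[OF that])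
  have \<Lambda>add: "additive_map N E (\<Lambda> h)" if h: "h \<in> H" for h
    unfolding \<Lambda>_def
    by (rule additive_fsum_fun[OF abE additive_comp[OF \<psi>add[OF dgH(1)[OF h]] radd[OF ec[OF h]]] \<Lambda>fin[OF h]])
  have \<Lambda>lin: "right_el b \<odot>\<^bsub>E\<^esub> \<Lambda> h x = \<Lambda> h (act B b (dg h) \<odot>\<^bsub>N\<^esub> x)"
    if h: "h \<in> H" and b: "b \<in> carrier B" and x: "x \<in> carrier N" for h b x
  proof -
    have "right_el b \<odot>\<^bsub>E\<^esub> \<Lambda> h x = fsum E (\<lambda>y. right_el b \<odot>\<^bsub>E\<^esub> (right_el (\<psi> (dg h) x y) \<odot>\<^bsub>E\<^esub> e h y)) (carrier N)"
      unfolding \<Lambda>_def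
      by (rule additive_fsum[OF abE abE E.smult_additive[OF right_el_closed[OF b]] \<Lambda>fin[OF h x] \<Lambda>term[OF h x]])
    also have "\<dots> = \<Lambda> h (act B b (dg h) \<odot>\<^bsub>N\<^esub> x)"
      unfolding \<Lambda>_def
    proof (rule E.M.fsum_cong)
      fix y assume y: "y \<in> carrier N"
      show "right_el b \<odot>\<^bsub>E\<^esub> (right_el (\<psi> (dg h) x y) \<odot>\<^bsub>E\<^esub> e h y) \<in> carrier E"
        by (rule rE[OF b \<Lambda>term[OF h x y]])
      show "right_el b \<odot>\<^bsub>E\<^esub> (right_el (\<psi> (dg h) x y) \<odot>\<^bsub>E\<^esub> e h y) =
          right_el (\<psi> (dg h) (act B b (dg h) \<odot>\<^bsub>N\<^esub> x) y) \<odot>\<^bsub>E\<^esub> e h y"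
        using \<psi>c[OF dgH(1)[OF h] x] b
        by (simp add: \<psi>lin[OF dgH(1)[OF h] b x] right_right_el[symmetric]
            E.smult_assoc[OF right_el_closed right_el_closed ec[OF h y]])
    qed
    finally show ?thesis .
  qed
  have \<Lambda>part: "\<Lambda> h x \<in> part E (dg h)" if h: "h \<in> H" and x: "x \<in> carrier N" for h x
    unfolding \<Lambda>_def
  proof (rule E.M.fsum_in_subgroup[OF EG.part_subgroup[OF dgH(1)[OF h]]])
    fix y assume y: "y \<in> carrier N"
    show "right_el (\<psi> (dg h) x y) \<odot>\<^bsub>E\<^esub> e h y \<in> part E (dg h)"
      using E.part_smult[OF S.one_\<Gamma> dgH(1)[OF h] right_el_part[OF \<psi>c[OF dgH(1)[OF h] x]] conjunct1[OF e[OF h y]]]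
        dgH(1)[OF h] by simp
  qed
  have g\<Lambda>: "g (\<Lambda> h x) = f (Q.pt h x)" if h: "h \<in> H" and x: "x \<in> carrier N" for h x
  proof -
    let ?\<beta> = "dg h"
    note \<beta> = dgH(1)[OF h]
    have "g (\<Lambda> h x) = fsum F (\<lambda>y. g (right_el (\<psi> ?\<beta> x y) \<odot>\<^bsub>E\<^esub> e h y)) (carrier N)"
      unfolding \<Lambda>_def by (rule additive_fsum[OF abE abF ga \<Lambda>fin[OF h x] \<Lambda>term[OF h x]])
    also have "\<dots> = fsum F (\<lambda>y. f (Q.pt h (act B (\<psi> ?\<beta> x y) ?\<beta> \<odot>\<^bsub>N\<^esub> y))) (carrier N)"
    proof (rule F.M.fsum_cong)
      fix y assume y: "y \<in> carrier N"
      show "g (right_el (\<psi> ?\<beta> x y) \<odot>\<^bsub>E\<^esub> e h y) \<in> carrier F" by (rule additive_closed[OF ga \<Lambda>term[OF h x y]])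
      have ptc: "Q.pt h y \<in> carrier SM" using Hc[OF h] y by (simp add: SM_simps Q.MN.pt_closed)
      have "g (right_el (\<psi> ?\<beta> x y) \<odot>\<^bsub>E\<^esub> e h y) = right_el (\<psi> ?\<beta> x y) \<odot>\<^bsub>F\<^esub> f (Q.pt h y)"
        using linear_map_smult[OF gl right_el_closed[OF \<psi>c[OF \<beta> x]] ec[OF h y]] e[OF h y] by simp
      also have "\<dots> = f (right_el (\<psi> ?\<beta> x y) \<odot>\<^bsub>SM\<^esub> Q.pt h y)"
        by (rule linear_map_smult[OF fl right_el_closed[OF \<psi>c[OF \<beta> x]] ptc, symmetric])
      also have "\<dots> = f (Q.pt h (act B (\<psi> ?\<beta> x y) ?\<beta> \<odot>\<^bsub>N\<^esub> y))"
        by (simp add: right_el_pt[OF \<psi>c[OF \<beta> x] \<beta> dgH(2)[OF h] y])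
      finally show "g (right_el (\<psi> ?\<beta> x y) \<odot>\<^bsub>E\<^esub> e h y) = f (Q.pt h (act B (\<psi> ?\<beta> x y) ?\<beta> \<odot>\<^bsub>N\<^esub> y))" .
    qed
    also have "\<dots> = f (Q.pt h (fsum (twisted_module B ?\<beta> N) (\<lambda>y. act B (\<psi> ?\<beta> x y) ?\<beta> \<odot>\<^bsub>N\<^esub> y) (carrier N)))"
    proof (rule additive_fsum[OF abtw abF, symmetric])
      have "additive_map N V (Q.pt h)"
        using Q.pt_additive_right[OF Hc[OF h]] by (simp add: additive_map_def)
      from additive_comp[OF this fT] show "additive_map (twisted_module B ?\<beta> N) F (\<lambda>y. f (Q.pt h y))"
        by (subst additive_map_cong_source[where W = N]) (simp_all add: tw)
      have z: "act B \<zero>\<^bsub>B\<^esub> ?\<beta> = \<zero>\<^bsub>B\<^esub>"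
        by (rule additive_zero[OF abB abB, of "\<lambda>b. act B b ?\<beta>"])
          (rule additiveI, auto simp: S.act_closed[OF \<beta>] S.act_add[OF \<beta>])
      show "finite {y \<in> carrier N. act B (\<psi> ?\<beta> x y) ?\<beta> \<odot>\<^bsub>N\<^esub> y \<noteq> \<zero>\<^bsub>twisted_module B ?\<beta> N\<^esub>}"
        by (rule finite_subset[OF _ \<psi>fin[OF \<beta> x]]) (use N.zero_smult z in \<open>auto simp: tw\<close>)
      show "act B (\<psi> ?\<beta> x y) ?\<beta> \<odot>\<^bsub>N\<^esub> y \<in> carrier (twisted_module B ?\<beta> N)" if "y \<in> carrier N" for y
        using N.smult_closed[OF S.act_closed[OF \<beta> \<psi>c[OF \<beta> x]] that] by (simp add: tw)
    qed
    also have "\<dots> = f (Q.pt h x)" by (simp add: \<psi>sum[OF \<beta> x])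
    finally show ?thesis .
  qed
  define \<kappa> where "\<kappa> p x = fsum E (\<lambda>h. left_el (c p h) \<odot>\<^bsub>E\<^esub> \<Lambda> h x) H" for p x
  have \<kappa>fin: "finite {h \<in> H. left_el (c p h) \<odot>\<^bsub>E\<^esub> \<Lambda> h x \<noteq> \<zero>\<^bsub>E\<^esub>}"
    if "p \<in> carrier M" "x \<in> carrier N" for p x
    by (rule finite_subset[OF _ c(3)[OF that(1)]]) (use lzero \<Lambda>c that in auto)
  have \<kappa>term: "left_el (c p h) \<odot>\<^bsub>E\<^esub> \<Lambda> h x \<in> carrier E"
    if "p \<in> carrier M" "x \<in> carrier N" "h \<in> H" for p x h
    by (rule lE[OF c(2)[OF that(1)] \<Lambda>c[OF that(3,2)]])
  have \<kappa>c: "\<kappa> p x \<in> carrier E" if "p \<in> carrier M" "x \<in> carrier N" for p x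
    unfolding \<kappa>_def by (rule E.M.fsum_closed) (rule \<kappa>term[OF that])
  have \<kappa>left: "additive_map M E (\<lambda>p. \<kappa> p x)" if x: "x \<in> carrier N" for x
    unfolding \<kappa>_def
    by (rule additive_fsum_fun[OF abE additive_comp[OF c(4) ladd[OF \<Lambda>c[OF _ x]]] \<kappa>fin[OF _ x]])
  have \<kappa>right: "additive_map N E (\<kappa> p)" if p: "p \<in> carrier M" for p
    unfolding \<kappa>_def
    by (rule additive_fsum_fun[OF abE additive_comp[OF \<Lambda>add E.smult_additive[OF left_el_closed[OF c(2)[OF p]]]] \<kappa>fin[OF p]])
  \<comment> \<open>a scalar \<open>r\<close> passes through as \<open>r 1\<^sub>A\<close> on the left and as \<open>r 1\<^sub>B\<close> on the right; \<open>\<Gamma>\<close> fixes the latter\<close>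
  have \<kappa>bal: "\<kappa> (r \<odot>\<^bsub>base_module A M\<^esub> p) x = \<kappa> p (r \<odot>\<^bsub>base_module B N\<^esub> x)"
    if r: "r \<in> carrier R" and p: "p \<in> carrier M" and x: "x \<in> carrier N" for r p x
    unfolding \<kappa>_def
  proof (rule E.M.fsum_cong)
    fix h assume h: "h \<in> H"
    have rA: "r \<odot>\<^bsub>A\<^esub> \<one>\<^bsub>A\<^esub> \<in> carrier A" and rB: "r \<odot>\<^bsub>B\<^esub> \<one>\<^bsub>B\<^esub> \<in> carrier B" using r by auto
    have rp: "r \<odot>\<^bsub>base_module A M\<^esub> p \<in> carrier M" using M.smult_closed[OF rA p] by simp
    show "left_el (c (r \<odot>\<^bsub>base_module A M\<^esub> p) h) \<odot>\<^bsub>E\<^esub> \<Lambda> h x \<in> carrier E" by (rule \<kappa>term[OF rp x h])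
    have ch: "c p h \<in> carrier A" by (rule c(2)[OF p])
    have "c (r \<odot>\<^bsub>base_module A M\<^esub> p) h = r \<odot>\<^bsub>A\<^esub> c p h"
      using c(5)[OF rA p, of h] r ch by (simp add: A.smult_mult_left)
    moreover have "left_el (r \<odot>\<^bsub>A\<^esub> c p h) = left_el (c p h) \<otimes>\<^bsub>SA\<^esub> right_el (r \<odot>\<^bsub>B\<^esub> \<one>\<^bsub>B\<^esub>)"
      using S.MN.pt_smult[OF r ch S.one_B] left_right_el[OF ch rB] by (simp add: left_el_def)
    ultimately have "left_el (c (r \<odot>\<^bsub>base_module A M\<^esub> p) h) \<odot>\<^bsub>E\<^esub> \<Lambda> h x =
        left_el (c p h) \<odot>\<^bsub>E\<^esub> (right_el (r \<odot>\<^bsub>B\<^esub> \<one>\<^bsub>B\<^esub>) \<odot>\<^bsub>E\<^esub> \<Lambda> h x)"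
      by (simp add: E.smult_assoc[OF left_el_closed[OF ch] right_el_closed[OF rB] \<Lambda>c[OF h x]])
    also have "right_el (r \<odot>\<^bsub>B\<^esub> \<one>\<^bsub>B\<^esub>) \<odot>\<^bsub>E\<^esub> \<Lambda> h x = \<Lambda> h (r \<odot>\<^bsub>base_module B N\<^esub> x)"
      using \<Lambda>lin[OF h rB x] r dgH(1)[OF h] by (simp add: B.act_smult S.act_unit)
    finally show "left_el (c (r \<odot>\<^bsub>base_module A M\<^esub> p) h) \<odot>\<^bsub>E\<^esub> \<Lambda> h x =
      left_el (c p h) \<odot>\<^bsub>E\<^esub> \<Lambda> h (r \<odot>\<^bsub>base_module B N\<^esub> x)" .
  qed
  have \<kappa>balanced: "balanced R (base_module A M) (base_module B N) E \<kappa>"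
    unfolding balanced_def using \<kappa>left \<kappa>right \<kappa>bal by (simp add: additive_map_def)
  define k where "k = tensor_lift E (case_prod \<kappa>)"
  have ka: "additive_map V E k"
    unfolding k_def by (rule Q.MN.tensor_lift_additive[OF abE \<kappa>balanced])
  have kpt: "k (Q.pt p x) = \<kappa> p x" if "p \<in> carrier M" "x \<in> carrier N" for p x
    unfolding k_def by (rule Q.MN.tensor_lift_pure[OF abE \<kappa>balanced]) (use that in auto)
  have gk: "g (k t) = f t" if t: "t \<in> carrier V" for t
  proof (rule Q.MN.tensor_hom_ext[OF abF additive_comp[OF ka ga] fT _ t])
    fix p x assume "p \<in> carrier (base_module A M)" "x \<in> carrier (base_module B N)"
    then have p: "p \<in> carrier M" and x: "x \<in> carrier N" by auto
    have "g (k (Q.pt p x)) = fsum F (\<lambda>h. g (left_el (c p h) \<odot>\<^bsub>E\<^esub> \<Lambda> h x)) H"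
      unfolding kpt[OF p x] \<kappa>_def by (rule additive_fsum[OF abE abF ga \<kappa>fin[OF p x] \<kappa>term[OF p x]])
    also have "\<dots> = fsum F (\<lambda>h. f (Q.pt (c p h \<odot>\<^bsub>M\<^esub> h) x)) H"
    proof (rule F.M.fsum_cong)
      fix h assume h: "h \<in> H"
      show "g (left_el (c p h) \<odot>\<^bsub>E\<^esub> \<Lambda> h x) \<in> carrier F" by (rule additive_closed[OF ga \<kappa>term[OF p x h]])
      have ptc: "Q.pt h x \<in> carrier SM" using Hc[OF h] x by (simp add: SM_simps Q.MN.pt_closed)
      note lc = left_el_closed[OF c(2)[OF p]]
      show "g (left_el (c p h) \<odot>\<^bsub>E\<^esub> \<Lambda> h x) = f (Q.pt (c p h \<odot>\<^bsub>M\<^esub> h) x)"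
        using linear_map_smult[OF gl lc \<Lambda>c[OF h x]] g\<Lambda>[OF h x] linear_map_smult[OF fl lc ptc]
          left_el_pt[OF c(2)[OF p] Hc[OF h] x] by simp
    qed
    also have "\<dots> = f (Q.pt (fsum M (\<lambda>h. c p h \<odot>\<^bsub>M\<^esub> h) H) x)"
    proof (rule additive_fsum[OF M.M.abelian_group_axioms abF additive_comp[OF pt_left[OF x] fT], symmetric])
      show "finite {h \<in> H. c p h \<odot>\<^bsub>M\<^esub> h \<noteq> \<zero>\<^bsub>M\<^esub>}"
        by (rule finite_subset[OF _ c(3)[OF p]]) (use M.zero_smult Hc in auto)
      show "c p h \<odot>\<^bsub>M\<^esub> h \<in> carrier M" if "h \<in> H" for h by (rule M.smult_closed[OF c(2)[OF p] Hc[OF that]])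
    qed
    also have "\<dots> = f (Q.pt p x)" by (simp add: c(6)[OF p])
    finally show "g (k (Q.pt p x)) = f (Q.pt p x)" .
  qed
  \<comment> \<open>the commutation of the twist with the coordinates: on a component of degree \<open>\<epsilon>\<close>, both sides equal
      \<open>(a a' \<otimes> b\<^sup>\<epsilon>) \<Lambda> h x\<close>, because \<open>b\<^sup>\<delta>\<close> is \<open>b\<^sup>\<epsilon>\<close> acted on by the degree of \<open>h\<close>\<close>
  have key: "left_el (a \<otimes>\<^bsub>A\<^esub> a') \<odot>\<^bsub>E\<^esub> \<Lambda> h (act B b \<delta> \<odot>\<^bsub>N\<^esub> x) = S.MN.pt a b \<odot>\<^bsub>E\<^esub> (left_el a' \<odot>\<^bsub>E\<^esub> \<Lambda> h x)"
    if a: "a \<in> carrier A" and b: "b \<in> carrier B" and \<delta>: "\<delta> \<in> carrier \<Gamma>" and h: "h \<in> H" and x: "x \<in> carrier N"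
      and a': "a' \<in> A.coarse_part (dg h) \<delta>" for a a' b \<delta> h x
  proof -
    let ?l = "\<lambda>a'. left_el (a \<otimes>\<^bsub>A\<^esub> a') \<odot>\<^bsub>E\<^esub> \<Lambda> h (act B b \<delta> \<odot>\<^bsub>N\<^esub> x)"
    let ?r = "\<lambda>a'. S.MN.pt a b \<odot>\<^bsub>E\<^esub> (left_el a' \<odot>\<^bsub>E\<^esub> \<Lambda> h x)"
    have bx: "act B b \<delta> \<odot>\<^bsub>N\<^esub> x \<in> carrier N" by (rule N.smult_closed[OF S.act_closed[OF \<delta> b] x])
    have ptc: "S.MN.pt a b \<in> carrier SA" using a b by (simp add: SA_simps S.MN.pt_closed)
    have am: "additive_map A A (\<lambda>y. a \<otimes>\<^bsub>A\<^esub> y)"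
      by (rule additiveI) (use a S.lact_closed S.lact_add_right in auto)
    have l: "additive_map A E ?l" by (rule additive_comp[OF am ladd[OF \<Lambda>c[OF h bx]]])
    have r: "additive_map A E ?r" by (rule additive_comp[OF ladd[OF \<Lambda>c[OF h x]] E.smult_additive[OF ptc]])
    have sub: "subgroup {y \<in> carrier A. ?l y = ?r y} (add_monoid A)"
      by (rule subgroup_addI[OF abA])
        (use additive_zero[OF abA abE l] additive_zero[OF abA abE r] additive_add[OF l] additive_add[OF r]
          additive_minus[OF abA abE l] additive_minus[OF abA abE r] abelian_group.a_inv_closed[OF abA]
          abelian_group.axioms(1)[OF abA] abelian_monoid.zero_closed abelian_monoid.a_closed in auto)
    have "A.coarse_part (dg h) \<delta> \<subseteq> {y \<in> carrier A. ?l y = ?r y}"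
    proof (rule A.coarse_part_subset[OF sub], rule)
      fix \<epsilon> y assume \<epsilon>: "\<epsilon> \<in> carrier \<Gamma>" and ed: "\<epsilon> \<otimes>\<^bsub>\<Gamma>\<^esub> dg h = \<delta>" and y: "y \<in> part A \<epsilon>"
      have yc: "y \<in> carrier A" by (rule S.grp.part_carrier[OF \<epsilon> y])
      have ay: "a \<otimes>\<^bsub>A\<^esub> y \<in> carrier A" by (rule S.lact_closed[OF a yc])
      have be: "act B b \<epsilon> \<in> carrier B" by (rule S.act_closed[OF \<epsilon> b])
      have "act B b \<delta> = act B (act B b \<epsilon>) (dg h)"
        using B.act_mult[OF \<epsilon> dgH(1)[OF h] b] ed by simp
      then have "?l y = left_el (a \<otimes>\<^bsub>A\<^esub> y) \<odot>\<^bsub>E\<^esub> (right_el (act B b \<epsilon>) \<odot>\<^bsub>E\<^esub> \<Lambda> h x)"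
        using \<Lambda>lin[OF h be x] by simp
      also have "\<dots> = S.MN.pt (a \<otimes>\<^bsub>A\<^esub> y) (act B b \<epsilon>) \<odot>\<^bsub>E\<^esub> \<Lambda> h x"
        by (simp add: E.smult_assoc[OF left_el_closed[OF ay] right_el_closed[OF be] \<Lambda>c[OF h x], symmetric]
            left_right_el[OF ay be])
      also have "\<dots> = ?r y"
        by (simp add: E.smult_assoc[OF ptc left_el_closed[OF yc] \<Lambda>c[OF h x], symmetric] pt_left_el[OF a b \<epsilon> y])
      finally show "y \<in> {y \<in> carrier A. ?l y = ?r y}" using yc by simp
    qed
    then show ?thesis using a' by auto
  qed
  have klin: "k (Q.op s t) = s \<odot>\<^bsub>E\<^esub> k t" if s: "s \<in> carrier S.MN.T" and t: "t \<in> carrier V" for s t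
  proof (rule S.MN.tensor_hom_ext[OF abE _ _ _ s])
    show "additive_map S.MN.T E (\<lambda>s. k (Q.op s t))" by (rule additive_comp[OF Q.op_additive_left[OF t] ka])
    show "additive_map S.MN.T E (\<lambda>s. s \<odot>\<^bsub>E\<^esub> k t)"
      using E.scalar_additive[OF additive_closed[OF ka t]] by (simp add: additive_map_def SA_simps)
    fix a b assume a: "a \<in> carrier A" and b: "b \<in> carrier B"
    have ptc: "S.MN.pt a b \<in> carrier SA" using a b by (simp add: SA_simps S.MN.pt_closed)
    show "k (Q.op (S.MN.pt a b) t) = S.MN.pt a b \<odot>\<^bsub>E\<^esub> k t"
    proof (rule Q.homogeneous_tensor_ext[OF abE _ _ _ t])
      show "additive_map V E (\<lambda>t. k (Q.op (S.MN.pt a b) t))"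
        using additive_comp[OF Q.op_additive_right ka] ptc by (simp add: SA_simps)
      show "additive_map V E (\<lambda>t. S.MN.pt a b \<odot>\<^bsub>E\<^esub> k t)" by (rule additive_comp[OF ka E.smult_additive[OF ptc]])
      fix \<delta> p x assume \<delta>: "\<delta> \<in> carrier \<Gamma>" and pd: "p \<in> part M \<delta>" and "x \<in> carrier (base_module B N)"
      then have x: "x \<in> carrier N" and p: "p \<in> carrier M" using Q.grp.part_carrier by auto
      have bx: "act B b \<delta> \<odot>\<^bsub>N\<^esub> x \<in> carrier N" by (rule N.smult_closed[OF S.act_closed[OF \<delta> b] x])
      have ap: "a \<odot>\<^bsub>M\<^esub> p \<in> carrier M" by (rule M.smult_closed[OF a p])
      have "k (Q.op (S.MN.pt a b) (Q.pt p x)) = \<kappa> (a \<odot>\<^bsub>M\<^esub> p) (act B b \<delta> \<odot>\<^bsub>N\<^esub> x)"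
        using Q.op_pure[OF a b \<delta> pd, of x] x kpt[OF ap bx] by simp
      also have "\<dots> = fsum E (\<lambda>h. S.MN.pt a b \<odot>\<^bsub>E\<^esub> (left_el (c p h) \<odot>\<^bsub>E\<^esub> \<Lambda> h x)) H"
        unfolding \<kappa>_def
      proof (rule E.M.fsum_cong)
        fix h assume h: "h \<in> H"
        show "left_el (c (a \<odot>\<^bsub>M\<^esub> p) h) \<odot>\<^bsub>E\<^esub> \<Lambda> h (act B b \<delta> \<odot>\<^bsub>N\<^esub> x) \<in> carrier E" by (rule \<kappa>term[OF ap bx h])
        show "left_el (c (a \<odot>\<^bsub>M\<^esub> p) h) \<odot>\<^bsub>E\<^esub> \<Lambda> h (act B b \<delta> \<odot>\<^bsub>N\<^esub> x) =
            S.MN.pt a b \<odot>\<^bsub>E\<^esub> (left_el (c p h) \<odot>\<^bsub>E\<^esub> \<Lambda> h x)"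
          unfolding c(5)[OF a p] by (rule key[OF a b \<delta> h x cdeg[OF \<delta> pd h]])
      qed
      also have "\<dots> = S.MN.pt a b \<odot>\<^bsub>E\<^esub> \<kappa> p x"
        unfolding \<kappa>_def
        by (rule additive_fsum[OF abE abE E.smult_additive[OF ptc] \<kappa>fin[OF p x] \<kappa>term[OF p x], symmetric])
      finally show "k (Q.op (S.MN.pt a b) (Q.pt p x)) = S.MN.pt a b \<odot>\<^bsub>E\<^esub> k (Q.pt p x)" by (simp add: kpt[OF p x])
    qed
  qed
  have kpart: "k t \<in> part E \<delta>" if \<delta>: "\<delta> \<in> carrier \<Gamma>" and t: "t \<in> Q.deg_part \<delta>" for \<delta> t
  proof -
    have "Q.deg_part \<delta> \<subseteq> {t \<in> carrier V. k t \<in> part E \<delta>}"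
    proof (rule Q.deg_part_subset[OF subgroup_vimage[OF Q.MN.abelian_group_T abE ka EG.part_subgroup[OF \<delta>]]])
      fix p x assume pd: "p \<in> part M \<delta>" and "x \<in> carrier (base_module B N)"
      then have x: "x \<in> carrier N" and p: "p \<in> carrier M" using Q.grp.part_carrier[OF \<delta>] by auto
      have "\<kappa> p x \<in> part E \<delta>"
        unfolding \<kappa>_def
      proof (rule E.M.fsum_in_subgroup[OF EG.part_subgroup[OF \<delta>]])
        fix h assume h: "h \<in> H"
        have "A.coarse_part (dg h) \<delta> \<subseteq> {a \<in> carrier A. left_el a \<odot>\<^bsub>E\<^esub> \<Lambda> h x \<in> part E \<delta>}"
        proof (rule A.coarse_part_subset[OF subgroup_vimage[OF abA abE ladd[OF \<Lambda>c[OF h x]] EG.part_subgroup[OF \<delta>]]], rule)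
          fix \<epsilon> y assume \<epsilon>: "\<epsilon> \<in> carrier \<Gamma>" and ed: "\<epsilon> \<otimes>\<^bsub>\<Gamma>\<^esub> dg h = \<delta>" and y: "y \<in> part A \<epsilon>"
          show "y \<in> {a \<in> carrier A. left_el a \<odot>\<^bsub>E\<^esub> \<Lambda> h x \<in> part E \<delta>}"
            using E.part_smult[OF \<epsilon> dgH(1)[OF h] left_el_part[OF \<epsilon> y] \<Lambda>part[OF h x]] ed S.grp.part_carrier[OF \<epsilon> y] by simp
        qed
        then show "left_el (c p h) \<odot>\<^bsub>E\<^esub> \<Lambda> h x \<in> part E \<delta>" using cdeg[OF \<delta> pd h] by auto
      qed
      then show "Q.pt p x \<in> {t \<in> carrier V. k t \<in> part E \<delta>}" using p x by (simp add: Q.MN.pt_closed kpt)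
    qed
    then show ?thesis using t by auto
  qed
  show "\<exists>h. graded_map \<Gamma> SA SM E h \<and> (\<forall>p\<in>carrier SM. g (h p) = f p)"
  proof (intro exI conjI ballI)
    show "graded_map \<Gamma> SA SM E k"
      unfolding graded_map_def
    proof (intro conjI ballI linear_mapI)
      show "additive_map SM E k" using ka by (simp add: additive_map_def SM_simps)
      show "k (s \<odot>\<^bsub>SM\<^esub> t) = s \<odot>\<^bsub>E\<^esub> k t" if "s \<in> carrier SA" "t \<in> carrier SM" for s t
        using klin that by (simp add: SA_simps SM_simps)
      show "k ` part SM \<gamma> \<subseteq> part E \<gamma>" if "\<gamma> \<in> carrier \<Gamma>" for \<gamma>
        using kpart[OF that] by (auto simp: SM_simps)
    qed
    show "g (k t) = f t" if "t \<in> carrier SM" for t using gk that by (simp add: SM_simps)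
  qed
qed

end

section \<open>Minimal projective resolutions\<close>

lemma tensor_map_image:
  fixes R :: "('r, 'x) ring_scheme" and M :: "('r, 'm, 'y) module_scheme"
    and M' :: "('r, 'l, 'v) module_scheme" and N :: "('r, 'n, 'z) module_scheme"
  assumes M: "module R M" and M': "module R M'" and N: "module R N" and f: "linear_map R M M' f"
  shows "tensor_map R M' N f ` carrier (tensor R M N) =
    generate (add_monoid (tensor R M' N)) {pure_tensor R M' N k n | k n. k \<in> f ` carrier M \<and> n \<in> carrier N}"
    (is "?f ` carrier ?T = generate _ ?P")
proof
  interpret MN: tensor_pair R M N by (rule tensor_pairI[OF M N])
  interpret M'N: tensor_pair R M' N by (rule tensor_pairI[OF M' N])
  note ad = tensor_map_additive[OF M M' N f]
  have sub: "?P \<subseteq> carrier M'N.T" using linear_map_closed[OF f] by (auto simp: M'N.pt_closed)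
  show "generate (add_monoid M'N.T) ?P \<subseteq> ?f ` carrier ?T"
  proof (rule generate_add_subset[OF M'N.abelian_group_T])
    show "subgroup (?f ` carrier ?T) (add_monoid M'N.T)"
      using subgroup_image[OF MN.abelian_group_T M'N.abelian_group_T ad, of "carrier ?T"]
        MN.T.add.subgroup_self by simp
    show "?P \<subseteq> ?f ` carrier ?T"
    proof
      fix y assume "y \<in> ?P"
      then obtain m n where mn: "m \<in> carrier M" "n \<in> carrier N" "y = M'N.pt (f m) n" by blast
      then have "y = ?f (MN.pt m n)" by (simp add: tensor_map_pure[OF M M' N f])
      then show "y \<in> ?f ` carrier ?T" using MN.pt_closed[OF mn(1,2)] by blast
    qed
  qed
  have "{t \<in> carrier ?T. ?f t \<in> generate (add_monoid M'N.T) ?P} = carrier ?T"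
    by (rule MN.tensor_subgroup_eqI[OF subgroup_vimage[OF MN.abelian_group_T M'N.abelian_group_T ad
            subgroup_generate_add[OF M'N.abelian_group_T sub]]])
      (auto simp: MN.pt_closed tensor_map_pure[OF M M' N f] intro!: generate.incl)
  then show "?f ` carrier ?T \<subseteq> generate (add_monoid M'N.T) ?P" by auto
qed

lemma graded_submodule_kernel:
  assumes M: "graded_module R \<Gamma> A M" and M': "graded_module R \<Gamma> A M'" and f: "graded_map \<Gamma> A M M' f"
  shows "graded_submodule R \<Gamma> A (kernel_of M M' f) M"
proof (rule graded_submoduleI[OF M])
  interpret M: graded_module R \<Gamma> A M by fact
  interpret M': graded_module R \<Gamma> A M' by fact
  have fl: "linear_map A M M' f" and fp: "\<And>\<gamma>. \<gamma> \<in> carrier \<Gamma> \<Longrightarrow> f ` part M \<gamma> \<subseteq> part M' \<gamma>"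
    using f by (auto simp: graded_map_def)
  note fa = linear_map_additive[OF fl]
  have "subgroup {x \<in> carrier M. f x \<in> {\<zero>\<^bsub>M'\<^esub>}} (add_monoid M)"
    by (rule subgroup_vimage[OF M.M.abelian_group_axioms M'.M.abelian_group_axioms fa])
      (use M'.M.add.triv_subgroup in simp)
  then show "subgroup (kernel_of M M' f) (add_monoid M)" by (simp add: kernel_of_def)
  show "a \<odot>\<^bsub>M\<^esub> x \<in> kernel_of M M' f" if "a \<in> carrier A" "x \<in> kernel_of M M' f" for a x
    using that linear_map_smult[OF fl] M.smult_closed
      additive_zero[OF M'.M.abelian_group_axioms M'.M.abelian_group_axioms M'.smult_additive]
    by (auto simp: kernel_of_def)
  show "homog_comp \<Gamma> M x \<gamma> \<in> kernel_of M M' f" if x: "x \<in> kernel_of M M' f" and \<gamma>: "\<gamma> \<in> carrier \<Gamma>" for x \<gamma>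
  proof -
    interpret G: graded_group \<Gamma> M by (rule M.graded_group_M)
    interpret G': graded_group \<Gamma> M' by (rule M'.graded_group_M)
    have xc: "x \<in> carrier M" "f x = \<zero>\<^bsub>M'\<^esub>" using x by (auto simp: kernel_of_def)
    have "f (homog_comp \<Gamma> M x \<gamma>) = homog_comp \<Gamma> M' \<zero>\<^bsub>M'\<^esub> \<gamma>"
      using graded_map_comp[OF M.graded_group_M M'.graded_group_M fa fp xc(1) \<gamma>] xc(2) by simp
    also have "\<dots> = \<zero>\<^bsub>M'\<^esub>"
      by (rule additive_zero[OF M'.M.abelian_group_axioms M'.M.abelian_group_axioms G'.comp_additive[OF \<gamma>]])
    finally show ?thesis using G.comp_closed[OF xc(1) \<gamma>] by (simp add: kernel_of_def)
  qed
qed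

theorem theorem3p5:
  fixes R :: "'r ring"
    and \<Gamma> :: "'g monoid"
    and A :: "('r, 'a, 'g) graded"
    and B :: "('r, 'b, 'g) acted"
    and N :: "('b, 'n) module"
    and M :: "('a, 'm, 'g) graded"
    and P :: "int \<Rightarrow> ('a, 'm, 'g) graded"
    and d :: "int \<Rightarrow> 'm \<Rightarrow> 'm"
  assumes "cring R"
    and "monoid \<Gamma>"
    and "graded_algebra R \<Gamma> A"
    and "monoid_algebra_action R \<Gamma> B"
    and "left_module B N"
    and "flat_module TYPE(('r, 'm) test) R (base_module B N)"
    and "finitely_generated R (base_module B N)"
    and "\<And>\<beta>. \<beta> \<in> carrier \<Gamma> \<Longrightarrow>
           projective_module TYPE(('b, 'n) test) B (twisted_module B \<beta> N)"
    and "graded_module R \<Gamma> A M"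
    and "minimal_projective_resolution TYPE(('a, 'm) test) R \<Gamma> A M P d"
  shows "minimal_projective_resolution TYPE('u) R \<Gamma> (smash_algebra R \<Gamma> A B)
           (smash_module R \<Gamma> A B N M)
           (\<lambda>k. smash_module R \<Gamma> A B N (P k))
           (\<lambda>k. smash_map R A B N (P k) (d k))"
proof -
  let ?N = "base_module B N"
  let ?P = "\<lambda>k. base_module A (P k)"
  have res: "projective_resolution TYPE(('a, 'm) test) R \<Gamma> A M P d"
    and minimal: "\<And>k. k \<ge> -1 \<Longrightarrow> superfluous R \<Gamma> A (kernel_of (P (k + 1)) (P k) (d k)) (P (k + 1))"
    using assms(10) by (auto simp: minimal_projective_resolution_def)
  have augmented: "P (-1) = M"
    and graded: "\<And>k. k \<ge> -1 \<Longrightarrow> graded_module R \<Gamma> A (P k)"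
    and diff: "\<And>k. k \<ge> -1 \<Longrightarrow> graded_map \<Gamma> A (P (k + 1)) (P k) (d k)"
    and surj: "d (-1) ` carrier (P 0) = carrier (P (-1))"
    and exact: "\<And>k. k \<ge> -1 \<Longrightarrow> d (k + 1) ` carrier (P (k + 2)) = kernel_of (P (k + 1)) (P k) (d k)"
    and projective: "\<And>k. k \<ge> 0 \<Longrightarrow> graded_projective TYPE(('a, 'm) test) R \<Gamma> A (P k)"
    using res by (simp_all add: projective_resolution_def)
  have setting: "smash_module_setting R \<Gamma> A B (P k) N" if "k \<ge> -1" for k
    by (intro smash_module_setting.intro smash_setting.intro assms(3-5) graded[OF that])
  have modP: "module R (?P k)" if "k \<ge> -1" for k
    by (rule graded_module.module_base_M[OF graded[OF that]])
  have modN: "module R ?N" using assms(6) by (simp add: flat_module_def)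
  have lin: "linear_map R (?P (k + 1)) (?P k) (d k)" if k: "k \<ge> -1" for k
  proof -
    interpret A: graded_algebra R \<Gamma> A by (rule assms(3))
    show ?thesis using diff[OF k] by (auto simp: graded_map_def linear_map_def)
  qed
  have gm: "graded_module R \<Gamma> (smash_algebra R \<Gamma> A B) (smash_module R \<Gamma> A B N (P k))" if "k \<ge> -1" for k
    by (rule smash_module_setting.graded_module_SM[OF setting[OF that]])
  have gmap: "graded_map \<Gamma> (smash_algebra R \<Gamma> A B) (smash_module R \<Gamma> A B N (P (k + 1)))
      (smash_module R \<Gamma> A B N (P k)) (smash_map R A B N (P k) (d k))" if k: "k \<ge> -1" for k
    by (rule graded_map_smash[OF assms(4,5) graded graded[OF k] diff[OF k]]) (use k in simp)
  have car: "carrier (smash_module R \<Gamma> A B N (P k)) = carrier (tensor R (?P k) ?N)"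
    "\<zero>\<^bsub>smash_module R \<Gamma> A B N (P k)\<^esub> = \<zero>\<^bsub>tensor R (?P k) ?N\<^esub>" for k
    by (simp_all add: smash_module_def Let_def)
  have smap: "smash_map R A B N (P k) (d k) = tensor_map R (?P k) ?N (d k)" for k
    by (simp add: smash_map_def[abs_def])
  \<comment> \<open>the kernels of the given resolution, and the span \<open>Y k\<close> of \<open>Z k \<otimes> N\<close>, which is both the kernel and
      the image at the corresponding place of the new complex\<close>
  define Z where "Z k = kernel_of (P (k + 1)) (P k) (d k)" for k
  define Y where "Y k = generate (add_monoid (tensor R (?P (k + 1)) ?N))
      {pure_tensor R (?P (k + 1)) ?N z n | z n. z \<in> Z k \<and> n \<in> carrier N}" for k
  have ker: "kernel_of (smash_module R \<Gamma> A B N (P (k + 1))) (smash_module R \<Gamma> A B N (P k))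
      (smash_map R A B N (P k) (d k)) = Y k" if k: "k \<ge> -1" for k
  proof -
    have k1: "k + 1 \<ge> -1" using k by simp
    have "kernel_of (?P (k + 1)) (?P k) (d k) = Z k" by (simp add: kernel_of_def Z_def)
    then show ?thesis
      using kernel_tensor_map_flat[OF assms(6) modP[OF k1] modP[OF k] lin[OF k]]
      by (simp add: kernel_of_def car smap Y_def)
  qed
  have img: "smash_map R A B N (P (k + 1)) (d (k + 1)) ` carrier (smash_module R \<Gamma> A B N (P (k + 2))) = Y k"
    if k: "k \<ge> -1" for k
  proof -
    have k1: "k + 1 \<ge> -1" and k2: "k + 2 \<ge> -1" and e: "k + 1 + 1 = k + 2" using k by simp_all
    show ?thesis
      using tensor_map_image[OF modP[OF k2] modP[OF k1] modN lin[OF k1, unfolded e]] exact[OF k]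
      by (simp add: car smap Y_def Z_def)
  qed
  have surj': "smash_map R A B N (P (-1)) (d (-1)) ` carrier (smash_module R \<Gamma> A B N (P 0)) =
      carrier (smash_module R \<Gamma> A B N (P (-1)))"
    using tensor_map_surj[OF modP[of 0] modP[of "-1"] modN, of "d (-1)"] lin[of "-1"] surj
    by (simp add: car smap)
  have proj': "graded_projective TYPE('u) R \<Gamma> (smash_algebra R \<Gamma> A B) (smash_module R \<Gamma> A B N (P k))"
    if k: "k \<ge> 0" for k
  proof -
    interpret S: smash_module_setting R \<Gamma> A B "P k" N by (rule setting) (use k in simp)
    obtain H dg c where "S.A.graded_dual_basis (P k) H dg c"
      using S.A.graded_projective_dual_basis[OF projective[OF k]] by blast
    moreover have "\<exists>c. dual_basis B (twisted_module B \<beta> N) (carrier N) c" if "\<beta> \<in> carrier \<Gamma>" for \<beta>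
      using projective_dual_basis[OF assms(8)[OF that]] by (simp add: twisted_module_def)
    then obtain \<psi> where "\<And>\<beta>. \<beta> \<in> carrier \<Gamma> \<Longrightarrow> dual_basis B (twisted_module B \<beta> N) (carrier N) (\<psi> \<beta>)" by metis
    ultimately show ?thesis by (rule S.graded_projective_smash)
  qed
  have minimal': "superfluous R \<Gamma> (smash_algebra R \<Gamma> A B)
      (kernel_of (smash_module R \<Gamma> A B N (P (k + 1))) (smash_module R \<Gamma> A B N (P k)) (smash_map R A B N (P k) (d k)))
      (smash_module R \<Gamma> A B N (P (k + 1)))" if k: "k \<ge> -1" for k
  proof -
    have k1: "k + 1 \<ge> -1" using k by simp
    interpret S: smash_module_setting R \<Gamma> A B "P (k + 1)" N by (rule setting[OF k1])
    have Y: "Y k = S.span_over (Z k) (carrier N)" by (simp add: Y_def S.span_over_def)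
    have "graded_submodule R \<Gamma> S.SA (S.span_over (Z k) (carrier N)) S.SM"
      using graded_submodule_kernel[OF gm[OF k1] gm[OF k] gmap[OF k]] ker[OF k] Y by simp
    then have "superfluous R \<Gamma> S.SA (S.span_over (Z k) (carrier N)) S.SM"
      using S.superfluous_smash[OF minimal[OF k, folded Z_def] assms(7)] by simp
    then show ?thesis using ker[OF k] Y by simp
  qed
  show ?thesis
    unfolding minimal_projective_resolution_def projective_resolution_def
    using augmented gm gmap surj' img ker proj' minimal' by (simp add: add.commute)
qed

end
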